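(* Assume that the class $\mathcal{L}$ of regular languages over $\mathbb{A}^\pm$ is closed under sublanguages. For any $k>1$ and any query $\Gamma\in\mathrm{UC2RPQ}(\mathcal{L})$, the following are equivalent: (1) $\Gamma$ is equivalent to an infinitary union of conjunctive queries of tree-width at most $k$; (2) $\Gamma$ has semantic tree-width at most $k$; (3) $\Gamma$ is equivalent to a query in $\mathrm{UC2RPQ}(\mathcal{L})$ of tree-width at most $k$.
   Context: Fix a finite alphabet $\mathbb{A}$. A graph database $G$ is a finite directed edge-labelled graph with node set $V(G)$ and edge set $E(G)\subseteq V(G)\times\mathbb{A}\times V(G)$. Let $\mathbb{A}^\pm=\mathbb{A}\cup\{a^-: a\in\mathbb{A}\}$, and let $G^\pm$ be obtained from $G$ by adding an edge $y\xrightarrow{a^-}x$ for every edge $x\xrightarrow{a}y$ of $G$. A C2RPQ $\gamma(z_1,\dots,z_n)$ consists of a tuple of output variables (repetitions allowed) and a finite conjunction $\bigwedge_{j=1}^m x_j\xrightarrow{L_j}y_j$ ($m\ge 0$) of atoms, each $L_j$ being a regular language over $\mathbb{A}^\pm$ given by an NFA; non-output variables are existentially quantified. A conjunctive query (CQ) is a C2RPQ each of whose languages is $\{a\}$ for a letter $a\in\mathbb{A}$. A tuple $(u_1,\dots,u_n)$ of nodes satisfies $\gamma$ on $G$ if there is a map $f$ from the variables of $\gamma$ to $V(G)$ with $f(z_i)=u_i$ for all $i$ and such that for every $j$ there is a (possibly empty) directed path in $G^\pm$ from $f(x_j)$ to $f(y_j)$ labelled by a word of $L_j$. A UC2RPQ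 is a finite set of C2RPQs with the same output arity, interpreted as a union; infinitary unions are defined in the same way but allowing potentially infinite sets. Two (unions of) queries are equivalent if they are satisfied by the same tuples on every graph database. The tree-width of a C2RPQ is that of its underlying multigraph (vertices are the variables, one edge per atom); that of a UC2RPQ is the maximum over its C2RPQs. A UC2RPQ has semantic tree-width at most $k$ if it is equivalent to a UC2RPQ of tree-width at most $k$. $\mathrm{UC2RPQ}(\mathcal{L})$ is the class of UC2RPQs all of whose atoms are labelled by languages from $\mathcal{L}$. For an NFA $\mathcal{A}$ and states $q,q'$, $\mathcal{A}[q,q']$ denotes the language recognized by $\mathcal{A}$ with $\{q\}$ as set of initial states and $\{q'\}$ as set of final states. $\mathcal{L}$ is closed under sublanguages if (i) it contains every language $\{a\}$, where $a\in\mathbb{A}$ is any letter such that $a$ or $a^-$ occurs in a word of a language of $\mathcal{L}$, and (ii) for every $L\in\mathcal{L}$ there is an NFA $\mathcal{A}_L$ accepting $L$ such that every language $\mathcal{A}_L[q,q']$ distinct from $\emptyset$ and $\{\varepsilon\}$ belongs to $\mathcal{L}$. *)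

theory Defs
  imports "Graph_Theory.Graph_Theory"
begin

section \<open>Words and regular languages over an alphabet with inverses\<close>

text \<open>The alphabet is a type \<open>'a\<close>, and \<open>Inv a\<close> is the letter \<open>a\<^sup>-\<close>.\<close>

datatype 'a letter = Fwd 'a | Inv 'a

type_synonym 'l lang = "'l list set"

fun lpath :: "('s \<times> 'l \<times> 's) set \<Rightarrow> 's \<Rightarrow> 'l list \<Rightarrow> 's \<Rightarrow> bool" where
  "lpath E u [] v \<longleftrightarrow> u = v"
| "lpath E u (l # w) v \<longleftrightarrow> (\<exists>t. (u, l, t) \<in> E \<and> lpath E t w v)"

record ('q, 'l) nfa =
  states :: "'q set"
  init :: "'q set"
  final :: "'q set"
  delta :: "('q \<times> 'l \<times> 'q) set"

definition wf_nfa :: "('q, 'l) nfa \<Rightarrow> bool" where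
  "wf_nfa A \<longleftrightarrow> finite (states A) \<and> init A \<subseteq> states A \<and> final A \<subseteq> states A
     \<and> finite (delta A) \<and> delta A \<subseteq> states A \<times> UNIV \<times> states A"

definition nfa_lang :: "('q, 'l) nfa \<Rightarrow> 'l lang" where
  "nfa_lang A = {w. \<exists>q\<in>init A. \<exists>q'\<in>final A. lpath (delta A) q w q'}"

text \<open>Every finite automaton can be renamed to have natural numbers as states.\<close>

definition regular :: "'l lang \<Rightarrow> bool" where
  "regular L \<longleftrightarrow> (\<exists>A :: (nat, 'l) nfa. wf_nfa A \<and> nfa_lang A = L)"

definition sub_nfa :: "('q, 'l) nfa \<Rightarrow> 'q \<Rightarrow> 'q \<Rightarrow> ('q, 'l) nfa" where
  "sub_nfa A q q' = A\<lparr>init := {q}, final := {q'}\<rparr>"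

definition closed_under_sublanguages :: "'a letter lang set \<Rightarrow> bool" where
  "closed_under_sublanguages \<L> \<longleftrightarrow>
     (\<forall>a. (\<exists>L\<in>\<L>. \<exists>w\<in>L. Fwd a \<in> set w \<or> Inv a \<in> set w) \<longrightarrow> {[Fwd a]} \<in> \<L>) \<and>
     (\<forall>L\<in>\<L>. \<exists>A :: (nat, 'a letter) nfa. wf_nfa A \<and> nfa_lang A = L \<and>
        (\<forall>q\<in>states A. \<forall>q'\<in>states A.
           nfa_lang (sub_nfa A q q') \<noteq> {} \<and> nfa_lang (sub_nfa A q q') \<noteq> {[]}
             \<longrightarrow> nfa_lang (sub_nfa A q q') \<in> \<L>))"


section \<open>Graph databases\<close>

record ('v, 'a) graph_db =
  nodes :: "'v set"
  edges :: "('v \<times> 'a \<times> 'v) set"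

definition wf_graph_db :: "('v, 'a) graph_db \<Rightarrow> bool" where
  "wf_graph_db G \<longleftrightarrow> finite (nodes G) \<and> finite (edges G) \<and> edges G \<subseteq> nodes G \<times> UNIV \<times> nodes G"

definition edges_pm :: "('v, 'a) graph_db \<Rightarrow> ('v \<times> 'a letter \<times> 'v) set" where
  "edges_pm G = {(x, Fwd a, y) | x a y. (x, a, y) \<in> edges G}
              \<union> {(y, Inv a, x) | x a y. (x, a, y) \<in> edges G}"


section \<open>Queries\<close>

datatype 'a atom = Atom (source: nat) (lang: "'a letter lang") (target: nat)

text \<open>
  The variables of a query are an explicit finite set of natural numbers containing every output
  variable and every variable of an atom. A further existential variable is redundant on every
  database with at least one node; it matters for Boolean queries on the database without nodes.
  There \<open>\<exists>x. x \<rightarrow> x\<close>, with an atom language containing the empty word, is false, and only because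
  of isolated variables is it a union of conjunctive queries.
\<close>

record 'a c2rpq =
  outs :: "nat list"
  vars :: "nat set"
  atoms :: "'a atom list"

definition wf_c2rpq :: "'a c2rpq \<Rightarrow> bool" where
  "wf_c2rpq \<gamma> \<longleftrightarrow> finite (vars \<gamma>) \<and> set (outs \<gamma>) \<subseteq> vars \<gamma> \<and>
     (\<forall>\<alpha>\<in>set (atoms \<gamma>). source \<alpha> \<in> vars \<gamma> \<and> target \<alpha> \<in> vars \<gamma> \<and> regular (lang \<alpha>))"

definition is_cq :: "'a c2rpq \<Rightarrow> bool" where
  "is_cq \<gamma> \<longleftrightarrow> wf_c2rpq \<gamma> \<and> (\<forall>\<alpha>\<in>set (atoms \<gamma>). \<exists>a. lang \<alpha> = {[Fwd a]})"

definition satisfies :: "('v, 'a) graph_db \<Rightarrow> 'v list \<Rightarrow> 'a c2rpq \<Rightarrow> bool" where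
  "satisfies G us \<gamma> \<longleftrightarrow>
     (\<exists>f. f ` vars \<gamma> \<subseteq> nodes G \<and> map f (outs \<gamma>) = us \<and>
        (\<forall>\<alpha>\<in>set (atoms \<gamma>). \<exists>w\<in>lang \<alpha>. lpath (edges_pm G) (f (source \<alpha>)) w (f (target \<alpha>))))"

definition infinitary_union :: "'a c2rpq set \<Rightarrow> bool" where
  "infinitary_union \<Gamma> \<longleftrightarrow>
     (\<forall>\<gamma>\<in>\<Gamma>. wf_c2rpq \<gamma>) \<and> (\<exists>n. \<forall>\<gamma>\<in>\<Gamma>. length (outs \<gamma>) = n)"

definition UC2RPQ :: "'a c2rpq set set" where
  "UC2RPQ = {\<Gamma>. finite \<Gamma> \<and> infinitary_union \<Gamma>}"

definition UC2RPQ_over :: "'a letter lang set \<Rightarrow> 'a c2rpq set set" where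
  "UC2RPQ_over \<L> = {\<Gamma> \<in> UC2RPQ. \<forall>\<gamma>\<in>\<Gamma>. \<forall>\<alpha>\<in>set (atoms \<gamma>). lang \<alpha> \<in> \<L>}"

definition satisfies_union :: "('v, 'a) graph_db \<Rightarrow> 'v list \<Rightarrow> 'a c2rpq set \<Rightarrow> bool" where
  "satisfies_union G us \<Gamma> \<longleftrightarrow> (\<exists>\<gamma>\<in>\<Gamma>. satisfies G us \<gamma>)"

text \<open>Every finite graph database is isomorphic to one whose nodes are natural numbers.\<close>

definition equivalent :: "'a c2rpq set \<Rightarrow> 'a c2rpq set \<Rightarrow> bool" where
  "equivalent \<Gamma> \<Delta> \<longleftrightarrow>
     (\<forall>G :: (nat, 'a) graph_db. wf_graph_db G \<longrightarrow>
        (\<forall>us. satisfies_union G us \<Gamma> \<longleftrightarrow> satisfies_union G us \<Delta>))"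


section \<open>Tree-width\<close>

text \<open>
  An undirected graph is a symmetric digraph (\<open>pair_graph\<close>), in which an edge traversed back and
  forth is a cycle of two arcs. Hence the constant \<open>tree\<close> of the library cannot be used here.
\<close>

definition undirected_tree :: "'t pair_pre_digraph \<Rightarrow> bool" where
  "undirected_tree T \<longleftrightarrow> pair_graph T \<and> connected (with_proj T) \<and>
     \<not> (\<exists>p. pre_digraph.cycle (with_proj T) p \<and> length p \<ge> 3)"

text \<open>\<open>connected\<close> includes that the set of vertices is nonempty.\<close>

definition tree_decomposition ::
    "('v, 'e) pre_digraph \<Rightarrow> 't pair_pre_digraph \<Rightarrow> ('t \<Rightarrow> 'v set) \<Rightarrow> bool" where
  "tree_decomposition H T bag \<longleftrightarrow> undirected_tree T \<and>
     (\<forall>t\<in>pverts T. bag t \<subseteq> verts H) \<and>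
     (\<forall>e\<in>arcs H. \<exists>t\<in>pverts T. tail H e \<in> bag t \<and> head H e \<in> bag t) \<and>
     (\<forall>v\<in>verts H. connected (with_proj T \<restriction> {t \<in> pverts T. v \<in> bag t}))"

text \<open>
  The subtraction only truncates if all bags are empty, so that the graph without vertices has
  tree-width 0 here instead of -1.
\<close>

definition width :: "'t pair_pre_digraph \<Rightarrow> ('t \<Rightarrow> 'v set) \<Rightarrow> nat" where
  "width T bag = Max ((\<lambda>t. card (bag t)) ` pverts T) - 1"

definition tree_width :: "('v, 'e) pre_digraph \<Rightarrow> nat" where
  "tree_width H = (LEAST w. \<exists>(T :: nat pair_pre_digraph) bag.
     tree_decomposition H T bag \<and> width T bag = w)"

definition underlying_multigraph :: "'a c2rpq \<Rightarrow> (nat, nat) pre_digraph" where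
  "underlying_multigraph \<gamma> = \<lparr>
     verts = vars \<gamma>,
     arcs = {..<length (atoms \<gamma>)},
     tail = (\<lambda>j. source (atoms \<gamma> ! j)),
     head = (\<lambda>j. target (atoms \<gamma> ! j))\<rparr>"

definition c2rpq_tree_width :: "'a c2rpq \<Rightarrow> nat" where
  "c2rpq_tree_width \<gamma> = tree_width (underlying_multigraph \<gamma>)"

text \<open>For a finite nonempty set of naturals the supremum is the maximum; for the empty set it is 0.\<close>

definition uc2rpq_tree_width :: "'a c2rpq set \<Rightarrow> nat" where
  "uc2rpq_tree_width \<Gamma> = (SUP \<gamma>\<in>\<Gamma>. c2rpq_tree_width \<gamma>)"

definition semantic_tree_width_at_most :: "'a c2rpq set \<Rightarrow> nat \<Rightarrow> bool" where
  "semantic_tree_width_at_most \<Gamma> k \<longleftrightarrow>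
     (\<exists>\<Delta>\<in>UC2RPQ. equivalent \<Gamma> \<Delta> \<and> uc2rpq_tree_width \<Delta> \<le> k)"

end

(*
  Let a conjunctive query delta of tree-width at most k be contained in Gamma. Then some gamma in Gamma
  maps into delta, every atom of gamma becoming a walk in delta that is labelled by a run of an
  automaton. Keeping only some of the times of each walk, its ends among them, and reading off the
  sublanguages A[q, q'] between consecutive times, one obtains a query alpha between delta and gamma.
  So it suffices to short-cut the walks to a length bounded in terms of gamma and k, keeping tree-width
  at most k: up to renaming there are then only finitely many alpha, and their union is the query of (3).

  For this take a rooted tree decomposition with as few nodes as possible, over all choices of times.
  Each tree edge separates the ends of the walks into two sets. Tree edges with the same separation lie
  on a chain, and if two far apart edges of a chain moreover have the same pattern of coincidences among
  the first visits of the crossing walks, then the part between them can be replaced by a ladder of at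
  most k + 1 nodes: each walk jumps from its first visit of the upper adhesion set to its first visit of
  the lower one, and as the patterns agree these jumps form a function between the two adhesion sets.
  Since this contradicts minimality, the decomposition has bounded size.

  Conversely, a query of tree-width at most k >= 2 is the union of its expansions, where subdividing an
  edge {x, y} by a vertex z only needs a new bag {x, y, z}.
*)
theory Submission
  imports Defs "HOL-Library.Sublist"
begin

section \<open>Rooted tree decompositions\<close>

text \<open>Two tree edges with the same pattern cannot be glued by identifying their adhesion sets:
  distinct vertices of delta would be merged, and an assignment for delta would no longer give one
  for alpha. So vertices may be dropped but never merged, and the ladder has to lead from one set to
  the other. What makes this possible is that a step of a walk needs no edge of delta, only a common
  bag: words along a skipped stretch are concatenated, and bags see vertices but not automaton
  states.

  First visits are used because a walk may cross an adhesion set many times; one jump between first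
  visits replaces everything between them, and later returns are filtered out. The jumps must fit
  into bags of k + 1 vertices. In a minimal decomposition an adhesion set has at most k vertices, as
  otherwise the lower node could be contracted into its parent. The free place serves to exchange
  the vertices of the upper set one at a time.

  Only the number of nodes is minimized. Lengths of walks are bounded afterwards, since a walk needs
  each bag for at most one step.\<close>

definition parent_rel :: "'n set \<Rightarrow> 'n \<Rightarrow> ('n \<Rightarrow> 'n) \<Rightarrow> 'n rel" where
  "parent_rel N r p = {(t, p t) | t. t \<in> N \<and> t \<noteq> r}"

definition is_top :: "'n \<Rightarrow> ('n \<Rightarrow> 'n) \<Rightarrow> ('n \<Rightarrow> 'v set) \<Rightarrow> 'v \<Rightarrow> 'n \<Rightarrow> bool" where
  "is_top r p bag v t \<longleftrightarrow> v \<in> bag t \<and> (t = r \<or> v \<notin> bag (p t))"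

text \<open>Uniqueness of the top node expresses that the nodes whose bag contains \<open>v\<close> form a subtree.\<close>

locale rooted_td =
  fixes N :: "'n set" and r :: 'n and p :: "'n \<Rightarrow> 'n" and bag :: "'n \<Rightarrow> 'v set"
  assumes fin: "finite N"
    and root: "r \<in> N"
    and par: "\<And>t. t \<in> N \<Longrightarrow> t \<noteq> r \<Longrightarrow> p t \<in> N"
    and reach: "\<And>t. t \<in> N \<Longrightarrow> (t, r) \<in> (parent_rel N r p)\<^sup>*"
    and top_unique: "\<And>v s t. s \<in> N \<Longrightarrow> t \<in> N \<Longrightarrow> is_top r p bag v s \<Longrightarrow> is_top r p bag v t \<Longrightarrow> s = t"
begin

abbreviation "E \<equiv> parent_rel N r p"

definition "desc t = {s \<in> N. (s, t) \<in> E\<^sup>*}"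

lemma tree_induct [consumes 1, case_names root child]:
  assumes "t \<in> N" "P r" "\<And>s. s \<in> N \<Longrightarrow> s \<noteq> r \<Longrightarrow> P (p s) \<Longrightarrow> P s"
  shows "P t"
  using reach[OF assms(1)]
  by (induction rule: converse_rtrancl_induct) (use assms in \<open>auto simp: parent_rel_def\<close>)

lemma E_iff: "(s, t) \<in> E \<longleftrightarrow> s \<in> N \<and> s \<noteq> r \<and> t = p s"
  by (auto simp: parent_rel_def)

lemma E_stepD: "(s, t) \<in> E\<^sup>* \<Longrightarrow> s \<noteq> t \<Longrightarrow> s \<in> N \<and> s \<noteq> r \<and> (p s, t) \<in> E\<^sup>*"
  by (erule converse_rtranclE) (auto simp: E_iff)

lemma E_stepI: "s \<in> N \<Longrightarrow> s \<noteq> r \<Longrightarrow> (p s, t) \<in> E\<^sup>* \<Longrightarrow> (s, t) \<in> E\<^sup>*"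
  by (rule converse_rtrancl_into_rtrancl) (auto simp: E_iff)

lemma E_closed: "(s, t) \<in> E\<^sup>* \<Longrightarrow> s \<in> N \<Longrightarrow> t \<in> N"
  by (induction rule: rtrancl_induct) (auto simp: E_iff par)

lemma E_irrefl: "s \<in> N \<Longrightarrow> (s, s) \<notin> E\<^sup>+"
proof (induction rule: tree_induct)
  case root
  then show ?case by (auto dest!: tranclD simp: E_iff)
next
  case (child s)
  show ?case
  proof
    assume "(s, s) \<in> E\<^sup>+"
    then have "(p s, s) \<in> E\<^sup>*" by (auto dest!: tranclD simp: E_iff)
    moreover have "(s, p s) \<in> E" using child by (simp add: E_iff)
    ultimately show False using child by (metis rtrancl_into_trancl1)
  qed
qed

lemma E_antisym: "(s, t) \<in> E\<^sup>* \<Longrightarrow> (t, s) \<in> E\<^sup>* \<Longrightarrow> s = t"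
  by (metis E_irrefl E_stepD rtranclD trancl_rtrancl_trancl)

text \<open>A node has at most one parent, so its ancestors form a chain.\<close>

lemma E_comparable: "(s, t) \<in> E\<^sup>* \<Longrightarrow> (s, t') \<in> E\<^sup>* \<Longrightarrow> (t, t') \<in> E\<^sup>* \<or> (t', t) \<in> E\<^sup>*"
proof (induction rule: converse_rtrancl_induct)
  case (step y z)
  then show ?case by (metis E_iff E_stepD E_stepI rtrancl.rtrancl_refl)
qed auto

lemma desc_subset: "desc t \<subseteq> N" by (auto simp: desc_def)
lemma desc_self: "t \<in> N \<Longrightarrow> t \<in> desc t" by (auto simp: desc_def)
lemma desc_mono: "(s, t) \<in> E\<^sup>* \<Longrightarrow> desc s \<subseteq> desc t" by (auto simp: desc_def)
lemma desc_par: "s \<in> N \<Longrightarrow> s \<noteq> r \<Longrightarrow> p s \<in> desc t \<Longrightarrow> s \<in> desc t"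
  by (auto simp: desc_def intro: E_stepI)
lemma desc_parD: "s \<in> desc t \<Longrightarrow> s \<noteq> t \<Longrightarrow> s \<noteq> r \<and> p s \<in> desc t"
  using par by (auto simp: desc_def dest: E_stepD)
lemma root_desc: "t \<in> N \<Longrightarrow> r \<in> desc t \<Longrightarrow> t = r"
  by (auto simp: desc_def dest: E_antisym reach)
lemma par_not_desc: "t \<in> N \<Longrightarrow> t \<noteq> r \<Longrightarrow> p t \<notin> desc t"
  unfolding desc_def using E_irrefl[of t] by (auto simp: E_iff intro: rtrancl_into_trancl2)

lemma ex_top: "s \<in> N \<Longrightarrow> v \<in> bag s \<Longrightarrow> \<exists>u\<in>N. (s, u) \<in> E\<^sup>* \<and> is_top r p bag v u"
proof (induction rule: tree_induct)
  case root
  then show ?case using rooted_td.root[OF rooted_td_axioms] by (auto simp: is_top_def)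
next
  case (child s)
  show ?case
  proof (cases "v \<in> bag (p s)")
    case True
    then show ?thesis using child by (meson E_stepI)
  next
    case False
    then show ?thesis using child by (auto simp: is_top_def)
  qed
qed

text \<open>If \<open>v\<close> were missing from one of the two bags, climbing from
  \<open>s\<close> would meet a top of \<open>v\<close> no later than at \<open>t\<close>. Climbing
  from \<open>s'\<close> never enters \<open>desc t\<close> and yields a second top, against
  uniqueness.\<close>

lemma separation:
  assumes "s \<in> desc t" "v \<in> bag s" "s' \<in> N - desc t" "v \<in> bag s'" "t \<noteq> r"
  shows "v \<in> bag t \<inter> bag (p t)"
proof (rule ccontr)
  assume neg: "v \<notin> bag t \<inter> bag (p t)"
  have "(s, t) \<in> E\<^sup>*" "s \<in> N" using assms by (auto simp: desc_def)
  then have "\<exists>u\<in>desc t. is_top r p bag v u" using assms(2)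
  proof (induction rule: converse_rtrancl_induct)
    case base
    then show ?case using neg by (auto simp: is_top_def desc_def)
  next
    case (step y z)
    show ?case
    proof (cases "v \<in> bag z")
      case True
      then show ?thesis using step E_closed by blast
    next
      case False
      then have "is_top r p bag v y" using step by (auto simp: is_top_def E_iff)
      then show ?thesis using step by (auto simp: desc_def intro: converse_rtrancl_into_rtrancl)
    qed
  qed
  moreover obtain u where "u \<in> N" "(s', u) \<in> E\<^sup>*" "is_top r p bag v u"
    using ex_top assms by blast
  moreover have "u \<notin> desc t" using calculation assms by (auto simp: desc_def dest: rtrancl_trans)
  ultimately show False using top_unique desc_subset by (metis subsetD)
qed

section \<open>Cutting, contracting and gluing rooted tree decompositions\<close>

lemma rooted_td_minus_desc:
  assumes "t \<in> N" "t \<noteq> r"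
  shows "rooted_td (N - desc t) r p bag"
proof
  show "finite (N - desc t)" using fin by simp
  show "r \<in> N - desc t" using root root_desc assms by auto
  show "p s \<in> N - desc t" if "s \<in> N - desc t" "s \<noteq> r" for s
    using that par desc_par by blast
  show "(s, r) \<in> (parent_rel (N - desc t) r p)\<^sup>*" if "s \<in> N - desc t" for s
  proof -
    from that have "s \<in> N" by simp
    then have "s \<notin> desc t \<longrightarrow> ?thesis"
    proof (induction rule: tree_induct)
      case (child s)
      then show ?case
        by (auto simp: parent_rel_def intro: converse_rtrancl_into_rtrancl desc_par)
    qed simp
    with that show ?thesis by simp
  qed
qed (use top_unique in blast)

text \<open>As the new root, \<open>t\<close> becomes a top of every vertex in its bag. This causes
  no conflict: in the whole tree the top of such a vertex is \<open>t\<close> or lies above it, so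
  no other node below \<open>t\<close> is a top of it.\<close>

lemma rooted_td_desc:
  assumes "t \<in> N"
  shows "rooted_td (desc t) t p bag"
proof
  show "finite (desc t)" using fin desc_subset finite_subset by blast
  show "t \<in> desc t" using desc_self assms by simp
  show "p s \<in> desc t" if "s \<in> desc t" "s \<noteq> t" for s
    using that desc_parD by blast
  show "(s, t) \<in> (parent_rel (desc t) t p)\<^sup>*" if "s \<in> desc t" for s
  proof -
    from that have "(s, t) \<in> E\<^sup>*" "s \<in> N" by (auto simp: desc_def)
    then show ?thesis
    proof (induction rule: converse_rtrancl_induct)
      case (step y z)
      show ?case
      proof (cases "y = t")
        case False
        have "y \<in> desc t" using step by (auto simp: desc_def intro: converse_rtrancl_into_rtrancl)
        then have "(y, z) \<in> parent_rel (desc t) t p" using step False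
          by (auto simp: parent_rel_def E_iff)
        then show ?thesis using step E_closed by (meson converse_rtrancl_into_rtrancl r_into_rtrancl)
      qed simp
    qed simp
  qed
  have top_D: "is_top r p bag v s" if "is_top t p bag v s" "s \<noteq> t" "s \<in> desc t" for s v
    using that desc_parD by (auto simp: is_top_def)
  have key: False if top: "is_top t p bag v s" "s \<noteq> t" "s \<in> desc t" "v \<in> bag t" for v s
  proof -
    obtain u where u: "u \<in> N" "(t, u) \<in> E\<^sup>*" "is_top r p bag v u" using ex_top[OF assms] top by blast
    then have "u = s" using top_unique top_D top desc_subset by blast
    then have "u = t" using u that E_antisym by (auto simp: desc_def)
    then show False using \<open>u = s\<close> that by simp
  qed
  show "s = s'" if "s \<in> desc t" "s' \<in> desc t" "is_top t p bag v s" "is_top t p bag v s'" for v s s'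
    using that top_D top_unique key by (metis desc_subset is_top_def subsetD)
qed

text \<open>The children of \<open>t\<close> move to \<open>p t\<close>. No top is created, because
  a vertex missing from \<open>bag (p t)\<close> is missing from \<open>bag t\<close> as
  well.\<close>

lemma rooted_td_contract:
  assumes "t \<in> N" "t \<noteq> r" "bag t \<subseteq> bag (p t)"
  shows "rooted_td (N - {t}) r (\<lambda>c. if p c = t then p t else p c) bag"
proof
  let ?p = "\<lambda>c. if p c = t then p t else p c"
  have pt: "p t \<noteq> t" using par_not_desc desc_self assms by metis
  show "finite (N - {t})" using fin by simp
  show "r \<in> N - {t}" using root assms by simp
  show "?p s \<in> N - {t}" if "s \<in> N - {t}" "s \<noteq> r" for s
    using that par assms pt by auto
  show "(s, r) \<in> (parent_rel (N - {t}) r ?p)\<^sup>*" if "s \<in> N - {t}" for s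
  proof -
    from that have "s \<in> N" by simp
    then have "((if s = t then p t else s), r) \<in> (parent_rel (N - {t}) r ?p)\<^sup>*"
    proof (induction rule: tree_induct)
      case root
      then show ?case using assms by simp
    next
      case (child s)
      show ?case
      proof (cases "s = t")
        case True
        then show ?thesis using child pt by simp
      next
        case False
        then have "(s, ?p s) \<in> parent_rel (N - {t}) r ?p" using child by (auto simp: parent_rel_def)
        then show ?thesis using child False by (auto intro: converse_rtrancl_into_rtrancl)
      qed
    qed
    with that show ?thesis by auto
  qed
  have "is_top r p bag v s" if "is_top r ?p bag v s" for v s
    using that assms by (auto simp: is_top_def split: if_splits)
  then show "s = s'" if "s \<in> N - {t}" "s' \<in> N - {t}" "is_top r ?p bag v s" "is_top r ?p bag v s'"
    for v s s' using that top_unique by (metis DiffE)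
qed

lemma rooted_td_cong:
  assumes "\<And>t. t \<in> N \<Longrightarrow> t \<noteq> r \<Longrightarrow> p' t = p t" "\<And>t. t \<in> N \<Longrightarrow> bag' t = bag t"
  shows "rooted_td N r p' bag'"
proof -
  have "parent_rel N r p' = E" using assms by (auto simp: parent_rel_def)
  moreover have "is_top r p bag v s" if "is_top r p' bag' v s" "s \<in> N" for v s
    using that assms par by (cases "s = r") (auto simp: is_top_def)
  ultimately show ?thesis
    using fin root par reach top_unique assms by unfold_locales (simp_all, metis)
qed

text \<open>The second tree is hung below \<open>s\<close>. A vertex of both parts lies in
  \<open>bag r2\<close>, so \<open>r2\<close> is its only top in the second tree; it ceases to be
  one because the vertex also lies in \<open>bag s\<close>.\<close>

lemma rooted_td_join:
  assumes "rooted_td N2 r2 p bag" "N \<inter> N2 = {}" "s \<in> N"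
    and sep: "\<Union>(bag ` N) \<inter> \<Union>(bag ` N2) \<subseteq> bag s \<inter> bag r2"
  shows "rooted_td (N \<union> N2) r (p(r2 := s)) bag"
proof -
  interpret B: rooted_td N2 r2 p bag by fact
  let ?p = "p(r2 := s)" and ?N = "N \<union> N2"
  have r2: "r2 \<notin> N" "r2 \<in> N2" using B.root assms by auto
  have rN2: "r \<notin> N2" using assms root by auto
  have reach1: "(t, r) \<in> (parent_rel ?N r ?p)\<^sup>*" if "t \<in> N" for t
  proof -
    have "E \<subseteq> parent_rel ?N r ?p" using r2 by (auto simp: parent_rel_def)
    then show ?thesis using reach[OF that] rtrancl_mono by blast
  qed
  have reach2: "(t, r) \<in> (parent_rel ?N r ?p)\<^sup>*" if "t \<in> N2" for t
    using that
  proof (induction rule: B.tree_induct)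
    case root
    have "(r2, s) \<in> parent_rel ?N r ?p" using r2 rN2 by (auto simp: parent_rel_def)
    then show ?case using reach1 assms by (meson converse_rtrancl_into_rtrancl)
  next
    case (child t)
    have "(t, p t) \<in> parent_rel ?N r ?p" using child rN2 by (auto simp: parent_rel_def)
    then show ?case using child by (meson converse_rtrancl_into_rtrancl)
  qed
  have top1: "is_top r p bag v t" if "is_top r ?p bag v t" "t \<in> N" for v t
    using that r2 by (auto simp: is_top_def split: if_splits)
  have top2: "is_top r2 p bag v t" if "is_top r ?p bag v t" "t \<in> N2" for v t
    using that rN2 by (auto simp: is_top_def split: if_splits)
  have cross: False if "is_top r ?p bag v t" "t \<in> N2" "is_top r ?p bag v t'" "t' \<in> N" for v t t'
  proof -
    have "v \<in> bag s \<inter> bag r2" using sep that by (auto simp: is_top_def)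
    then have "t = r2" using B.top_unique[OF _ _ top2[OF that(1,2)], of r2] r2 that(2)
      by (auto simp: is_top_def)
    then show False using that \<open>v \<in> bag s \<inter> bag r2\<close> rN2 by (auto simp: is_top_def)
  qed
  show ?thesis
  proof
    show "finite ?N" using fin B.fin by simp
    show "r \<in> ?N" using root by simp
    show "?p t \<in> ?N" if "t \<in> ?N" "t \<noteq> r" for t
      using that par B.par assms r2 by auto
    show "(t, r) \<in> (parent_rel ?N r ?p)\<^sup>*" if "t \<in> ?N" for t
      using that reach1 reach2 by blast
    show "t = t'" if "t \<in> ?N" "t' \<in> ?N" "is_top r ?p bag v t" "is_top r ?p bag v t'" for v t t'
      using that top1 top2 cross top_unique B.top_unique by (metis Un_iff)
  qed
qed

lemma rooted_td_leaf:
  assumes "l \<notin> N" "s \<in> N" "\<Union>(bag ` N) \<inter> X \<subseteq> bag s"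
  shows "rooted_td (insert l N) r (p(l := s)) (bag(l := X))"
proof -
  interpret A: rooted_td N r p "bag(l := X)" by (rule rooted_td_cong) (use assms in auto)
  have "rooted_td {l} l p (bag(l := X))"
    by unfold_locales auto
  then have "rooted_td (N \<union> {l}) r (p(l := s)) (bag(l := X))"
    using assms by (intro A.rooted_td_join) auto
  then show ?thesis by simp
qed

end

section \<open>Short-cutting walks\<close>

definition shortcut :: "'i list \<Rightarrow> 'i list \<Rightarrow> bool" where
  "shortcut zs ys \<longleftrightarrow> subseq zs ys \<and> zs \<noteq> [] \<and> hd zs = hd ys \<and> last zs = last ys"

lemma shortcut_trans: "shortcut xs ys \<Longrightarrow> shortcut ys zs \<Longrightarrow> shortcut xs zs"
  by (auto simp: shortcut_def)

lemma shortcut_refl: "ys \<noteq> [] \<Longrightarrow> shortcut ys ys"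
  by (auto simp: shortcut_def)

lemma subseq_rev: "subseq xs ys \<Longrightarrow> subseq (rev xs) (rev ys)"
  by (induction rule: list_emb.induct) (auto intro: list_emb_append_mono)

lemma shortcut_rev: "shortcut zs (rev ys) \<Longrightarrow> shortcut (rev zs) ys"
  unfolding shortcut_def
  by (metis hd_rev last_rev list_emb_Nil2 rev_is_Nil_conv rev_rev_ident subseq_rev)

text \<open>Excursions out of a region \<open>Q\<close> with border \<open>B\<close> are cut out.
  The second conjunct carries the induction: after a dropped entry the next kept one has just
  returned, hence lies on the border.\<close>

lemma successively_filter:
  assumes "successively C (x # ys)"
    and QQ: "\<And>x y. C x y \<Longrightarrow> Q x \<Longrightarrow> Q y \<Longrightarrow> C' x y"
    and leave: "\<And>x y. C x y \<Longrightarrow> Q x \<Longrightarrow> \<not> Q y \<Longrightarrow> B x"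
    and return: "\<And>x y. C x y \<Longrightarrow> \<not> Q x \<Longrightarrow> Q y \<Longrightarrow> B y"
    and BB: "\<And>x y. B x \<Longrightarrow> B y \<Longrightarrow> C' x y"
  shows "successively C' (filter Q (x # ys)) \<and>
    (\<not> Q x \<longrightarrow> filter Q ys \<noteq> [] \<longrightarrow> B (hd (filter Q ys)))"
  using assms(1)
proof (induction ys arbitrary: x)
  case (Cons y ys)
  then have IH: "successively C' (filter Q (y # ys))"
      "\<not> Q y \<Longrightarrow> filter Q ys \<noteq> [] \<Longrightarrow> B (hd (filter Q ys))" and C: "C x y"
    by auto
  show ?case
  proof (cases "Q y")
    case True
    then show ?thesis using IH C QQ return by auto
  next
    case False
    then show ?thesis using IH C leave BB by (auto simp: successively_Cons)
  qed
qed auto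

text \<open>A walk can leave the region \<open>Q\<close> only after meeting the separator
  \<open>S\<close>, and \<open>Q'\<close> meets \<open>Q\<close> only inside \<open>S\<close>; the
  list is split at the first visit of \<open>S\<close>.\<close>

lemma successively_split:
  assumes "successively C ys" "ys \<noteq> []" "Q (hd ys)" "Q' (last ys)"
    and "\<And>x y. C x y \<Longrightarrow> Q x \<Longrightarrow> \<not> S x \<Longrightarrow> Q y"
    and "\<And>x. Q x \<Longrightarrow> Q' x \<Longrightarrow> S x"
  shows "\<exists>xs a zs. ys = xs @ a # zs \<and> S a \<and> Q a \<and> (\<forall>x\<in>set xs. Q x \<and> \<not> S x)"
  using assms(1-4)
proof (induction ys)
  case (Cons y ys)
  show ?case
  proof (cases "S y")
    case True
    then show ?thesis using Cons by (metis append_Nil empty_iff empty_set list.sel(1))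
  next
    case False
    then have ne: "ys \<noteq> []" using Cons assms(6) by auto
    then have "C y (hd ys)" "successively C ys" using Cons by (auto simp: successively_Cons)
    then obtain xs a zs where "ys = xs @ a # zs" "S a" "Q a" "\<forall>x\<in>set xs. Q x \<and> \<not> S x"
      using Cons False ne assms(5) by auto
    then show ?thesis using Cons False by (intro exI[of _ "y # xs"]) auto
  qed
qed auto

text \<open>Adjacency in the graph in which every bag is made a clique. Adding such edges does not
  raise the width, which is why walks may be short-cut along them.\<close>

definition share_bag :: "'n set \<Rightarrow> ('n \<Rightarrow> 'v set) \<Rightarrow> 'v \<Rightarrow> 'v \<Rightarrow> bool" where
  "share_bag N bag u v \<longleftrightarrow> (\<exists>t\<in>N. u \<in> bag t \<and> v \<in> bag t)"

text \<open>Entries are pairs of a vertex and, later, an automaton state. The bags constrain the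
  vertices only; the states are carried along.\<close>

abbreviation "bag_walk N bag \<equiv> successively (\<lambda>x y. share_bag N bag (fst x) (fst y))"

lemma share_bag_sym: "share_bag N bag u v \<Longrightarrow> share_bag N bag v u"
  by (auto simp: share_bag_def)

lemma bag_walk_rev: "bag_walk N bag (rev ys) \<longleftrightarrow> bag_walk N bag ys"
  by (auto simp: successively_rev intro: share_bag_sym elim!: successively_mono)

text \<open>An excursion out of \<open>X\<close> leaves and returns through vertices of one bag.\<close>

lemma bag_walk_filter:
  fixes ys :: "('v \<times> 'q) list"
  assumes sep: "\<Union>(bag ` X) \<inter> \<Union>(bag ` Y) \<subseteq> bag s" and s: "s \<in> X"
    and walk: "bag_walk (X \<union> Y) bag ys"
  shows "bag_walk X bag (filter (\<lambda>x. fst x \<in> \<Union>(bag ` X)) ys)"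
proof (cases ys)
  case (Cons y ys')
  show ?thesis unfolding Cons
  proof (rule conjunct1[OF successively_filter[where C = "\<lambda>x y. share_bag (X \<union> Y) bag (fst x) (fst y)"
        and B = "\<lambda>x. fst x \<in> bag s"]])
    show "bag_walk (X \<union> Y) bag (y # ys')" using walk Cons by simp
    fix x y :: "'v \<times> 'q"
    let ?Q = "\<lambda>x :: 'v \<times> 'q. fst x \<in> \<Union>(bag ` X)"
    show BB: "share_bag X bag (fst x) (fst y)" if "fst x \<in> bag s" "fst y \<in> bag s" for x y :: "'v \<times> 'q"
      using that s unfolding share_bag_def by blast
    assume C: "share_bag (X \<union> Y) bag (fst x) (fst y)"
    \<comment> \<open>A step that no bag of \<open>X\<close> covers is covered by a bag of
      \<open>Y\<close>, so an end of it that lies in \<open>X\<close> belongs to the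
      separator.\<close>
    have Y: "fst x \<in> \<Union>(bag ` Y) \<and> fst y \<in> \<Union>(bag ` Y)" if "\<not> share_bag X bag (fst x) (fst y)"
      using C that unfolding share_bag_def by blast
    show "share_bag X bag (fst x) (fst y)" if "?Q x" "?Q y"
      using that sep Y BB by blast
    show "fst x \<in> bag s" if "?Q x" "\<not> ?Q y"
    proof -
      have "\<not> share_bag X bag (fst x) (fst y)" using that by (auto simp: share_bag_def)
      then show ?thesis using sep Y that by blast
    qed
    show "fst y \<in> bag s" if "\<not> ?Q x" "?Q y"
    proof -
      have "\<not> share_bag X bag (fst x) (fst y)" using that by (auto simp: share_bag_def)
      then show ?thesis using sep Y that by blast
    qed
  qed
qed simp

lemma shortcut_filter:
  assumes "ys \<noteq> []" "Q (hd ys)" "Q (last ys)"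
  shows "shortcut (filter Q ys) ys"
proof -
  have "filter Q ys \<noteq> []" using assms by (auto simp: filter_empty_conv intro: bexI[of _ "hd ys"])
  moreover have "hd (filter Q ys) = hd ys" using assms by (cases ys) auto
  moreover have "last (filter Q ys) = last ys" using assms by (cases ys rule: rev_cases) auto
  ultimately show ?thesis by (simp add: shortcut_def)
qed

text \<open>The value is unspecified for a walk that misses \<open>S\<close>.\<close>

definition first_visit :: "'v set \<Rightarrow> ('v \<times> 'q) list \<Rightarrow> 'v" where
  "first_visit S ys = fst (hd (dropWhile (\<lambda>x. fst x \<notin> S) ys))"

lemma first_visit_eq:
  assumes "\<forall>x\<in>set xs. fst x \<notin> S" "fst a \<in> S"
  shows "first_visit S (xs @ a # zs) = fst a"
  using assms by (induction xs) (auto simp: first_visit_def)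

section \<open>Walks across one or two edges of the tree\<close>

context rooted_td
begin

abbreviation "adh t \<equiv> bag t \<inter> bag (p t)"
abbreviation "outside t \<equiv> N - desc t"

lemma share_bag_cases:
  assumes "share_bag N bag u v" "t \<in> N"
  shows "share_bag (outside t) bag u v \<or> share_bag (desc t) bag u v"
  using assms by (auto simp: share_bag_def)

lemma outside_inter_desc:
  assumes "t \<in> N" "t \<noteq> r"
  shows "\<Union>(bag ` outside t) \<inter> \<Union>(bag ` desc t) = adh t"
proof
  show "\<Union>(bag ` outside t) \<inter> \<Union>(bag ` desc t) \<subseteq> adh t"
    using separation assms by blast
  show "adh t \<subseteq> \<Union>(bag ` outside t) \<inter> \<Union>(bag ` desc t)"
    using assms desc_self par_not_desc par by blast
qed

lemma bag_walk_filter_outside: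
  assumes "t \<in> N" "t \<noteq> r" "bag_walk N bag ys"
  shows "bag_walk (outside t) bag (filter (\<lambda>x. fst x \<in> \<Union>(bag ` outside t)) ys)"
proof (rule bag_walk_filter)
  show "p t \<in> outside t" using assms par_not_desc par by auto
  show "\<Union>(bag ` outside t) \<inter> \<Union>(bag ` desc t) \<subseteq> bag (p t)"
    using outside_inter_desc assms by blast
  have "outside t \<union> desc t = N" using desc_subset by auto
  then show "bag_walk (outside t \<union> desc t) bag ys" using assms by simp
qed

lemma bag_walk_filter_desc:
  assumes "t \<in> N" "t \<noteq> r" "bag_walk N bag ys"
  shows "bag_walk (desc t) bag (filter (\<lambda>x. fst x \<in> \<Union>(bag ` desc t)) ys)"
proof (rule bag_walk_filter)
  show "t \<in> desc t" using assms desc_self by auto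
  show "\<Union>(bag ` desc t) \<inter> \<Union>(bag ` outside t) \<subseteq> bag t"
    using outside_inter_desc assms by blast
  have "desc t \<union> outside t = N" using desc_subset by auto
  then show "bag_walk (desc t \<union> outside t) bag ys" using assms by simp
qed

text \<open>A walk descending from outside \<open>t\<close> to below \<open>t'\<close> can be made to do so in one jump, between its
  first visits to the two adhesion sets.\<close>

lemma bag_walk_jump:
  fixes ys :: "('v \<times> 'q) list"
  assumes t: "t \<in> N" "t \<noteq> r" and t': "t' \<in> desc t" 
    and w: "bag_walk N bag ys" and ys: "ys \<noteq> []"
    and hd: "fst (hd ys) \<in> \<Union>(bag ` outside t)" and last: "fst (last ys) \<in> \<Union>(bag ` desc t')"
  shows "first_visit (adh t) ys \<in> adh t" "first_visit (adh t') ys \<in> adh t'"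
    "\<exists>zs. shortcut zs ys \<and> successively (\<lambda>x y. share_bag (outside t) bag (fst x) (fst y)
        \<or> share_bag (desc t') bag (fst x) (fst y)
        \<or> (fst x = first_visit (adh t) ys \<and> fst y = first_visit (adh t') ys)) zs"
proof -
  have t'N: "t' \<in> N" "t' \<noteq> r" using t' t desc_subset root_desc by auto
  have dd: "desc t' \<subseteq> desc t" using t' desc_mono by (auto simp: desc_def)
  then have oo: "outside t \<subseteq> outside t'" by blast
  let ?VU = "\<Union>(bag ` outside t)" and ?VD = "\<Union>(bag ` desc t')"
  note I = outside_inter_desc[OF t] and I' = outside_inter_desc[OF t'N]
  have "\<exists>xs a zs. ys = xs @ a # zs \<and> fst a \<in> adh t \<and> fst a \<in> ?VU \<and> (\<forall>x\<in>set xs. fst x \<in> ?VU \<and> fst x \<notin> adh t)"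
  proof (rule successively_split[where Q = "\<lambda>x. fst x \<in> ?VU" and Q' = "\<lambda>x. fst x \<in> \<Union>(bag ` desc t)" and S = "\<lambda>x. fst x \<in> adh t", OF w ys hd])
    show "fst (last ys) \<in> \<Union>(bag ` desc t)" using last dd by blast
    show "fst y \<in> ?VU" if "share_bag N bag (fst x) (fst y)" "fst x \<in> ?VU" "fst x \<notin> adh t" for x y :: "'v \<times> 'q"
      using that share_bag_cases[OF that(1) t(1)] I unfolding share_bag_def by blast
    show "fst x \<in> adh t" if "fst x \<in> ?VU" "fst x \<in> \<Union>(bag ` desc t)" for x :: "'v \<times> 'q"
      using that I by blast
  qed
  then obtain xs a zs where a: "ys = xs @ a # zs" "fst a \<in> adh t" "fst a \<in> ?VU"
      "\<forall>x\<in>set xs. fst x \<in> ?VU \<and> fst x \<notin> adh t" by blast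
  have "\<exists>xs' c zs'. ys = xs' @ c # zs' \<and> fst c \<in> adh t' \<and> fst c \<in> \<Union>(bag ` outside t') \<and>
      (\<forall>x\<in>set xs'. fst x \<in> \<Union>(bag ` outside t') \<and> fst x \<notin> adh t')"
  proof (rule successively_split[where Q = "\<lambda>x. fst x \<in> \<Union>(bag ` outside t')" and Q' = "\<lambda>x. fst x \<in> ?VD" and S = "\<lambda>x. fst x \<in> adh t'", OF w ys])
    show "fst (hd ys) \<in> \<Union>(bag ` outside t')" using hd oo by blast
    show "fst (last ys) \<in> ?VD" using last by blast
    show "fst y \<in> \<Union>(bag ` outside t')" if "share_bag N bag (fst x) (fst y)" "fst x \<in> \<Union>(bag ` outside t')" "fst x \<notin> adh t'"
      for x y :: "'v \<times> 'q"
      using that share_bag_cases[OF that(1) t'N(1)] I' unfolding share_bag_def by blast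
    show "fst x \<in> adh t'" if "fst x \<in> \<Union>(bag ` outside t')" "fst x \<in> ?VD" for x :: "'v \<times> 'q"
      using that I' by blast
  qed
  then obtain xs' c zs' where c: "ys = xs' @ c # zs'" "fst c \<in> adh t'"
      "\<forall>x\<in>set xs'. fst x \<notin> adh t'" by blast
  have fa: "first_visit (adh t) ys = fst a" using first_visit_eq[of xs "adh t" a zs] a by metis
  have fc: "first_visit (adh t') ys = fst c" using first_visit_eq[of xs' "adh t'" c zs'] c by metis
  show "first_visit (adh t) ys \<in> adh t" "first_visit (adh t') ys \<in> adh t'"
    using fa fc a c by auto
  have cD: "fst c \<in> ?VD" using c desc_self t'N by blast
  \<comment> \<open>The upper adhesion set is met no later than the lower one: an entry before
    \<open>a\<close> lies outside \<open>t\<close> and off \<open>adh t\<close>, hence not in any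
    bag below \<open>t\<close>, whereas \<open>c\<close> does.\<close>
  have "c \<notin> set xs"
  proof
    assume "c \<in> set xs"
    then have "fst c \<in> ?VU" "fst c \<notin> adh t" using a by auto
    moreover have "fst c \<in> \<Union>(bag ` desc t)" using cD dd by blast
    ultimately show False using I by blast
  qed
  then have "length xs \<le> length xs'" using a(1) c(1)
    by (metis append_eq_append_conv_if in_set_conv_nth leI list.set_intros(1) nth_append_length nth_append)
  then obtain mid where mid: "xs' = xs @ mid" "a # zs = mid @ c # zs'"
    using a(1) c(1) by (auto simp: append_eq_append_conv2)
  have wU: "bag_walk (outside t) bag (xs @ [a])"
  proof -
    have "bag_walk N bag (xs @ [a])" using w a(1) by (auto simp: successively_append_iff)
    moreover have "filter (\<lambda>x. fst x \<in> ?VU) (xs @ [a]) = xs @ [a]"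
      using a by (intro filter_True) auto
    ultimately show ?thesis using bag_walk_filter_outside[OF t, of "xs @ [a]"] by metis
  qed
  have wD: "bag_walk (desc t') bag (c # filter (\<lambda>x. fst x \<in> ?VD) zs')"
  proof -
    have "bag_walk N bag (c # zs')" using w c(1) by (auto simp: successively_append_iff)
    from bag_walk_filter_desc[OF t'N this] show ?thesis using cD by simp
  qed
  let ?f = "filter (\<lambda>x. fst x \<in> ?VD) zs'"
  let ?C = "\<lambda>x y. share_bag (outside t) bag (fst x) (fst y) \<or> share_bag (desc t') bag (fst x) (fst y)
        \<or> (fst x = first_visit (adh t) ys \<and> fst y = first_visit (adh t') ys)"
  have lastf: "last (c # ?f) = last (c # zs')"
  proof (cases zs' rule: rev_cases)
    case (snoc zs'' z)
    then have "fst z \<in> ?VD" using last c by simp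
    then show ?thesis using snoc by simp
  qed simp
  have CU: "successively ?C (xs @ [a])" using wU by (rule successively_mono) auto
  have CD: "successively ?C (c # ?f)" using wD by (rule successively_mono) auto
  show "\<exists>zs. shortcut zs ys \<and> successively ?C zs"
  proof (cases mid)
    \<comment> \<open>Both first visits happen at the same entry, and no jump is inserted.\<close>
    case Nil
    then have "a = c" using mid by simp
    have "successively ?C (xs @ c # ?f)"
      using CU CD \<open>a = c\<close> by (auto simp: successively_append_iff)
    moreover have "shortcut (xs @ c # ?f) ys"
      unfolding shortcut_def c(1) mid(1) Nil using lastf
      by (auto simp: hd_append intro!: list_emb_append_mono)
    ultimately show ?thesis by blast
  next
    case (Cons m mid')
    then have "m = a" using mid by simp
    have "successively ?C ((xs @ [a]) @ c # ?f)"
      using CU CD fa fc unfolding successively_append_iff by auto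
    moreover have "shortcut ((xs @ [a]) @ c # ?f) ys"
    proof -
      have "subseq (xs @ [a] @ c # ?f) (xs @ (a # mid') @ c # zs')"
        by (intro list_emb_append_mono) auto
      then show ?thesis
        unfolding shortcut_def c(1) mid(1) Cons using lastf \<open>m = a\<close>
        by (auto simp: hd_append)
    qed
    ultimately show ?thesis by blast
  qed
qed

end

text \<open>Finiteness is stated separately because \<open>card\<close> is 0 on infinite
  sets.\<close>

definition narrow :: "nat \<Rightarrow> 'n set \<Rightarrow> ('n \<Rightarrow> 'v set) \<Rightarrow> bool" where
  "narrow k N bag \<longleftrightarrow> (\<forall>t\<in>N. finite (bag t) \<and> card (bag t) \<le> Suc k)"

text \<open>Replacing the vertices \<open>u\<close> of \<open>A\<close> by their images \<open>\<sigma> u\<close> in \<open>B\<close> one at a time needs only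
  \<open>card A + 1\<close> vertices in each bag.\<close>

lemma ladder:
  fixes N Y :: "nat set" and bag :: "nat \<Rightarrow> 'v set"
  assumes "rooted_td N r p bag" "s \<in> N" "A \<subseteq> bag s" "finite A" "card A \<le> k" "B \<inter> \<Union>(bag ` N) \<subseteq> A"
    and B: "finite B" "card B \<le> Suc k" and Y: "finite Y"
    and "\<forall>v\<in>A - B. \<sigma> v \<in> B \<or> \<sigma> v = v"
  shows "\<exists>L p' bag' s'. finite L \<and> L \<inter> (N \<union> Y) = {} \<and> card L \<le> Suc (card (A - B)) \<and>
    (\<forall>t\<in>N \<union> Y. p' t = p t \<and> bag' t = bag t) \<and> rooted_td (N \<union> L) r p' bag' \<and> s' \<in> L \<and> bag' s' = B \<and>
    narrow k L bag' \<and> \<Union>(bag' ` L) \<subseteq> \<Union>(bag ` N) \<union> B \<and> (\<forall>v\<in>A. \<sigma> v \<in> B \<or> \<sigma> v = v \<longrightarrow> share_bag L bag' v (\<sigma> v))"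
  using assms(1-6,10)
proof (induction "card (A - B)" arbitrary: N p bag s A)
  case 0
  interpret rooted_td N r p bag by fact
  \<comment> \<open>The set \<open>Y\<close> reserves names of nodes that are to be glued below the
    ladder afterwards. Since \<open>A\<close> is contained in \<open>B\<close> here, a single node
    with bag \<open>B\<close> finishes the ladder.\<close>
  obtain l where l: "l \<notin> N \<union> Y" using Y fin by (meson ex_new_if_finite finite_UnI infinite_UNIV_nat)
  have AB: "A \<subseteq> B" using 0 by auto
  define p' bag' where "p' = p(l := s)" and "bag' = bag(l := B)"
  have "rooted_td (insert l N) r p' bag'"
    unfolding p'_def bag'_def using 0 l by (intro rooted_td_leaf) auto
  moreover have "bag' l = B" "\<forall>t\<in>N \<union> Y. p' t = p t \<and> bag' t = bag t"
    using l by (auto simp: p'_def bag'_def)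
  moreover have "share_bag {l} bag' v (\<sigma> v)" if "v \<in> A" "\<sigma> v \<in> B \<or> \<sigma> v = v" for v
    using that AB 0 by (auto simp: share_bag_def bag'_def)
  ultimately show ?case using l B 0
    by (intro exI[of _ "{l}"] exI[of _ p'] exI[of _ bag'] exI[of _ l]) (simp add: narrow_def)
next
  case (Suc n)
  interpret rooted_td N r p bag by fact
  have "A - B \<noteq> {}" using Suc(2) by force
  then obtain u where u: "u \<in> A" "u \<notin> B" by blast
  obtain l where l: "l \<notin> N \<union> Y" using Y fin by (meson ex_new_if_finite finite_UnI infinite_UNIV_nat)
  \<comment> \<open>One rung: \<open>u\<close> and its image share the bag \<open>?X\<close>, which
    has at most k + 1 vertices, and then \<open>u\<close> is forgotten. If
    \<open>\<sigma> u = u\<close>, the rung only forgets \<open>u\<close>. In either case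
    \<open>A - B\<close> loses exactly \<open>u\<close>.\<close>
  let ?X = "insert (\<sigma> u) A" and ?p = "p(l := s)"
  let ?b = "bag(l := ?X)" and ?A = "?X - {u}"
  have su: "\<sigma> u \<in> B \<or> \<sigma> u = u" using Suc(9) u by blast
  have tree: "rooted_td (insert l N) r ?p ?b"
    using Suc(4,5,8) l su u by (intro rooted_td_leaf) auto
  have AB: "?A - B = (A - B) - {u}" using su u by auto
  have "n = card (?A - B)" unfolding AB using Suc(2,6) u by simp
  moreover have "card ?A \<le> k"
  proof -
    have "card ?A = card ?X - 1" using u Suc(6) by (simp add: card_Diff_singleton)
    also have "\<dots> \<le> card A" using Suc(6) by (simp add: card_insert_if)
    finally show ?thesis using Suc(7) by simp
  qed
  moreover have "B \<inter> \<Union>(?b ` insert l N) \<subseteq> ?A" using Suc(8) su u l by auto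
  moreover have "\<forall>v\<in>?A - B. \<sigma> v \<in> B \<or> \<sigma> v = v" using Suc(9) AB by auto
  moreover have "l \<in> insert l N" "?A \<subseteq> ?b l" "finite ?A" using Suc(6) by auto
  ultimately have "\<exists>L p' bag' s'. finite L \<and> L \<inter> (insert l N \<union> Y) = {} \<and> card L \<le> Suc (card (?A - B)) \<and>
    (\<forall>t\<in>insert l N \<union> Y. p' t = ?p t \<and> bag' t = ?b t) \<and> rooted_td (insert l N \<union> L) r p' bag' \<and> s' \<in> L \<and> bag' s' = B \<and>
    narrow k L bag' \<and> \<Union>(bag' ` L) \<subseteq> \<Union>(?b ` insert l N) \<union> B \<and> (\<forall>v\<in>?A. \<sigma> v \<in> B \<or> \<sigma> v = v \<longrightarrow> share_bag L bag' v (\<sigma> v))"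
    using tree by - (rule Suc(1)[of ?A "insert l N" ?p ?b l])
  then obtain L p' bag' s' where L: "finite L" "L \<inter> (insert l N \<union> Y) = {}" "card L \<le> Suc (card (?A - B))"
    "\<forall>t\<in>insert l N \<union> Y. p' t = ?p t \<and> bag' t = ?b t" "rooted_td (insert l N \<union> L) r p' bag'" "s' \<in> L" "bag' s' = B"
    "narrow k L bag'" "\<Union>(bag' ` L) \<subseteq> \<Union>(?b ` insert l N) \<union> B"
    "\<forall>v\<in>?A. \<sigma> v \<in> B \<or> \<sigma> v = v \<longrightarrow> share_bag L bag' v (\<sigma> v)" by - (elim exE conjE, rule that)
  have bl: "bag' l = ?X" using L(4) by simp
  have "card (insert l L) \<le> Suc (card (A - B))"
    using L(1-3) Suc(2) \<open>n = card (?A - B)\<close> by (simp add: card_insert_if)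
  moreover have "\<forall>t\<in>N \<union> Y. p' t = p t \<and> bag' t = bag t" using L(4) l by auto
  moreover have "narrow k (insert l L) bag'"
    using L(8) bl Suc(6,7) by (auto simp: narrow_def card_insert_if)
  moreover have "\<Union>(bag' ` insert l L) \<subseteq> \<Union>(bag ` N) \<union> B"
  proof -
    have "\<Union>(?b ` insert l N) \<subseteq> ?X \<union> \<Union>(bag ` N)" by auto
    moreover have "A \<subseteq> \<Union>(bag ` N)" using Suc(4,5) by blast
    moreover have "\<sigma> u \<in> B \<union> A" using su u by auto
    ultimately have "\<Union>(?b ` insert l N) \<subseteq> \<Union>(bag ` N) \<union> B" by blast
    then show ?thesis using L(9) bl by auto
  qed
  moreover have "\<forall>v\<in>A. \<sigma> v \<in> B \<or> \<sigma> v = v \<longrightarrow> share_bag (insert l L) bag' v (\<sigma> v)"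
  proof (intro ballI impI)
    fix v assume v: "v \<in> A" "\<sigma> v \<in> B \<or> \<sigma> v = v"
    show "share_bag (insert l L) bag' v (\<sigma> v)"
    proof (cases "v = u")
      case True
      then show ?thesis using bl u by (simp add: share_bag_def)
    next
      case False
      then have "share_bag L bag' v (\<sigma> v)" using bspec[OF L(10), of v] v by blast
      then show ?thesis by (auto simp: share_bag_def)
    qed
  qed
  moreover have "rooted_td (N \<union> insert l L) r p' bag'" using L(5) by simp
  moreover have "insert l L \<inter> (N \<union> Y) = {}" "finite (insert l L)" "s' \<in> insert l L" using L(1,2,6) l by auto
  moreover note L(7)
  ultimately show ?case
    by - (rule exI[of _ "insert l L"], rule exI[of _ p'], rule exI[of _ bag'], rule exI[of _ s'], intro conjI)
qed

text \<open>Every bag need be used for one step only.\<close>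

lemma short_walk:
  assumes "finite N" "bag_walk N bag ys" "ys \<noteq> []"
  shows "\<exists>zs. shortcut zs ys \<and> bag_walk N bag zs \<and> length zs \<le> Suc (card N)"
  using assms
proof (induction "card N" arbitrary: N ys)
  case 0
  then have "\<exists>y. ys = [y]" by (cases ys rule: remdups_adj.cases) (auto simp: share_bag_def)
  then show ?case by (auto intro: shortcut_refl exI[of _ ys])
next
  case (Suc n)
  show ?case
  proof (cases ys rule: remdups_adj.cases)
    case (3 x y ys')
    then obtain t where t: "t \<in> N" "fst x \<in> bag t" "fst y \<in> bag t" using Suc by (auto simp: share_bag_def)
    have "\<exists>z\<in>set (y # ys'). fst z \<in> bag t" using t by simp
    \<comment> \<open>The entry \<open>c\<close> is the last one in \<open>bag t\<close>. The walk
      jumps from \<open>x\<close> straight to \<open>c\<close>; every later step ends outside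
      \<open>bag t\<close>, so the rest avoids the node \<open>t\<close>.\<close>
    then obtain as c bs where c: "y # ys' = as @ c # bs" "fst c \<in> bag t" "\<forall>z\<in>set bs. fst z \<notin> bag t"
      using split_list_last_prop[of "y # ys'" "\<lambda>z. fst z \<in> bag t"] by blast
    have "bag_walk N bag ((x # as) @ c # bs)" using Suc 3 c by simp
    then have "bag_walk N bag (c # bs)" unfolding successively_append_iff by blast
    then have "bag_walk (N - {t}) bag (c # bs)" using c(3)
    proof (induction bs arbitrary: c)
      case (Cons b bs)
      then show ?case by (auto simp: share_bag_def)
    qed simp
    moreover have card: "n = card (N - {t})" using t Suc(2) by (metis card_Diff_singleton diff_Suc_1)
    ultimately obtain zs where zs: "shortcut zs (c # bs)" "bag_walk (N - {t}) bag zs" "length zs \<le> Suc (card (N - {t}))"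
      using Suc(1)[of "N - {t}" "c # bs"] card Suc(3) by auto
    have "bag_walk N bag zs" by (rule successively_mono[OF zs(2)]) (auto simp: share_bag_def)
    moreover have "hd zs = c" "zs \<noteq> []" using zs by (auto simp: shortcut_def)
    ultimately have "bag_walk N bag (x # zs)" using t c by (auto simp: successively_Cons share_bag_def)
    moreover have "shortcut (x # zs) ys"
      using zs(1) c(1) unfolding 3(1) by (auto simp: shortcut_def)
    moreover have "length (x # zs) \<le> Suc (card N)" using zs(3) t Suc by simp
    ultimately show ?thesis by blast
  qed (use Suc in \<open>auto intro: shortcut_refl exI[of _ ys]\<close>)
qed

section \<open>Minimal solutions and the bound on their number of nodes\<close>

definition solves :: "nat \<Rightarrow> 'v set \<Rightarrow> nat \<Rightarrow> (nat \<Rightarrow> ('v \<times> 'q) list) \<Rightarrow>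
    nat set \<Rightarrow> nat \<Rightarrow> (nat \<Rightarrow> nat) \<Rightarrow> (nat \<Rightarrow> 'v set) \<Rightarrow> (nat \<Rightarrow> ('v \<times> 'q) list) \<Rightarrow> bool" where
  "solves k F m xs N r p bag ys \<longleftrightarrow> rooted_td N r p bag \<and> narrow k N bag \<and> F \<subseteq> \<Union>(bag ` N) \<and>
     (\<forall>j<m. shortcut (ys j) (xs j) \<and> bag_walk N bag (ys j))"

text \<open>A surgery only has to short-cut the current walks \<open>ys\<close>; by transitivity the
  results are shortcuts of the original walks.\<close>

lemma solvesI:
  assumes "rooted_td N' r' p' bag'" "narrow k N' bag'" "F \<subseteq> \<Union>(bag' ` N')"
    and "\<And>j. j < m \<Longrightarrow> shortcut (ys j) (xs j)"
    and "\<And>j. j < m \<Longrightarrow> \<exists>zs. shortcut zs (ys j) \<and> bag_walk N' bag' zs"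
  shows "\<exists>ys'. solves k F m xs N' r' p' bag' ys'"
proof -
  have "\<forall>j. \<exists>zs. j < m \<longrightarrow> shortcut zs (ys j) \<and> bag_walk N' bag' zs" using assms(5) by blast
  then obtain zs where "\<And>j. j < m \<Longrightarrow> shortcut (zs j) (ys j) \<and> bag_walk N' bag' (zs j)" by metis
  then have "solves k F m xs N' r' p' bag' zs"
    using assms by (auto simp: solves_def intro: shortcut_trans)
  then show ?thesis by blast
qed

text \<open>Only the number of tree nodes is minimal, among all trees, bags and shortcuts together.
  The ends of the walks lie in \<open>F\<close> and are kept by shortcuts.\<close>

locale minimal_solution =
  fixes k F m and xs :: "nat \<Rightarrow> ('v \<times> 'q) list" and N r p and bag :: "nat \<Rightarrow> 'v set" and ys
  assumes finF: "finite F"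
    and ends: "\<And>j. j < m \<Longrightarrow> fst (hd (xs j)) \<in> F \<and> fst (last (xs j)) \<in> F"
    and sol: "solves k F m xs N r p bag ys"
    and minimal: "\<And>N' r' p' bag' ys'. solves k F m xs N' r' p' bag' ys' \<Longrightarrow> card N \<le> card N'"
begin

sublocale rooted_td N r p bag using sol by (simp add: solves_def)

lemma narrow: "narrow k N bag" and F_covered: "F \<subseteq> \<Union>(bag ` N)"
  and short: "j < m \<Longrightarrow> shortcut (ys j) (xs j)" and walk: "j < m \<Longrightarrow> bag_walk N bag (ys j)"
  using sol by (auto simp: solves_def)

lemma ys_ne: "j < m \<Longrightarrow> ys j \<noteq> []"
  and ys_ends: "j < m \<Longrightarrow> fst (hd (ys j)) \<in> F" "j < m \<Longrightarrow> fst (last (ys j)) \<in> F"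
  using short ends by (auto simp: shortcut_def)

text \<open>An element of \<open>F\<close> may lie in many bags. Assigning it to one chosen node
  makes every tree edge split \<open>F\<close> into two disjoint sets.\<close>

definition "loc v = (SOME t. t \<in> N \<and> v \<in> bag t)"

lemma loc: "v \<in> F \<Longrightarrow> loc v \<in> N \<and> v \<in> bag (loc v)"
  unfolding loc_def by (rule someI_ex) (use F_covered in blast)

definition "terminals t = {v \<in> F. loc v \<in> desc t}"

lemma terminal_desc: "v \<in> terminals t \<Longrightarrow> v \<in> \<Union>(bag ` desc t)"
  using loc by (auto simp: terminals_def)

lemma terminal_outside: "v \<in> F \<Longrightarrow> v \<notin> terminals t \<Longrightarrow> v \<in> \<Union>(bag ` outside t)"
  using loc by (auto simp: terminals_def)

lemma minimal': "solves k F m xs N' r' p' bag' ys' \<Longrightarrow> \<not> card N' < card N"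
  using minimal leD by blast

text \<open>Otherwise the subtree at \<open>t\<close> could be deleted: all walks start and end
  outside of it, and their excursions into it can be cut out.\<close>

lemma terminals_nonempty:
  assumes t: "t \<in> N" "t \<noteq> r"
  shows "terminals t \<noteq> {}"
proof
  assume empty: "terminals t = {}"
  then have out: "v \<in> \<Union>(bag ` outside t)" if "v \<in> F" for v using terminal_outside that by blast
  have "\<exists>ys'. solves k F m xs (outside t) r p bag ys'"
  proof (rule solvesI)
    show "rooted_td (outside t) r p bag" using rooted_td_minus_desc t .
    show "narrow k (outside t) bag" using narrow by (auto simp: narrow_def)
    show "F \<subseteq> \<Union>(bag ` outside t)" using out by blast
    show "\<exists>zs. shortcut zs (ys j) \<and> bag_walk (outside t) bag zs" if "j < m" for j
      using bag_walk_filter_outside[OF t walk[OF that]] shortcut_filter[OF ys_ne[OF that]]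
        ys_ends[OF that] out by (metis (no_types, lifting))
  qed (use short in auto)
  moreover have "card (outside t) < card N"
    using t desc_self fin by (intro psubset_card_mono) auto
  ultimately show False using minimal' by blast
qed

text \<open>An adhesion set with k + 1 vertices is the whole bag of \<open>t\<close>, and then
  \<open>t\<close> can be contracted into its parent. The bound k instead of k + 1 leaves the free
  place needed for \<open>ladder\<close>.\<close>

lemma card_adh:
  assumes t: "t \<in> N" "t \<noteq> r"
  shows "card (adh t) \<le> k"
proof (rule ccontr)
  assume "\<not> card (adh t) \<le> k"
  moreover have b: "finite (bag t)" "card (bag t) \<le> Suc k" using narrow t by (auto simp: narrow_def)
  ultimately have "card (bag t) \<le> card (adh t)" by linarith
  then have "adh t = bag t" using b by (intro card_seteq) auto
  then have sub: "bag t \<subseteq> bag (p t)" by blast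
  let ?p = "\<lambda>c. if p c = t then p t else p c"
  have pt: "p t \<in> N - {t}" using par t par_not_desc desc_self by fastforce
  have cv: "share_bag (N - {t}) bag u v" if "share_bag N bag u v" for u v
    using that sub pt unfolding share_bag_def by blast
  have "\<exists>ys'. solves k F m xs (N - {t}) r ?p bag ys'"
  proof (rule solvesI)
    show "rooted_td (N - {t}) r ?p bag" using t sub by (rule rooted_td_contract)
    show "narrow k (N - {t}) bag" using narrow by (auto simp: narrow_def)
    show "F \<subseteq> \<Union>(bag ` (N - {t}))" using F_covered sub pt by blast
    show "\<exists>zs. shortcut zs (ys j) \<and> bag_walk (N - {t}) bag zs" if "j < m" for j
      using successively_mono[OF walk[OF that]] cv shortcut_refl ys_ne[OF that] by (metis (no_types, lifting))
  qed (use short in auto)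
  moreover have "card (N - {t}) < card N"
    using t fin by (intro psubset_card_mono) auto
  ultimately show False using minimal' by blast
qed

text \<open>Each walk with exactly one end below \<open>t\<close> is read in the direction that descends into \<open>t\<close>.\<close>

definition "orient t j = (if fst (hd (ys j)) \<in> terminals t then rev (ys j) else ys j)"
definition "crosses t j \<longleftrightarrow> (fst (hd (ys j)) \<in> terminals t) \<noteq> (fst (last (ys j)) \<in> terminals t)"
definition "mark t j = first_visit (adh t) (orient t j)"
text \<open>The kernel of \<open>mark t\<close> on the indices of the walks. States are left out,
  because the bags of the ladder only have to accommodate vertices.\<close>

definition "profile t = {(i, j). i < m \<and> j < m \<and> mark t i = mark t j}"

text \<open>Replacing the nodes between the two edges by a ladder gives another solution. By
  minimality the removed nodes are no more than those of the ladder, of which there are at most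
  \<open>card (?A - ?B) + 1\<close>.\<close>

lemma card_between:
  assumes t: "t \<in> N" "t \<noteq> r" and t': "t' \<in> desc t" "t' \<noteq> t"
    and same: "terminals t' = terminals t" "profile t' = profile t"
  shows "card (desc t - desc t') \<le> Suc k"
proof -
  let ?U = "outside t" and ?D = "desc t'" and ?A = "adh t" and ?B = "adh t'"
  have t'N: "t' \<in> N" "t' \<noteq> r" using t' t desc_subset root_desc by auto
  have dd: "desc t' \<subseteq> desc t" using t' desc_mono by (auto simp: desc_def)
  \<comment> \<open>Both notions depend on the node only through its set of terminals.\<close>
  have or: "orient t' = orient t" and cr: "crosses t' = crosses t"
    unfolding orient_def crosses_def using same by auto
  have jump: "mark t j \<in> ?A" "mark t' j \<in> ?B"
    "\<exists>zs. shortcut zs (orient t j) \<and> successively (\<lambda>x y. share_bag ?U bag (fst x) (fst y)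
        \<or> share_bag ?D bag (fst x) (fst y) \<or> (fst x = mark t j \<and> fst y = mark t' j)) zs"
    if j: "j < m" "crosses t j" for j
  proof -
    have w: "bag_walk N bag (orient t j)" using walk[OF j(1)]
      by (cases "fst (hd (ys j)) \<in> terminals t") (simp_all only: orient_def if_True if_False bag_walk_rev)
    have ne: "orient t j \<noteq> []" using ys_ne j by (auto simp: orient_def)
    have "fst (hd (orient t j)) \<in> F - terminals t" "fst (last (orient t j)) \<in> terminals t'"
      using j ys_ne ys_ends same by (auto simp: orient_def crosses_def hd_rev last_rev)
    then have "fst (hd (orient t j)) \<in> \<Union>(bag ` ?U)" "fst (last (orient t j)) \<in> \<Union>(bag ` ?D)"
      using terminal_outside terminal_desc by blast+
    note J = bag_walk_jump[OF t t'(1) w ne this]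
    show "mark t j \<in> ?A" "mark t' j \<in> ?B"
      "\<exists>zs. shortcut zs (orient t j) \<and> successively (\<lambda>x y. share_bag ?U bag (fst x) (fst y)
        \<or> share_bag ?D bag (fst x) (fst y) \<or> (fst x = mark t j \<and> fst y = mark t' j)) zs"
      using J unfolding mark_def or by - assumption+
  qed
  \<comment> \<open>A vertex marked at \<open>t\<close> is sent to the mark at \<open>t'\<close> of
    some walk marking it; equal profiles make the choice of this walk irrelevant. Unmarked vertices
    are fixed, so the ladder merely forgets them unless they lie in \<open>?B\<close>.\<close>
  define \<sigma> where "\<sigma> v = (if \<exists>j. j < m \<and> crosses t j \<and> mark t j = v
      then mark t' (SOME j. j < m \<and> crosses t j \<and> mark t j = v) else v)" for v
  have \<sigma>: "\<sigma> (mark t j) = mark t' j" if j: "j < m" "crosses t j" for j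
  proof -
    let ?i = "SOME i. i < m \<and> crosses t i \<and> mark t i = mark t j"
    have i: "?i < m \<and> crosses t ?i \<and> mark t ?i = mark t j" by (rule someI_ex) (use j in blast)
    then have "(?i, j) \<in> profile t" using j by (auto simp: profile_def)
    then have "mark t' ?i = mark t' j" using same by (auto simp: profile_def)
    then show ?thesis using j unfolding \<sigma>_def by auto
  qed
  have \<sigma>B: "\<sigma> v \<in> ?B \<or> \<sigma> v = v" for v
  proof (cases "\<exists>j. j < m \<and> crosses t j \<and> mark t j = v")
    case True
    then show ?thesis using jump(2) \<sigma> by metis
  next
    case False
    then show ?thesis by (simp only: \<sigma>_def if_False simp_thms)
  qed
  interpret U: rooted_td ?U r p bag using rooted_td_minus_desc t .
  have pt: "p t \<in> ?U" using par par_not_desc t by auto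
  note I = outside_inter_desc[OF t] and I' = outside_inter_desc[OF t'N]
  have nb: "finite (bag s)" "card (bag s) \<le> Suc k" if "s \<in> N" for s
    using narrow that by (auto simp: narrow_def)
  have "\<exists>L p' bag' s'. finite L \<and> L \<inter> (?U \<union> N) = {} \<and> card L \<le> Suc (card (?A - ?B)) \<and>
    (\<forall>t\<in>?U \<union> N. p' t = p t \<and> bag' t = bag t) \<and> rooted_td (?U \<union> L) r p' bag' \<and> s' \<in> L \<and> bag' s' = ?B \<and>
    narrow k L bag' \<and> \<Union>(bag' ` L) \<subseteq> \<Union>(bag ` ?U) \<union> ?B \<and>
    (\<forall>v\<in>?A. \<sigma> v \<in> ?B \<or> \<sigma> v = v \<longrightarrow> share_bag L bag' v (\<sigma> v))"
  \<comment> \<open>Here \<open>Y\<close> is \<open>N\<close>, so that the new nodes also avoid the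
    names used in \<open>desc t'\<close>.\<close>
  proof (rule ladder[where s = "p t" and k = k])
    show "rooted_td ?U r p bag" by (rule U.rooted_td_axioms)
    show "card ?A \<le> k" using card_adh t .
    show "finite ?A" "finite ?B" using nb t t'N by auto
    show "card ?B \<le> Suc k" using card_adh[OF t'N] by simp
    have "?B \<subseteq> \<Union>(bag ` desc t)" using t'(1) by blast
    then show "?B \<inter> \<Union>(bag ` ?U) \<subseteq> ?A" using I by blast
    show "\<forall>v\<in>?A - ?B. \<sigma> v \<in> ?B \<or> \<sigma> v = v" using \<sigma>B by blast
  qed (use pt fin in auto)
  then obtain L p' bag' s' where L: "finite L" "L \<inter> (?U \<union> N) = {}" "card L \<le> Suc (card (?A - ?B))"
    "\<forall>t\<in>?U \<union> N. p' t = p t \<and> bag' t = bag t" "rooted_td (?U \<union> L) r p' bag'" "s' \<in> L" "bag' s' = ?B"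
    "narrow k L bag'" "\<Union>(bag' ` L) \<subseteq> \<Union>(bag ` ?U) \<union> ?B"
    "\<forall>v\<in>?A. \<sigma> v \<in> ?B \<or> \<sigma> v = v \<longrightarrow> share_bag L bag' v (\<sigma> v)" by - (elim exE conjE, rule that)
  have LN: "L \<inter> N = {}" using L(2) by blast
  have eq: "bag' s = bag s" "p' s = p s" if "s \<in> N" for s using L(4) that by auto
  have eqU: "bag' s = bag s" if "s \<in> ?U" for s by (rule eq(1)) (use that in blast)
  have eqD: "bag' s = bag s" "p' s = p s" if "s \<in> ?D" for s
    by (rule eq; use that desc_subset in blast)+
  have imU: "bag' ` ?U = bag ` ?U" and imD: "bag' ` ?D = bag ` ?D"
    using eqU eqD(1) by (simp_all cong: image_cong_simp)
  let ?N = "?U \<union> L \<union> ?D"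
  interpret UL: rooted_td "?U \<union> L" r p' bag' by (rule L(5))
  interpret D0: rooted_td ?D t' p bag using rooted_td_desc t'N by blast
  have tree: "rooted_td ?N r (p'(t' := s')) bag'"
  proof (rule UL.rooted_td_join)
    show "rooted_td ?D t' p' bag'" using eqD by (intro D0.rooted_td_cong) simp_all
    show "(?U \<union> L) \<inter> ?D = {}" using LN dd desc_subset by blast
    show "s' \<in> ?U \<union> L" using L(6) by simp
    \<comment> \<open>The ladder brings in no vertex besides those outside \<open>t\<close> and
      those of \<open>?B\<close>, so the parts to be glued meet only in \<open>?B\<close>.\<close>
    have "v \<in> ?B" if "v \<in> \<Union>(bag' ` (?U \<union> L))" "v \<in> \<Union>(bag ` ?D)" for v
    proof (cases "v \<in> \<Union>(bag ` ?U)")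
      case True
      then have "v \<in> \<Union>(bag ` outside t')" using dd by blast
      then show ?thesis using I' that by blast
    next
      case False
      then show ?thesis using that imU L(9) by (auto simp: image_Un)
    qed
    then show "\<Union>(bag' ` (?U \<union> L)) \<inter> \<Union>(bag' ` ?D) \<subseteq> bag' s' \<inter> bag' t'"
      unfolding imD L(7) eq(1)[OF t'N(1)] by blast
  qed
  have covU: "share_bag ?N bag' u v" if "share_bag ?U bag u v" for u v
    using that eqU unfolding share_bag_def by blast
  have covD: "share_bag ?N bag' u v" if "share_bag ?D bag u v" for u v
    using that eqD(1) unfolding share_bag_def by blast
  have covL: "share_bag ?N bag' (mark t j) (mark t' j)" if "j < m" "crosses t j" for j
  proof -
    have "share_bag L bag' (mark t j) (\<sigma> (mark t j))"
      using bspec[OF L(10) jump(1)[OF that]] jump(2)[OF that] \<sigma>[OF that] by metis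
    then show ?thesis unfolding \<sigma>[OF that] share_bag_def by blast
  qed
  have "\<exists>ys'. solves k F m xs ?N r (p'(t' := s')) bag' ys'"
  proof (rule solvesI[OF tree])
    have "narrow k ?U bag'" using eqU nb by (simp add: narrow_def)
    moreover have "narrow k ?D bag'" using eqD nb[OF subsetD[OF desc_subset]] by (simp add: narrow_def)
    ultimately show "narrow k ?N bag'" using L(8) unfolding narrow_def by blast
    \<comment> \<open>A terminal of \<open>t\<close> is one of \<open>t'\<close> too, so its chosen
      node lies below \<open>t'\<close> and survives.\<close>
    have "v \<in> \<Union>(bag ` ?U) \<union> \<Union>(bag ` ?D)" if "v \<in> F" for v
      using terminal_outside[OF that, of t] terminal_desc[of v t'] same(1) by (metis UnCI)
    then have "F \<subseteq> \<Union>(bag ` ?U) \<union> \<Union>(bag ` ?D)" by (rule subsetI)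
    also have "\<dots> \<subseteq> \<Union>(bag' ` ?N)" unfolding imU[symmetric] imD[symmetric] by blast
    finally show "F \<subseteq> \<Union>(bag' ` ?N)" .
    show "shortcut (ys j) (xs j)" if "j < m" for j using short that .
    fix j assume j: "j < m"
    note e = ys_ends[OF j] and w = walk[OF j]
    show "\<exists>zs. shortcut zs (ys j) \<and> bag_walk ?N bag' zs"
    \<comment> \<open>A crossing walk jumps along the ladder, possibly read backwards. A walk with
      both ends on one side stays there once its excursions are filtered out.\<close>
    proof (cases "crosses t j")
      case True
      from jump(3)[OF j this] obtain zs where zs: "shortcut zs (orient t j)"
        "successively (\<lambda>x y. share_bag ?U bag (fst x) (fst y)
        \<or> share_bag ?D bag (fst x) (fst y) \<or> (fst x = mark t j \<and> fst y = mark t' j)) zs" by blast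
      have "bag_walk ?N bag' zs"
        by (rule successively_mono[OF zs(2)]) (use covU covD covL[OF j True] in auto)
      then have "bag_walk ?N bag' zs \<and> bag_walk ?N bag' (rev zs)"
        by (simp only: bag_walk_rev simp_thms)
      moreover have "shortcut zs (ys j) \<or> shortcut (rev zs) (ys j)"
        using zs(1) shortcut_rev[of zs "ys j"]
        by (cases "fst (hd (ys j)) \<in> terminals t") (simp_all only: orient_def if_True if_False simp_thms)
      ultimately show ?thesis by metis
    next
      case False
      show ?thesis
      proof (cases "fst (hd (ys j)) \<in> terminals t")
        case True
        then have "fst (hd (ys j)) \<in> \<Union>(bag ` ?D)" "fst (last (ys j)) \<in> \<Union>(bag ` ?D)"
          using False terminal_desc[of _ t'] same(1) unfolding crosses_def by metis+
        then have "shortcut (filter (\<lambda>x. fst x \<in> \<Union>(bag ` ?D)) (ys j)) (ys j)"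
          by (intro shortcut_filter ys_ne[OF j])
        moreover have "bag_walk ?N bag' (filter (\<lambda>x. fst x \<in> \<Union>(bag ` ?D)) (ys j))"
          by (rule successively_mono[OF bag_walk_filter_desc[OF t'N w]]) (use covD in auto)
        ultimately show ?thesis by (intro exI conjI)
      next
        case out: False
        then have "fst (hd (ys j)) \<in> \<Union>(bag ` ?U)" "fst (last (ys j)) \<in> \<Union>(bag ` ?U)"
          using False terminal_outside[OF e(1), of t] terminal_outside[OF e(2), of t] unfolding crosses_def by metis+
        then have "shortcut (filter (\<lambda>x. fst x \<in> \<Union>(bag ` ?U)) (ys j)) (ys j)"
          by (intro shortcut_filter ys_ne[OF j])
        moreover have "bag_walk ?N bag' (filter (\<lambda>x. fst x \<in> \<Union>(bag ` ?U)) (ys j))"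
          by (rule successively_mono[OF bag_walk_filter_outside[OF t w]]) (use covU in auto)
        ultimately show ?thesis by (intro exI conjI)
      qed
    qed
  qed
  then have "card N \<le> card ?N" by (elim exE) (rule minimal)
  also have "\<dots> \<le> card ?U + card L + card ?D"
    using card_Un_le[of "?U \<union> L" ?D] card_Un_le[of ?U L] by linarith
  finally have "card N \<le> card ?U + card L + card ?D" .
  moreover have "card N = card ?U + card (desc t)"
    using card_Diff_subset[OF _ desc_subset[of t]] card_mono[OF fin desc_subset[of t]]
      finite_subset[OF desc_subset fin, of t] by simp
  moreover have "card (desc t - ?D) = card (desc t) - card ?D"
    using dd D0.fin by (intro card_Diff_subset)
  moreover have "card (?A - ?B) \<le> k"
    by (rule order_trans[OF card_mono card_adh[OF t]]) (use nb(1)[OF t(1)] in auto)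
  moreover have "card ?D \<le> card (desc t)"
    using finite_subset[OF desc_subset fin] dd by (rule card_mono)
  ultimately show ?thesis using L(3) by arith
qed

text \<open>Two edges with the same nonempty set of terminals have a chosen node
  \<open>loc v\<close> below both, so the class is a chain. Besides its lowest node
  \<open>t'\<close>, all of it lies between its extreme members, where \<open>card_between\<close>
  leaves room for k + 1 nodes.\<close>

lemma card_class:
  assumes Q: "Q \<subseteq> N - {r}" and same: "\<And>s t. s \<in> Q \<Longrightarrow> t \<in> Q \<Longrightarrow> terminals s = terminals t \<and> profile s = profile t"
  shows "card Q \<le> k + 2"
proof (cases "Q = {}")
  case False
  have finQ: "finite Q" using Q fin finite_subset by blast
  have chain: "desc s \<subseteq> desc t \<or> desc t \<subseteq> desc s" if st: "s \<in> Q" "t \<in> Q" for s t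
  proof -
    obtain v where "v \<in> terminals s" using terminals_nonempty[of s] st Q by blast
    then have "loc v \<in> desc s" "loc v \<in> desc t" using same[OF st] by (auto simp: terminals_def)
    then have "(s, t) \<in> E\<^sup>* \<or> (t, s) \<in> E\<^sup>*" using E_comparable[of "loc v"] by (auto simp: desc_def)
    then show ?thesis using desc_mono by blast
  qed
  have "Max ((\<lambda>t. card (desc t)) ` Q) \<in> (\<lambda>t. card (desc t)) ` Q" "Min ((\<lambda>t. card (desc t)) ` Q) \<in> (\<lambda>t. card (desc t)) ` Q"
    using finQ False by auto
  then obtain t t' where t: "t \<in> Q" "card (desc t) = Max ((\<lambda>t. card (desc t)) ` Q)"
    and t': "t' \<in> Q" "card (desc t') = Min ((\<lambda>t. card (desc t)) ` Q)" by auto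
  have le: "card (desc q) \<le> card (desc t)" "card (desc t') \<le> card (desc q)" if "q \<in> Q" for q
    using finQ t(2) t'(2) that by simp_all
  have fd: "finite (desc q)" for q using desc_subset fin finite_subset by blast
  have top: "desc q \<subseteq> desc t" "desc t' \<subseteq> desc q" if "q \<in> Q" for q
    using chain[OF that t(1)] chain[OF that t'(1)] le[OF that] card_seteq[OF fd] by blast+
  have inj: "q = t'" if "q \<in> Q" "q \<in> desc t'" for q
  proof -
    have "t' \<in> desc q" using top(2)[OF that(1)] desc_self t'(1) Q by blast
    then show ?thesis using that E_antisym by (auto simp: desc_def)
  qed
  have "Q - {t'} \<subseteq> desc t - desc t'" using top desc_self Q inj by blast
  then have "card (Q - {t'}) \<le> card (desc t - desc t')" using fd by (intro card_mono) auto
  also have "\<dots> \<le> Suc k"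
  proof (cases "t' = t")
    case False
    have "t' \<in> desc t" using top(1)[OF t'(1)] desc_self t'(1) Q by blast
    then show ?thesis using card_between[of t t'] t(1) t'(1) Q False same by blast
  qed simp
  finally show ?thesis using t'(1) finQ by (simp add: card_Diff_singleton)
qed simp

text \<open>Tree edges are named by their lower nodes. There are at most \<open>2 ^ card F\<close>
  separations and \<open>2 ^ (m * m)\<close> profiles, and k + 2 edges for each pair of them; the
  successor accounts for the root.\<close>

lemma card_bound: "card N \<le> Suc (2 ^ card F * 2 ^ (m * m) * (k + 2))"
proof -
  let ?C = "Pow F \<times> Pow ({..<m} \<times> {..<m})"
  let ?f = "\<lambda>t. (terminals t, profile t)"
  let ?Q = "\<lambda>c. {t \<in> N - {r}. ?f t = c}"
  have "?f t \<in> ?C" for t by (auto simp: terminals_def profile_def)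
  then have "N - {r} \<subseteq> (\<Union>c\<in>?C. ?Q c)" by blast
  then have "card (N - {r}) \<le> card (\<Union>c\<in>?C. ?Q c)" using fin finF by (intro card_mono) auto
  also have "\<dots> \<le> (\<Sum>c\<in>?C. card (?Q c))" using finF by (intro card_UN_le) auto
  also have "\<dots> \<le> (\<Sum>c\<in>?C. k + 2)"
  proof (rule sum_mono)
    fix c
    show "card (?Q c) \<le> k + 2" by (rule card_class) (blast, metis (mono_tags, lifting) mem_Collect_eq prod.inject)
  qed
  also have "\<dots> = 2 ^ card F * 2 ^ (m * m) * (k + 2)"
    using finF by (simp add: card_Pow card_cartesian_product)
  finally show ?thesis using root fin by (simp add: card_Diff_singleton)
qed

end

text \<open>One successor stems from the root in \<open>card_bound\<close>, the other from a walk
  having one entry more than steps. Natural numbers as nodes ensure that ladders find fresh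
  ones.\<close>

theorem bounded_shortcuts:
  fixes xs :: "nat \<Rightarrow> ('v \<times> 'q) list" and N :: "nat set"
  assumes "rooted_td N r p bag" "narrow k N bag" "finite F" "F \<subseteq> \<Union>(bag ` N)"
    and "\<And>j. j < m \<Longrightarrow> xs j \<noteq> [] \<and> bag_walk N bag (xs j) \<and> fst (hd (xs j)) \<in> F \<and> fst (last (xs j)) \<in> F"
  shows "\<exists>(N' :: nat set) r' p' bag' ys. rooted_td N' r' p' bag' \<and> narrow k N' bag' \<and> F \<subseteq> \<Union>(bag' ` N') \<and>
    (\<forall>j<m. shortcut (ys j) (xs j) \<and> bag_walk N' bag' (ys j) \<and>
      length (ys j) \<le> Suc (Suc (2 ^ card F * 2 ^ (m * m) * (k + 2))))"
proof -
  have "solves k F m xs N r p bag xs" using assms shortcut_refl by (auto simp: solves_def)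
  then have "\<exists>n N r p bag ys. solves k F m xs N r p bag ys \<and> card N = n" by blast
  define n where "n = (LEAST n. \<exists>N r p bag ys. solves k F m xs N r p bag ys \<and> card N = n)"
  have "\<exists>N r p bag ys. solves k F m xs N r p bag ys \<and> card N = n"
    unfolding n_def by (rule LeastI_ex) fact
  then obtain N' r' p' bag' ys where sol: "solves k F m xs N' r' p' bag' ys" "card N' = n" by blast
  interpret minimal_solution k F m xs N' r' p' bag' ys
  proof
    show "card N' \<le> card N''" if "solves k F m xs N'' r'' p'' bag'' ys''" for N'' r'' p'' bag'' ys''
      unfolding sol(2) n_def by (rule Least_le) (use that in blast)
  qed (use assms sol in auto)
  have "\<forall>j. \<exists>zs. j < m \<longrightarrow> shortcut zs (ys j) \<and> bag_walk N' bag' zs \<and> length zs \<le> Suc (card N')"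
    using short_walk[OF fin walk ys_ne] by blast
  then obtain zs where zs: "\<And>j. j < m \<Longrightarrow> shortcut (zs j) (ys j) \<and> bag_walk N' bag' (zs j) \<and> length (zs j) \<le> Suc (card N')"
    by metis
  have "\<forall>j<m. shortcut (zs j) (xs j) \<and> bag_walk N' bag' (zs j) \<and>
      length (zs j) \<le> Suc (Suc (2 ^ card F * 2 ^ (m * m) * (k + 2)))"
  proof (intro allI impI conjI)
    fix j assume j: "j < m"
    show "shortcut (zs j) (xs j)" using zs[OF j] short[OF j] shortcut_trans by blast
    show "bag_walk N' bag' (zs j)" using zs[OF j] by blast
    show "length (zs j) \<le> Suc (Suc (2 ^ card F * 2 ^ (m * m) * (k + 2)))" using zs[OF j] card_bound by linarith
  qed
  then show ?thesis using rooted_td_axioms narrow F_covered by (intro exI conjI)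
qed

section \<open>Tree decompositions and rooted tree decompositions\<close>

lemma connected_iff:
  assumes "wf_digraph G"
  shows "connected G \<longleftrightarrow> verts G \<noteq> {} \<and>
    (\<forall>u\<in>verts G. \<forall>v\<in>verts G. (u, v) \<in> (\<Union>e\<in>arcs G. {(tail G e, head G e), (head G e, tail G e)})\<^sup>*)"
proof -
  interpret wf_digraph G by fact
  let ?S = "mk_symmetric G"
  interpret S: pair_wf_digraph ?S
    by unfold_locales (auto simp: mk_symmetric_def)
  show ?thesis
    unfolding connected_def strongly_connected_def
    using S.reachable_conv' by (simp add: mk_symmetric_def cong: ball_cong)
qed

lemma connected_induced_iff:
  fixes T :: "'t pair_pre_digraph"
  assumes "pair_sym_digraph T" "X \<subseteq> pverts T"
  shows "connected (with_proj T \<restriction> X) \<longleftrightarrow> X \<noteq> {} \<and> (\<forall>u\<in>X. \<forall>v\<in>X. (u, v) \<in> (parcs T \<inter> X \<times> X)\<^sup>*)"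
proof -
  interpret pair_sym_digraph T by fact
  have "wf_digraph (with_proj T \<restriction> X)" using wellformed_induce_subgraph by blast
  moreover have "(\<Union>e\<in>arcs (with_proj T \<restriction> X). {(tail (with_proj T \<restriction> X) e, head (with_proj T \<restriction> X) e),
      (head (with_proj T \<restriction> X) e, tail (with_proj T \<restriction> X) e)}) = parcs T \<inter> X \<times> X"
    using arcs_symmetric by auto
  ultimately show ?thesis by (simp add: connected_iff)
qed

lemma connected_pair_iff:
  fixes T :: "'t pair_pre_digraph"
  assumes "pair_sym_digraph T"
  shows "connected (with_proj T) \<longleftrightarrow> pverts T \<noteq> {} \<and> (\<forall>u\<in>pverts T. \<forall>v\<in>pverts T. (u, v) \<in> (parcs T)\<^sup>*)"
proof -
  interpret pair_sym_digraph T by fact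
  have "(\<Union>e\<in>arcs (with_proj T). {(tail (with_proj T) e, head (with_proj T) e),
      (head (with_proj T) e, tail (with_proj T) e)}) = parcs T"
    using arcs_symmetric by auto
  then show ?thesis using connected_iff[of "with_proj T"] wf_digraph_axioms by simp
qed

lemma pcas_nth:
  "pcas u p v \<Longrightarrow> Suc i < length p \<Longrightarrow> snd (p ! i) = fst (p ! Suc i)"
proof (induction p arbitrary: u i)
  case (Cons e es)
  then show ?case by (cases i; cases es) auto
qed simp

lemma pcas_ends:
  "pcas u p v \<Longrightarrow> p \<noteq> [] \<Longrightarrow> fst (p ! 0) = u \<and> snd (p ! (length p - 1)) = v"
proof (induction p arbitrary: u)
  case (Cons e es)
  then show ?case by (cases es) auto
qed simp

lemma pcas_pawalk_verts: "pcas u p v \<Longrightarrow> pawalk_verts u p = u # map snd p"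
  by (induction p arbitrary: u) auto

section \<open>The undirected tree of a parent function\<close>

context rooted_td
begin

definition "tree_graph = \<lparr>pverts = N, parcs = E \<union> E\<inverse>\<rparr>"

lemma tree_graph_simps [simp]: "pverts tree_graph = N" "parcs tree_graph = E \<union> E\<inverse>"
  by (simp_all add: tree_graph_def)

lemma E_loopfree: "(s, t) \<in> E \<Longrightarrow> s \<noteq> t"
  by (metis E_irrefl E_iff r_into_trancl')

lemma finite_E: "finite E"
  by (rule finite_subset[of _ "N \<times> N"]) (use fin par in \<open>auto simp: E_iff\<close>)

lemma pair_graph_tree_graph: "pair_graph tree_graph"
proof
  show "finite (parcs tree_graph)" using finite_E by simp
  show "fst e \<noteq> snd e" if "e \<in> parcs tree_graph" for e
    using that E_loopfree by fastforce
  show "symmetric (with_proj tree_graph)" by (simp add: symmetric_def sym_Un_converse)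
  show "fst e \<in> pverts tree_graph" "snd e \<in> pverts tree_graph" if "e \<in> parcs tree_graph" for e
    using that par by (auto simp: parent_rel_def)
qed (simp add: fin)

lemma wf_E: "wf E"
proof (rule finite_acyclic_wf[OF finite_E])
  show "acyclic E" unfolding acyclic_def
    using E_irrefl by (metis E_iff tranclD)
qed

text \<open>Take a vertex of the cycle none of whose children is on the cycle. Both of its
  neighbours on the cycle are its parent; as the cycle repeats no vertex, predecessor and successor
  have the same index, which needs length at most 2.\<close>

lemma no_long_cycle:
  assumes "pre_digraph.cycle (with_proj tree_graph) es"
  shows "length es < 3"
proof (rule ccontr)
  let ?n = "length es"
  assume n: "\<not> ?n < 3"
  interpret T: pair_graph tree_graph by (rule pair_graph_tree_graph)
  obtain u where u: "set es \<subseteq> E \<union> E\<inverse>" "pcas u es u" "distinct (tl (pawalk_verts u es))"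
    using assms unfolding T.cycle_def T.awalk_def by auto
  have dist: "distinct (map snd es)" using u pcas_pawalk_verts[OF u(2)] by simp
  define prev where "prev i = (if i = 0 then ?n - 1 else i - 1)" for i
  define succ where "succ i = (if Suc i = ?n then 0 else Suc i)" for i
  have prev: "prev i < ?n" "snd (es ! prev i) = fst (es ! i)" if "i < ?n" for i
    using that pcas_nth[OF u(2), of "i - 1"] pcas_ends[OF u(2)] n by (auto simp: prev_def)
  have succ: "succ i < ?n" "fst (es ! succ i) = snd (es ! i)" if "i < ?n" for i
  proof -
    show "succ i < ?n" using that n by (auto simp: succ_def)
    have "es \<noteq> []" using n by auto
    show "fst (es ! succ i) = snd (es ! i)"
    proof (cases "Suc i = ?n")
      case True
      then have "i = ?n - 1" by simp
      then show ?thesis using pcas_ends[OF u(2) \<open>es \<noteq> []\<close>] True by (simp add: succ_def)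
    next
      case False
      then show ?thesis using pcas_nth[OF u(2), of i] that by (simp add: succ_def)
    qed
  qed
  let ?S = "set (map snd es)"
  have inS: "snd (es ! i) \<in> ?S" if "i < ?n" for i using that by simp
  have "?S \<noteq> {}" using n by auto
  then obtain t where t: "t \<in> ?S" "\<And>y. (y, t) \<in> E \<Longrightarrow> y \<notin> ?S"
    using wf_E by (metis ex_in_conv wfE_min)
  then obtain i where i: "i < ?n" "t = snd (es ! i)" by (auto simp: in_set_conv_nth)
  have arc: "(fst (es ! j), snd (es ! j)) \<in> E \<union> E\<inverse>" if "j < ?n" for j
    using u(1) that by (metis nth_mem prod.collapse subsetD)
  have "fst (es ! i) \<in> ?S" using prev[OF i(1)] inS by metis
  then have "(fst (es ! i), t) \<notin> E" using t(2) by blast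
  then have "(t, fst (es ! i)) \<in> E" using arc[OF i(1)] unfolding i(2)[symmetric] by blast
  moreover have "(snd (es ! succ i), t) \<notin> E" using t(2) inS[OF succ(1)[OF i(1)]] by blast
  then have "(t, snd (es ! succ i)) \<in> E"
    using arc[OF succ(1)[OF i(1)]] unfolding succ(2)[OF i(1)] i(2)[symmetric] by blast
  ultimately have "snd (es ! prev i) = snd (es ! succ i)" using prev(2)[OF i(1)] by (simp add: E_iff)
  then have "prev i = succ i"
    using nth_eq_iff_index_eq[OF dist, of "prev i" "succ i"] prev(1)[OF i(1)] succ(1)[OF i(1)] by simp
  then show False using n i(1) by (auto simp: prev_def succ_def split: if_splits)
qed

lemma undirected_tree_tree_graph: "undirected_tree tree_graph"
proof -
  interpret T: pair_graph tree_graph by (rule pair_graph_tree_graph)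
  have "(u, v) \<in> (E \<union> E\<inverse>)\<^sup>*" if "u \<in> N" "v \<in> N" for u v
  proof -
    have "(u, r) \<in> (E \<union> E\<inverse>)\<^sup>*" using reach[OF that(1)] by (rule subsetD[OF rtrancl_mono, rotated]) simp
    moreover have "(r, v) \<in> (E\<inverse>)\<^sup>*" using reach[OF that(2)] by (simp add: rtrancl_converse)
    then have "(r, v) \<in> (E \<union> E\<inverse>)\<^sup>*" by (rule subsetD[OF rtrancl_mono, rotated]) simp
    ultimately show ?thesis by simp
  qed
  then have "connected (with_proj tree_graph)"
    using connected_pair_iff[OF T.pair_sym_digraph_axioms] root by auto
  then show ?thesis using pair_graph_tree_graph no_long_cycle
    unfolding undirected_tree_def by (meson not_less)
qed

lemma top_connected:
  assumes "t \<in> N" "v \<in> bag t"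
  shows "\<exists>u\<in>N. is_top r p bag v u \<and> (t, u) \<in> (E \<inter> {t \<in> N. v \<in> bag t} \<times> {t \<in> N. v \<in> bag t})\<^sup>*"
  using assms
proof (induction rule: tree_induct)
  case root
  then show ?case using rooted_td.root[OF rooted_td_axioms] by (auto simp: is_top_def)
next
  case (child s)
  show ?case
  proof (cases "v \<in> bag (p s)")
    case True
    then have "(s, p s) \<in> E \<inter> {t \<in> N. v \<in> bag t} \<times> {t \<in> N. v \<in> bag t}"
      using child par by (auto simp: E_iff)
    then show ?thesis using child True by (meson converse_rtrancl_into_rtrancl)
  next
    case False
    then show ?thesis using child by (auto simp: is_top_def)
  qed
qed

text \<open>Any two nodes holding \<open>v\<close> climb, through nodes holding \<open>v\<close>, to
  the same unique top.\<close>

lemma bag_connected: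
  assumes "v \<in> \<Union>(bag ` N)"
  shows "connected (with_proj tree_graph \<restriction> {t \<in> N. v \<in> bag t})"
proof -
  interpret T: pair_graph tree_graph by (rule pair_graph_tree_graph)
  let ?X = "{t \<in> N. v \<in> bag t}"
  let ?R = "E \<inter> ?X \<times> ?X" and ?S = "(E \<union> E\<inverse>) \<inter> ?X \<times> ?X"
  have "(s, t) \<in> ?S\<^sup>*" if st: "s \<in> ?X" "t \<in> ?X" for s t
  proof -
    obtain u u' where u: "u \<in> N" "is_top r p bag v u" "(s, u) \<in> ?R\<^sup>*"
      and u': "u' \<in> N" "is_top r p bag v u'" "(t, u') \<in> ?R\<^sup>*"
      using top_connected[of s v] top_connected[of t v] st by blast
    have "u' = u" using top_unique u u' by blast
    have "(u, t) \<in> (?R\<inverse>)\<^sup>*" using u'(3) unfolding \<open>u' = u\<close> by (simp add: rtrancl_converse)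
    moreover have "?R\<inverse> \<subseteq> ?S" "?R \<subseteq> ?S" by auto
    ultimately have "(u, t) \<in> ?S\<^sup>*" "(s, u) \<in> ?S\<^sup>*" using u(3) rtrancl_mono by blast+
    then show ?thesis by simp
  qed
  moreover have "?X \<noteq> {}" using assms by blast
  ultimately show ?thesis
    using connected_induced_iff[OF T.pair_sym_digraph_axioms, of ?X] by simp
qed

end

section \<open>Tree-width expressed by rooted tree decompositions\<close>

lemma rooted_td_restrict:
  assumes "rooted_td N r p bag"
  shows "rooted_td N r p (\<lambda>t. bag t \<inter> W)"
proof -
  interpret rooted_td N r p bag by fact
  show ?thesis
  proof
    have "is_top r p bag v t" if "is_top r p (\<lambda>t. bag t \<inter> W) v t" for v t
      using that by (auto simp: is_top_def)
    then show "s = t" if "s \<in> N" "t \<in> N" "is_top r p (\<lambda>t. bag t \<inter> W) v s" "is_top r p (\<lambda>t. bag t \<inter> W) v t" for v s t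
      using that top_unique by blast
  qed (use fin root par reach in blast)+
qed

text \<open>The second conclusion is recorded for the converse direction, where the
  \<open>LEAST\<close> in \<open>tree_width\<close> has to be known to be attained.\<close>

lemma tree_width_leI:
  fixes H :: "('v, 'e) pre_digraph" and N :: "nat set"
  assumes "rooted_td N r p bag" "narrow k N bag" "verts H \<subseteq> \<Union>(bag ` N)"
    and arcs: "\<And>e. e \<in> arcs H \<Longrightarrow> tail H e \<in> verts H \<and> head H e \<in> verts H \<and> share_bag N bag (tail H e) (head H e)"
  shows "tree_width H \<le> k" "\<exists>(T :: nat pair_pre_digraph) bag. tree_decomposition H T bag"
proof -
  \<comment> \<open>The bags of a tree decomposition contain vertices of \<open>H\<close> only,
    while those given here may contain others.\<close>
  let ?b = "\<lambda>t. bag t \<inter> verts H"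
  interpret rooted_td N r p ?b using assms(1) by (rule rooted_td_restrict)
  have dec: "tree_decomposition H tree_graph ?b"
    unfolding tree_decomposition_def
  proof (intro conjI ballI)
    show "undirected_tree tree_graph" by (rule undirected_tree_tree_graph)
    show "\<exists>t\<in>pverts tree_graph. tail H e \<in> ?b t \<and> head H e \<in> ?b t" if "e \<in> arcs H" for e
      using arcs[OF that] by (auto simp: share_bag_def)
    show "connected (with_proj tree_graph \<restriction> {t \<in> pverts tree_graph. v \<in> ?b t})" if "v \<in> verts H" for v
      using bag_connected[of v] assms(3) that by auto
  qed auto
  then show "\<exists>(T :: nat pair_pre_digraph) bag. tree_decomposition H T bag" by blast
  have "card (?b t) \<le> Suc k" if "t \<in> N" for t
    using assms(2) that by (meson card_mono inf_le1 le_trans narrow_def)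
  then have "Max ((\<lambda>t. card (?b t)) ` N) \<le> Suc k"
    using fin root by (intro Max.boundedI) auto
  then have "width tree_graph ?b \<le> k" unfolding width_def by simp
  moreover have "tree_width H \<le> width tree_graph ?b"
    unfolding tree_width_def by (rule Least_le) (use dec in blast)
  ultimately show "tree_width H \<le> k" by simp
qed

text \<open>A largest vertex set whose induced arcs come from a parent function is everything.
  Otherwise connectedness supplies a neighbour \<open>t\<close> outside; its neighbour in the set is
  unique, since a second one would close a cycle through \<open>t\<close>, and so it can serve as
  the parent of \<open>t\<close>.\<close>

lemma undirected_tree_rooted:
  fixes T :: "'t pair_pre_digraph"
  assumes "undirected_tree T"
  obtains r p where "r \<in> pverts T" "\<And>t. t \<in> pverts T \<Longrightarrow> t \<noteq> r \<Longrightarrow> p t \<in> pverts T"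
    "\<And>t. t \<in> pverts T \<Longrightarrow> (t, r) \<in> (parent_rel (pverts T) r p)\<^sup>*"
    "parcs T = parent_rel (pverts T) r p \<union> (parent_rel (pverts T) r p)\<inverse>"
proof -
  interpret pair_graph T using assms by (simp add: undirected_tree_def)
  let ?V = "pverts T" and ?A = "parcs T"
  have conn: "?V \<noteq> {}" "\<And>u v. u \<in> ?V \<Longrightarrow> v \<in> ?V \<Longrightarrow> (u, v) \<in> ?A\<^sup>*"
    using assms connected_pair_iff[OF pair_sym_digraph_axioms] by (auto simp: undirected_tree_def)
  define P where "P M r p \<longleftrightarrow> M \<subseteq> ?V \<and> r \<in> M \<and> (\<forall>t\<in>M - {r}. p t \<in> M) \<and>
    (\<forall>t\<in>M. (t, r) \<in> (parent_rel M r p)\<^sup>*) \<and>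
    ?A \<inter> M \<times> M = parent_rel M r p \<union> (parent_rel M r p)\<inverse>" for M r p
  obtain r0 where "r0 \<in> ?V" using conn by blast
  then have "P {r0} r0 id" using no_loops' by (auto simp: P_def parent_rel_def)
  then have "\<exists>M. (\<exists>r p. P M r p)" by blast
  moreover have "\<And>M. \<exists>r p. P M r p \<Longrightarrow> card M < Suc (card ?V)"
    using card_mono[OF pair_finite_verts] by (auto simp: P_def less_Suc_eq_le)
  ultimately obtain M where M: "\<exists>r p. P M r p" "\<And>M'. \<exists>r p. P M' r p \<Longrightarrow> card M' \<le> card M"
    using ex_has_greatest_nat[of "\<lambda>M. \<exists>r p. P M r p" _ card] by metis
  obtain r p where P: "P M r p" using M by blast
  let ?E = "parent_rel M r p"
  have "M = ?V"
  proof (rule ccontr)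
    assume "M \<noteq> ?V"
    then obtain x where x: "x \<in> ?V" "x \<notin> M" using P by (auto simp: P_def)
    have "(r, x) \<in> ?A\<^sup>*" using conn P x by (auto simp: P_def)
    then have "\<exists>s t. s \<in> M \<and> t \<notin> M \<and> (s, t) \<in> ?A" using x(2)
    proof (induction rule: rtrancl_induct)
      case base
      then show ?case using P by (simp add: P_def)
    qed blast
    then obtain s t where st: "s \<in> M" "t \<notin> M" "(s, t) \<in> ?A" by blast
    have unique: "s' = s" if s': "s' \<in> M" "(s', t) \<in> ?A" for s'
    proof (rule ccontr)
      assume ne: "s' \<noteq> s"
      let ?T = "\<lparr>pverts = M, parcs = ?A \<inter> M \<times> M\<rparr>"
      interpret M: pair_wf_digraph ?T by unfold_locales auto
      have up: "(t, r) \<in> (?A \<inter> M \<times> M)\<^sup>* \<and> (r, t) \<in> (?A \<inter> M \<times> M)\<^sup>*" if "t \<in> M" for t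
      proof -
        have "(t, r) \<in> ?E\<^sup>*" "(r, t) \<in> (?E\<inverse>)\<^sup>*"
          using that P by (auto simp: P_def rtrancl_converse)
        then show ?thesis using P rtrancl_mono[of ?E "?A \<inter> M \<times> M"] rtrancl_mono[of "?E\<inverse>" "?A \<inter> M \<times> M"]
          unfolding P_def by blast
      qed
      have "(s, s') \<in> (?A \<inter> M \<times> M)\<^sup>*" using up[OF st(1)] up[OF s'(1)] by (meson rtrancl_trans)
      then have "reachable (with_proj ?T) s s'" using M.reachable_conv'[of s s'] st(1) by simp
      then obtain q where q: "M.apath s q s'" using M.reachable_apath by blast
      then have q': "set q \<subseteq> ?A \<inter> M \<times> M" "pcas s q s'" "distinct (pawalk_verts s q)"
        by (auto simp: M.apath_def M.awalk_def)
      have "q \<noteq> []" using q'(2) ne by auto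
      \<comment> \<open>The path \<open>q\<close> is nonempty because its ends differ, so that
        closing it through \<open>t\<close> gives a cycle with at least three arcs.\<close>
      let ?c = "q @ [(s', t), (t, s)]"
      have "pcas s q s' \<Longrightarrow> pcas s (q @ [(s', t), (t, x)]) x" for x
        by (induction q arbitrary: s) auto
      then have cas: "pcas s ?c s" using q'(2) by blast
      have "set ?c \<subseteq> ?A" using q'(1) s' st arcs_symmetric by auto
      moreover have "distinct (tl (pawalk_verts s ?c))"
        using q' st(1,2) pcas_pawalk_verts[OF cas] pcas_pawalk_verts[OF q'(2)] by force
      ultimately have "cycle ?c"
        unfolding cycle_def awalk_def using cas st P by (auto simp: P_def intro!: exI[of _ s])
      moreover have "length ?c \<ge> 3" using \<open>q \<noteq> []\<close> by (cases q) auto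
      ultimately show False using assms unfolding undirected_tree_def by blast
    qed
    let ?p = "p(t := s)" and ?M = "insert t M"
    have E: "parent_rel ?M r ?p = insert (t, s) ?E"
      using st P by (auto simp: parent_rel_def P_def)
    have "(u, r) \<in> (parent_rel ?M r ?p)\<^sup>*" if "u \<in> ?M" for u
    proof -
      have up: "(u, r) \<in> (parent_rel ?M r ?p)\<^sup>*" if "u \<in> M" for u
        using that P rtrancl_mono[of ?E "parent_rel ?M r ?p"] E unfolding P_def by blast
      show ?thesis
      proof (cases "u = t")
        case True
        have "(t, s) \<in> parent_rel ?M r ?p" using E by simp
        then show ?thesis using up[OF st(1)] True by (meson converse_rtrancl_into_rtrancl)
      next
        case False
        then show ?thesis using up that by simp
      qed
    qed
    moreover have "?A \<inter> ?M \<times> ?M = parent_rel ?M r ?p \<union> (parent_rel ?M r ?p)\<inverse>"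
    proof -
      have "?A \<inter> ?M \<times> ?M = (?A \<inter> M \<times> M) \<union> {(t, s), (s, t)}"
        using st unique arcs_symmetric no_loops' by blast
      also have "?A \<inter> M \<times> M = ?E \<union> ?E\<inverse>" using P by (simp add: P_def)
      finally show ?thesis unfolding E by auto
    qed
    ultimately have "P ?M r ?p" using P st wellformed' unfolding P_def by auto
    then have "card ?M \<le> card M" using M(2) by blast
    moreover have "finite M" using P finite_subset[OF _ pair_finite_verts] by (simp add: P_def)
    ultimately show False using st(2) by simp
  qed
  moreover have "?A \<inter> ?V \<times> ?V = ?A" using wellformed' by auto
  ultimately show ?thesis using that[of r p] P unfolding P_def by auto
qed

text \<open>Let \<open>s\<close> be a top of \<open>v\<close>. Along a connection inside the nodes
  holding \<open>v\<close>, every node reached lies below \<open>s\<close>; another top reached in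
  this way has no parent holding \<open>v\<close>, hence equals \<open>s\<close>.\<close>

lemma tree_decomposition_rooted_td:
  assumes dec: "tree_decomposition H T bag"
  obtains r p where "rooted_td (pverts T) r p bag"
proof -
  have tree: "undirected_tree T" using dec by (simp add: tree_decomposition_def)
  interpret pair_graph T using tree by (simp add: undirected_tree_def)
  obtain r p where rp: "r \<in> pverts T" "\<And>t. t \<in> pverts T \<Longrightarrow> t \<noteq> r \<Longrightarrow> p t \<in> pverts T"
    "\<And>t. t \<in> pverts T \<Longrightarrow> (t, r) \<in> (parent_rel (pverts T) r p)\<^sup>*"
    "parcs T = parent_rel (pverts T) r p \<union> (parent_rel (pverts T) r p)\<inverse>"
    using undirected_tree_rooted[OF tree] by metis
  let ?E = "parent_rel (pverts T) r p"
  have "rooted_td (pverts T) r p bag"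
  proof
    fix v s t
    assume st: "s \<in> pverts T" "t \<in> pverts T" "is_top r p bag v s" "is_top r p bag v t"
    let ?X = "{t \<in> pverts T. v \<in> bag t}"
    have "v \<in> verts H" using dec st by (auto simp: tree_decomposition_def is_top_def)
    then have "connected (with_proj T \<restriction> ?X)" using dec by (auto simp: tree_decomposition_def)
    then have "(s, t) \<in> (parcs T \<inter> ?X \<times> ?X)\<^sup>*"
      using connected_induced_iff[OF pair_sym_digraph_axioms, of ?X] st by (auto simp: is_top_def)
    then have "(t, s) \<in> (?E \<inter> ?X \<times> ?X)\<^sup>*"
    proof (induction rule: rtrancl_induct)
      case (step y z)
      have *: "(y, z) \<in> ?E \<or> (z, y) \<in> ?E" "y \<in> ?X" "z \<in> ?X" using step(2) rp(4) by auto
      show ?case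
      proof (cases "(z, y) \<in> ?E")
        case True
        then show ?thesis using * step(3) by (meson IntI SigmaI converse_rtrancl_into_rtrancl)
      next
        case False
        then have yz: "(y, z) \<in> ?E" using * by blast
        \<comment> \<open>Going up from the top \<open>s\<close> would leave the nodes holding
          \<open>v\<close>. Hence \<open>y\<close> lies strictly below \<open>s\<close>, and its
          parent \<open>z\<close> is the next node on the way up to \<open>s\<close>.\<close>
        then have "y \<noteq> s" using *(3) st(3) by (auto simp: parent_rel_def is_top_def)
        then obtain z' where "(y, z') \<in> ?E" "(z', s) \<in> (?E \<inter> ?X \<times> ?X)\<^sup>*"
          using step(3) by (meson IntD1 converse_rtranclE)
        moreover have "z' = z" using yz calculation(1) by (auto simp: parent_rel_def)
        ultimately show ?thesis by simp
      qed
    qed simp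
    then show "s = t"
    proof (cases rule: converse_rtranclE)
      case (step y)
      then show ?thesis using st(4) by (auto simp: parent_rel_def is_top_def)
    qed simp
  qed (use rp pair_finite_verts in auto)
  then show ?thesis using that by blast
qed

lemma tree_width_leD:
  fixes H :: "('v, 'e) pre_digraph"
  assumes "finite (verts H)" "wf_digraph H" "tree_width H \<le> k"
  obtains N :: "nat set" and r p bag where "rooted_td N r p bag" "narrow k N bag"
    "verts H \<subseteq> \<Union>(bag ` N)" "\<And>e. e \<in> arcs H \<Longrightarrow> share_bag N bag (tail H e) (head H e)"
proof -
  interpret H: wf_digraph H by fact
  \<comment> \<open>A single bag with all vertices shows that the set of attainable widths is
    nonempty.\<close>
  have "rooted_td {0 :: nat} 0 id (\<lambda>_. verts H)" by unfold_locales auto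
  then have "\<exists>(T :: nat pair_pre_digraph) bag. tree_decomposition H T bag"
    by (rule tree_width_leI(2)[where k = "card (verts H)"]) (use assms in \<open>auto simp: narrow_def share_bag_def\<close>)
  then have "\<exists>w. \<exists>(T :: nat pair_pre_digraph) bag. tree_decomposition H T bag \<and> width T bag = w" by blast
  from LeastI_ex[OF this] obtain T :: "nat pair_pre_digraph" and bag
    where dec: "tree_decomposition H T bag" and w: "width T bag = tree_width H"
    unfolding tree_width_def by blast
  obtain r p where rooted_td: "rooted_td (pverts T) r p bag" using tree_decomposition_rooted_td[OF dec] .
  then interpret rooted_td "pverts T" r p bag .
  have sub: "bag t \<subseteq> verts H" if "t \<in> pverts T" for t using dec that by (auto simp: tree_decomposition_def)
  have "card (bag t) \<le> Suc k" if "t \<in> pverts T" for t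
  proof -
    have "card (bag t) \<le> Max ((\<lambda>t. card (bag t)) ` pverts T)" using fin that by simp
    then show ?thesis using w assms(3) unfolding width_def by linarith
  qed
  then have "narrow k (pverts T) bag"
    using sub assms(1) by (auto simp: narrow_def intro: finite_subset)
  moreover have "verts H \<subseteq> \<Union>(bag ` pverts T)"
  proof
    fix v assume "v \<in> verts H"
    then have "connected (with_proj T \<restriction> {t \<in> pverts T. v \<in> bag t})" using dec by (auto simp: tree_decomposition_def)
    then have "{t \<in> pverts T. v \<in> bag t} \<noteq> {}"
      by (auto simp: connected_def strongly_connected_def mk_symmetric_def)
    then show "v \<in> \<Union>(bag ` pverts T)" by blast
  qed
  moreover have "share_bag (pverts T) bag (tail H e) (head H e)" if "e \<in> arcs H" for e
    using dec that by (auto simp: tree_decomposition_def share_bag_def)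
  ultimately show ?thesis using that[OF rooted_td] by blast
qed

text \<open>Unlike in a tree decomposition, the bags may contain numbers that are not variables of
  the query.\<close>

definition certifies :: "nat \<Rightarrow> nat set \<Rightarrow> nat \<Rightarrow> (nat \<Rightarrow> nat) \<Rightarrow> (nat \<Rightarrow> nat set) \<Rightarrow> 'a c2rpq \<Rightarrow> bool" where
  "certifies k N r p bag \<gamma> \<longleftrightarrow> rooted_td N r p bag \<and> narrow k N bag \<and> vars \<gamma> \<subseteq> \<Union>(bag ` N) \<and>
     (\<forall>\<alpha>\<in>set (atoms \<gamma>). share_bag N bag (source \<alpha>) (target \<alpha>))"

lemma c2rpq_tree_width_le_iff:
  assumes "wf_c2rpq \<gamma>"
  shows "c2rpq_tree_width \<gamma> \<le> k \<longleftrightarrow> (\<exists>N r p bag. certifies k N r p bag \<gamma>)"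
proof
  let ?H = "underlying_multigraph \<gamma>"
  have wf: "wf_digraph ?H" "finite (verts ?H)"
    using assms by (auto simp: underlying_multigraph_def wf_digraph_def wf_c2rpq_def)
  show "\<exists>N r p bag. certifies k N r p bag \<gamma>" if "c2rpq_tree_width \<gamma> \<le> k"
  proof -
    obtain N :: "nat set" and r p bag where "rooted_td N r p bag" "narrow k N bag" "verts ?H \<subseteq> \<Union>(bag ` N)"
      and arcs: "\<And>e. e \<in> arcs ?H \<Longrightarrow> share_bag N bag (tail ?H e) (head ?H e)"
      using tree_width_leD[of ?H k] wf \<open>c2rpq_tree_width \<gamma> \<le> k\<close> unfolding c2rpq_tree_width_def by metis
    moreover have "share_bag N bag (source \<alpha>) (target \<alpha>)" if \<alpha>: "\<alpha> \<in> set (atoms \<gamma>)" for \<alpha>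
    proof -
      obtain j where "j < length (atoms \<gamma>)" "\<alpha> = atoms \<gamma> ! j" using \<alpha> by (metis in_set_conv_nth)
      then show ?thesis using arcs[of j] by (simp add: underlying_multigraph_def)
    qed
    ultimately have "certifies k N r p bag \<gamma>" by (auto simp: certifies_def underlying_multigraph_def)
    then show ?thesis by blast
  qed
  show "c2rpq_tree_width \<gamma> \<le> k" if "\<exists>N r p bag. certifies k N r p bag \<gamma>"
  proof -
    obtain N r p bag where "certifies k N r p bag \<gamma>" using \<open>\<exists>N r p bag. certifies k N r p bag \<gamma>\<close> by blast
    then show ?thesis unfolding c2rpq_tree_width_def using assms
      by (intro tree_width_leI(1)[of N r p bag])
        (auto simp: certifies_def underlying_multigraph_def wf_c2rpq_def)
  qed
qed

section \<open>Images of rooted tree decompositions\<close>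

context rooted_td
begin

lemma rooted_td_image_inj:
  assumes "inj_on \<rho> (\<Union>(bag ` N))"
  shows "rooted_td N r p (\<lambda>t. \<rho> ` bag t)"
proof
  have in_bag: "v \<in> bag t" if "\<rho> v \<in> \<rho> ` bag t" "v \<in> \<Union>(bag ` N)" "t \<in> N" for v t
    using that assms unfolding inj_on_def by blast
  show "s = t" if st: "s \<in> N" "t \<in> N" "is_top r p (\<lambda>t. \<rho> ` bag t) v s" "is_top r p (\<lambda>t. \<rho> ` bag t) v t" for v s t
  proof -
    obtain u where u: "v = \<rho> u" "u \<in> bag s" using st by (auto simp: is_top_def)
    then have "u \<in> bag t" using st in_bag[of u t] by (auto simp: is_top_def)
    then have "is_top r p bag u s" "is_top r p bag u t" using u st by (auto simp: is_top_def)
    then show ?thesis using top_unique st by blast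
  qed
qed (use fin root par reach in blast)+

text \<open>The tops of \<open>x\<close> and \<open>y\<close> lie above the common node \<open>s\<close>, hence are comparable; the higher one is
  the top of the merged vertex.\<close>

lemma rooted_td_identify:
  assumes s: "s \<in> N" "x \<in> bag s" "y \<in> bag s"
  shows "rooted_td N r p (\<lambda>t. (id(y := x)) ` bag t)"
proof
  let ?b = "\<lambda>t. (id(y := x)) ` bag t"
  have mem: "v \<in> ?b t \<longleftrightarrow> (if v = x then x \<in> bag t \<or> y \<in> bag t else v \<noteq> y \<and> v \<in> bag t)" for v t
    by (auto simp: image_iff split: if_splits)
  \<comment> \<open>On the way up from a node holding \<open>v\<close> to the top of
    \<open>v\<close>, every node holds \<open>v\<close>; a gap would create a second top.\<close>
  have chain: "v \<in> bag t" if "v \<in> bag s'" "(s', t) \<in> E\<^sup>*" "(t, u) \<in> E\<^sup>*" "is_top r p bag v u" "s' \<in> N" for v s' t u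
    using that(2,1,5)
  proof (induction rule: converse_rtrancl_induct)
    case (step a b)
    have b: "b \<in> N" using step(1,5) par by (auto simp: E_iff)
    have bu: "(b, u) \<in> E\<^sup>*" using step(2) that(3) by (rule rtrancl_trans)
    have "v \<in> bag b"
    proof (rule ccontr)
      assume "v \<notin> bag b"
      then have "is_top r p bag v a" using step(1,4) by (simp add: is_top_def E_iff)
      then have "a = u" using top_unique[OF step(5) E_closed[OF bu b]] that(4) by blast
      then have "a = b" using E_antisym[OF bu] step(1) by blast
      then show False using step(1,5) E_irrefl by blast
    qed
    then show ?case using step(3) b by blast
  qed
  obtain tx ty where tx: "tx \<in> N" "(s, tx) \<in> E\<^sup>*" "is_top r p bag x tx"
    and ty: "ty \<in> N" "(s, ty) \<in> E\<^sup>*" "is_top r p bag y ty"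
    using ex_top s by blast
  have top_xy: "t = (if (tx, ty) \<in> E\<^sup>* then ty else tx)" if t: "t \<in> N" "is_top r p ?b x t" for t
  proof -
    have *: "x \<in> bag t \<or> y \<in> bag t" "t = r \<or> x \<notin> bag (p t) \<and> y \<notin> bag (p t)"
      using t(2) mem[of x] unfolding is_top_def by auto
    then have "t = tx \<or> t = ty" using top_unique tx ty t(1) unfolding is_top_def by metis
    \<comment> \<open>If \<open>tx\<close> is strictly below \<open>ty\<close>, its parent is on the
      way from \<open>s\<close> to \<open>ty\<close> and so holds \<open>y\<close>; hence
      \<open>tx\<close> is no top of the merged vertex.\<close>
    moreover have False if "t = tx" "(tx, ty) \<in> E\<^sup>*" "tx \<noteq> ty"
    proof -
      have "tx \<noteq> r" "(p tx, ty) \<in> E\<^sup>*" using E_stepD[OF that(2,3)] by blast+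
      moreover have "(s, p tx) \<in> E\<^sup>*"
        using tx(1,2) \<open>tx \<noteq> r\<close> by (meson E_iff rtrancl.rtrancl_into_rtrancl)
      ultimately have "y \<in> bag (p tx)" by (intro chain[OF s(3) _ _ ty(3) s(1)])
      then show False using * that(1) \<open>tx \<noteq> r\<close> by blast
    qed
    moreover have False if "t = ty" "(tx, ty) \<notin> E\<^sup>*"
    proof -
      have "(ty, tx) \<in> E\<^sup>*" "ty \<noteq> tx" using E_comparable[OF tx(2) ty(2)] that(2) by auto
      then have "ty \<noteq> r" "(p ty, tx) \<in> E\<^sup>*" using E_stepD[of ty tx] by blast+
      moreover have "(s, p ty) \<in> E\<^sup>*"
        using ty(1,2) \<open>ty \<noteq> r\<close> by (meson E_iff rtrancl.rtrancl_into_rtrancl)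
      ultimately have "x \<in> bag (p ty)" by (intro chain[OF s(2) _ _ tx(3) s(1)])
      then show False using * that(1) \<open>ty \<noteq> r\<close> by blast
    qed
    ultimately show ?thesis by auto
  qed
  show "t = t'" if t: "t \<in> N" "t' \<in> N" "is_top r p ?b v t" "is_top r p ?b v t'" for v t t'
  proof (cases "v = x")
    case True
    then show ?thesis using top_xy t by metis
  next
    case False
    then have "is_top r p bag v t" "is_top r p bag v t'"
      using t(3,4) mem[of v] unfolding is_top_def by auto
    then show ?thesis using top_unique t by blast
  qed
qed (use fin root par reach in blast)+

end

section \<open>Queries\<close>

lemma lpath_append: "lpath E u (w @ w') v \<longleftrightarrow> (\<exists>t. lpath E u w t \<and> lpath E t w' v)"
  by (induction w arbitrary: u) auto

lemma lpath_map:
  assumes "\<And>x l y. (x, l, y) \<in> E \<Longrightarrow> (g x, l, g y) \<in> E'"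
  shows "lpath E u w v \<Longrightarrow> lpath E' (g u) w (g v)"
proof (induction w arbitrary: u)
  case (Cons l w)
  then obtain t where "(u, l, t) \<in> E" "lpath E t w v" by auto
  then have "(g u, l, g t) \<in> E'" "lpath E' (g t) w (g v)" using Cons.IH assms by blast+
  then show ?case by auto
qed simp

lemma edges_pm_iff [simp]:
  "(x, Fwd a, y) \<in> edges_pm G \<longleftrightarrow> (x, a, y) \<in> edges G"
  "(x, Inv a, y) \<in> edges_pm G \<longleftrightarrow> (y, a, x) \<in> edges G"
  by (auto simp: edges_pm_def)

lemma edges_pm_map:
  assumes "\<And>x a y. (x, a, y) \<in> edges G \<Longrightarrow> (g x, a, g y) \<in> edges G'"
  shows "(x, l, y) \<in> edges_pm G \<Longrightarrow> (g x, l, g y) \<in> edges_pm G'"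
  using assms by (cases l) auto

lemma edges_pm_nodes: "wf_graph_db G \<Longrightarrow> (x, l, y) \<in> edges_pm G \<Longrightarrow> x \<in> nodes G \<and> y \<in> nodes G"
  by (cases l) (auto simp: wf_graph_db_def)

lemma nfa_lang_sub_nfa [simp]: "nfa_lang (sub_nfa A q q') = {w. lpath (delta A) q w q'}"
  by (simp add: nfa_lang_def sub_nfa_def)

lemma regular_letter: "regular {[l]}"
proof -
  let ?A = "\<lparr>states = {0, 1}, init = {0}, final = {1}, delta = {(0, l, 1)}\<rparr> :: (nat, 'a) nfa"
  have "lpath {(0 :: nat, l, 1)} 0 w 1 \<longleftrightarrow> w = [l]" for w :: "'a list"
  proof (cases w rule: remdups_adj.cases)
    case (3 x y xs)
    then show ?thesis by simp
  qed auto
  then have "nfa_lang ?A = {[l]}" by (auto simp: nfa_lang_def)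
  moreover have "wf_nfa ?A" by (auto simp: wf_nfa_def)
  ultimately show ?thesis unfolding regular_def by blast
qed

definition rename_atom :: "(nat \<Rightarrow> nat) \<Rightarrow> 'a atom \<Rightarrow> 'a atom" where
  "rename_atom \<rho> \<alpha> = Atom (\<rho> (source \<alpha>)) (lang \<alpha>) (\<rho> (target \<alpha>))"

definition rename :: "(nat \<Rightarrow> nat) \<Rightarrow> 'a c2rpq \<Rightarrow> 'a c2rpq" where
  "rename \<rho> \<gamma> = \<lparr>outs = map \<rho> (outs \<gamma>), vars = \<rho> ` vars \<gamma>, atoms = map (rename_atom \<rho>) (atoms \<gamma>)\<rparr>"

lemma rename_atom_simps [simp]:
  "source (rename_atom \<rho> \<alpha>) = \<rho> (source \<alpha>)" "target (rename_atom \<rho> \<alpha>) = \<rho> (target \<alpha>)"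
  "lang (rename_atom \<rho> \<alpha>) = lang \<alpha>"
  by (simp_all add: rename_atom_def)

text \<open>No injectivity is asked for: identifying variables only strengthens a query. This is
  what eliminating empty words relies on.\<close>

lemma satisfies_renameD:
  assumes "satisfies G us (rename \<rho> \<gamma>)"
  shows "satisfies G us \<gamma>"
proof -
  obtain f where "f ` \<rho> ` vars \<gamma> \<subseteq> nodes G" "map f (map \<rho> (outs \<gamma>)) = us"
    "\<forall>\<alpha>\<in>set (atoms \<gamma>). \<exists>w\<in>lang \<alpha>. lpath (edges_pm G) (f (\<rho> (source \<alpha>))) w (f (\<rho> (target \<alpha>)))"
    using assms by (auto simp: satisfies_def rename_def)
  then show ?thesis unfolding satisfies_def by (intro exI[of _ "f \<circ> \<rho>"]) auto
qed

lemma satisfies_renameI: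
  assumes "satisfies G us \<gamma>" "inj_on \<rho> (vars \<gamma>)" "set (outs \<gamma>) \<subseteq> vars \<gamma>"
    "\<And>\<alpha>. \<alpha> \<in> set (atoms \<gamma>) \<Longrightarrow> source \<alpha> \<in> vars \<gamma> \<and> target \<alpha> \<in> vars \<gamma>"
  shows "satisfies G us (rename \<rho> \<gamma>)"
proof -
  obtain f where f: "f ` vars \<gamma> \<subseteq> nodes G" "map f (outs \<gamma>) = us"
    "\<forall>\<alpha>\<in>set (atoms \<gamma>). \<exists>w\<in>lang \<alpha>. lpath (edges_pm G) (f (source \<alpha>)) w (f (target \<alpha>))"
    using assms by (auto simp: satisfies_def)
  have inv: "inv_into (vars \<gamma>) \<rho> (\<rho> x) = x" if "x \<in> vars \<gamma>" for x
    using assms that by simp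
  let ?g = "f \<circ> inv_into (vars \<gamma>) \<rho>"
  have "?g ` \<rho> ` vars \<gamma> \<subseteq> nodes G" using f inv by auto
  moreover have "map ?g (map \<rho> (outs \<gamma>)) = us" using f(2) inv assms(3) by (auto simp: subset_iff)
  ultimately show ?thesis unfolding satisfies_def rename_def
    using f(3) inv assms(4) by (intro exI[of _ ?g]) auto
qed

lemma narrow_image: "narrow k N bag \<Longrightarrow> narrow k N (\<lambda>t. \<rho> ` bag t)"
  unfolding narrow_def by (metis card_image_le finite_imageI le_trans)

lemma share_bag_image: "share_bag N bag u v \<Longrightarrow> share_bag N (\<lambda>t. \<rho> ` bag t) (\<rho> u) (\<rho> v)"
  unfolding share_bag_def by blast

lemma certifies_rename:
  assumes "certifies k N r p bag \<gamma>" "rooted_td N r p (\<lambda>t. \<rho> ` bag t)"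
  shows "certifies k N r p (\<lambda>t. \<rho> ` bag t) (rename \<rho> \<gamma>)"
  unfolding certifies_def
proof (intro conjI ballI)
  show "rooted_td N r p (\<lambda>t. \<rho> ` bag t)" by fact
  show "narrow k N (\<lambda>t. \<rho> ` bag t)" using assms(1) narrow_image by (auto simp: certifies_def)
  have "vars \<gamma> \<subseteq> \<Union>(bag ` N)" using assms(1) by (simp add: certifies_def)
  then have "\<rho> ` vars \<gamma> \<subseteq> \<rho> ` \<Union>(bag ` N)" by (rule image_mono)
  then show "vars (rename \<rho> \<gamma>) \<subseteq> (\<Union>t\<in>N. \<rho> ` bag t)" by (simp add: rename_def image_UN)
  fix \<alpha> assume "\<alpha> \<in> set (atoms (rename \<rho> \<gamma>))"
  then obtain \<beta> where \<beta>: "\<beta> \<in> set (atoms \<gamma>)" "\<alpha> = rename_atom \<rho> \<beta>" by (auto simp: rename_def)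
  then have "share_bag N bag (source \<beta>) (target \<beta>)" using assms(1) by (simp add: certifies_def)
  then show "share_bag N (\<lambda>t. \<rho> ` bag t) (source \<alpha>) (target \<alpha>)"
    unfolding \<beta>(2) rename_atom_simps by (rule share_bag_image)
qed

section \<open>Expanding a query into conjunctive queries\<close>

fun letter_atom :: "nat \<Rightarrow> 'a letter \<Rightarrow> nat \<Rightarrow> 'a atom" where
  "letter_atom x (Fwd a) y = Atom x {[Fwd a]} y"
| "letter_atom x (Inv a) y = Atom y {[Fwd a]} x"

lemma letter_atom_path:
  "(\<exists>w\<in>lang (letter_atom x l y). lpath (edges_pm G) (f (source (letter_atom x l y))) w (f (target (letter_atom x l y))))
    \<longleftrightarrow> (f x, l, f y) \<in> edges_pm G"
  by (cases l) auto

lemma letter_atom_ends: "{source (letter_atom x l y), target (letter_atom x l y)} = {x, y}"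
  by (cases l) auto

lemma letter_atom_lang: "\<exists>a. lang (letter_atom x l y) = {[Fwd a]}"
  by (cases l) auto

fun word_atom :: "nat \<times> 'a letter list \<times> nat \<Rightarrow> 'a atom" where
  "word_atom (x, w, y) = Atom x {w} y"

text \<open>In the query below the atoms \<open>ds\<close> are already those of a conjunctive query, while the words of the
  triples \<open>ts\<close> remain to be spelled out: an empty word identifies its two ends, and a first letter is
  split off with a fresh variable \<open>z\<close>, which needs a bag \<open>{x, y, z}\<close>. This is where \<open>k \<ge> 2\<close> enters.\<close>

lemma expand_words:
  fixes G :: "('v, 'a) graph_db"
  assumes k: "2 \<le> k" and G: "wf_graph_db G"
    and "certifies k N r p bag \<lparr>outs = os, vars = V, atoms = ds @ map word_atom ts\<rparr>"
    and "finite V" "set os \<subseteq> V"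
    and "\<forall>\<alpha>\<in>set ds. \<exists>a. lang \<alpha> = {[Fwd a]}"
    and "\<forall>\<alpha>\<in>set (ds @ map word_atom ts). source \<alpha> \<in> V \<and> target \<alpha> \<in> V \<and>
      (\<exists>w\<in>lang \<alpha>. lpath (edges_pm G) (f (source \<alpha>)) w (f (target \<alpha>)))"
    and "f ` V \<subseteq> nodes G"
  shows "\<exists>c. is_cq c \<and> c2rpq_tree_width c \<le> k \<and> length (outs c) = length os \<and> satisfies G (map f os) c \<and>
    (\<forall>(G' :: (nat, 'a) graph_db) us. satisfies G' us c \<longrightarrow>
      satisfies G' us \<lparr>outs = os, vars = V, atoms = ds @ map word_atom ts\<rparr>)"
  using assms(3-)
\<comment> \<open>Each triple counts one more than the length of its word, so that removing a triple
  with an empty word decreases the measure as well.\<close>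
proof (induction "sum_list (map (\<lambda>t. Suc (length (fst (snd t)))) ts)" arbitrary: N r p bag os V ds ts f rule: less_induct)
  case less
  let ?q = "\<lparr>outs = os, vars = V, atoms = ds @ map word_atom ts\<rparr>"
  show ?case
  proof (cases ts)
    case Nil
    have "regular (lang \<alpha>)" if "\<alpha> \<in> set ds" for \<alpha>
    proof -
      from bspec[OF less.prems(4) that] obtain a where "lang \<alpha> = {[Fwd a]}" by blast
      then show ?thesis by (simp add: regular_letter)
    qed
    then have wf: "wf_c2rpq ?q" using less.prems Nil by (auto simp: wf_c2rpq_def)
    then have "is_cq ?q" using less.prems(4) Nil by (simp add: is_cq_def)
    moreover have "c2rpq_tree_width ?q \<le> k"
      using c2rpq_tree_width_le_iff[OF wf] less.prems(1) by blast
    moreover have "satisfies G (map f os) ?q"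
      unfolding satisfies_def using less.prems by (intro exI[of _ f]) auto
    ultimately show ?thesis by (intro exI[of _ ?q]) auto
  next
    case (Cons t ts')
    obtain x w y where t: "t = (x, w, y)" by (cases t) auto
    have xy: "x \<in> V" "y \<in> V" "lpath (edges_pm G) (f x) w (f y)" "share_bag N bag x y"
      using less.prems(1,5) Cons t by (auto simp: certifies_def)
    show ?thesis
    proof (cases w)
      case Nil
      define \<rho> where "\<rho> = id(y := x)"
      \<comment> \<open>The empty word forces \<open>f x = f y\<close>, so \<open>f\<close> remains
        a satisfying assignment after the identification.\<close>
      have f\<rho>: "f (\<rho> v) = f v" for v using xy(3) Nil by (simp add: \<rho>_def)
      let ?ts = "map (\<lambda>(x, w, y). (\<rho> x, w, \<rho> y)) ts'" and ?ds = "map (rename_atom \<rho>) ds"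
      have wa: "map word_atom ?ts = map (rename_atom \<rho>) (map word_atom ts')"
        by (auto simp: rename_atom_def)
      have q: "\<lparr>outs = map \<rho> os, vars = \<rho> ` V, atoms = ?ds @ map word_atom ?ts\<rparr> =
          rename \<rho> \<lparr>outs = os, vars = V, atoms = ds @ map word_atom ts'\<rparr>" (is "?q' = _")
        unfolding wa rename_def by simp
      have "\<exists>c. is_cq c \<and> c2rpq_tree_width c \<le> k \<and> length (outs c) = length (map \<rho> os) \<and>
          satisfies G (map f (map \<rho> os)) c \<and>
          (\<forall>(G' :: (nat, 'a) graph_db) us. satisfies G' us c \<longrightarrow> satisfies G' us ?q')"
      proof (rule less.hyps)
        show "sum_list (map (\<lambda>t. Suc (length (fst (snd t)))) ?ts) < sum_list (map (\<lambda>t. Suc (length (fst (snd t)))) ts)"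
          by (simp add: Cons t o_def split_beta Nil)
        interpret rooted_td N r p bag using less.prems(1) by (simp add: certifies_def)
        obtain s where s: "s \<in> N" "x \<in> bag s" "y \<in> bag s" using xy(4) by (auto simp: share_bag_def)
        have "rooted_td N r p (\<lambda>t. \<rho> ` bag t)" unfolding \<rho>_def using s by (rule rooted_td_identify)
        moreover have "certifies k N r p bag \<lparr>outs = os, vars = V, atoms = ds @ map word_atom ts'\<rparr>"
          using less.prems(1) by (auto simp: certifies_def Cons)
        ultimately show "certifies k N r p (\<lambda>t. \<rho> ` bag t) ?q'"
          unfolding q by (intro certifies_rename)
        show "\<forall>\<alpha>\<in>set (?ds @ map word_atom ?ts). source \<alpha> \<in> \<rho> ` V \<and> target \<alpha> \<in> \<rho> ` V \<and>
            (\<exists>w\<in>lang \<alpha>. lpath (edges_pm G) (f (source \<alpha>)) w (f (target \<alpha>)))"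
        proof
          fix \<alpha> assume "\<alpha> \<in> set (?ds @ map word_atom ?ts)"
          then obtain \<beta> where \<beta>: "\<beta> \<in> set (ds @ map word_atom ts')" "\<alpha> = rename_atom \<rho> \<beta>"
            unfolding wa by auto
          then have "\<beta> \<in> set (ds @ map word_atom ts)" by (auto simp: Cons)
          from bspec[OF less.prems(5) this] show "source \<alpha> \<in> \<rho> ` V \<and> target \<alpha> \<in> \<rho> ` V \<and>
            (\<exists>w\<in>lang \<alpha>. lpath (edges_pm G) (f (source \<alpha>)) w (f (target \<alpha>)))"
            unfolding \<beta>(2) rename_atom_simps f\<rho> by blast
        qed
        show "finite (\<rho> ` V)" using less.prems(2) by simp
        show "set (map \<rho> os) \<subseteq> \<rho> ` V" using less.prems(3) by auto
        show "\<forall>\<alpha>\<in>set ?ds. \<exists>a. lang \<alpha> = {[Fwd a]}" using less.prems(4) by simp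
        show "f ` \<rho> ` V \<subseteq> nodes G" using less.prems(6) f\<rho> by (simp add: image_image)
      qed
      then obtain c where c: "is_cq c" "c2rpq_tree_width c \<le> k" "length (outs c) = length os"
        "satisfies G (map f (map \<rho> os)) c" "\<And>(G' :: (nat, 'a) graph_db) us. satisfies G' us c \<Longrightarrow> satisfies G' us ?q'"
        by auto
      have "satisfies G' us ?q" if sat: "satisfies G' us ?q'" for G' :: "(nat, 'a) graph_db" and us
      proof -
        let ?r = "rename \<rho> \<lparr>outs = os, vars = V, atoms = ds @ map word_atom ts'\<rparr>"
        obtain g where g: "g ` vars ?r \<subseteq> nodes G'" "map g (outs ?r) = us"
          "\<forall>\<alpha>\<in>set (atoms ?r). \<exists>w\<in>lang \<alpha>. lpath (edges_pm G') (g (source \<alpha>)) w (g (target \<alpha>))"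
          using sat unfolding q satisfies_def by blast
        have "\<exists>w\<in>lang \<alpha>. lpath (edges_pm G') ((g \<circ> \<rho>) (source \<alpha>)) w ((g \<circ> \<rho>) (target \<alpha>))"
          if "\<alpha> \<in> set (ds @ map word_atom ts')" for \<alpha>
        proof -
          have "rename_atom \<rho> \<alpha> \<in> set (atoms ?r)" using that by (auto simp: rename_def)
          from bspec[OF g(3) this] show ?thesis by simp
        qed
        moreover have "(g \<circ> \<rho>) ` V \<subseteq> nodes G'" "map (g \<circ> \<rho>) os = us"
          using g(1,2) by (auto simp: rename_def)
        moreover have "\<rho> x = \<rho> y" by (simp add: \<rho>_def)
        ultimately show ?thesis
          unfolding satisfies_def Cons t Nil by (intro exI[of _ "g \<circ> \<rho>"]) (simp add: ball_Un)
      qed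
      note sub = this
      have os: "map f (map \<rho> os) = map f os" using f\<rho> by simp
      show ?thesis
        by (intro exI[of _ c] conjI allI impI c(1-3) c(4)[unfolded os] sub[OF c(5)])
    next
      case (Cons l w')
      note w = Cons
      interpret rooted_td N r p bag using less.prems(1) by (simp add: certifies_def)
      have nb: "finite (bag t)" "card (bag t) \<le> Suc k" if "t \<in> N" for t
        using less.prems(1) that by (auto simp: certifies_def narrow_def)
      have "finite (V \<union> \<Union>(bag ` N))" using less.prems(2) fin nb by blast
      then obtain z where z: "z \<notin> V" "z \<notin> \<Union>(bag ` N)"
        by (metis UnI1 UnI2 ex_new_if_finite infinite_UNIV_nat)
      obtain b where b: "b \<notin> N" using fin by (metis ex_new_if_finite infinite_UNIV_nat)
      obtain s where s: "s \<in> N" "x \<in> bag s" "y \<in> bag s" using xy(4) by (auto simp: share_bag_def)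
      obtain v where v: "(f x, l, v) \<in> edges_pm G" "lpath (edges_pm G) v w' (f y)" using xy(3) w by auto
      let ?V = "insert z V" and ?ds = "letter_atom x l z # ds" and ?ts = "(z, w', y) # ts'" and ?f = "f(z := v)"
      let ?q' = "\<lparr>outs = os, vars = ?V, atoms = ?ds @ map word_atom ?ts\<rparr>"
      define bag' where "bag' = bag(b := {x, y, z})"
      have f: "?f u = f u" if "u \<in> V" for u using that z by auto
      have "\<exists>c. is_cq c \<and> c2rpq_tree_width c \<le> k \<and> length (outs c) = length os \<and>
          satisfies G (map ?f os) c \<and>
          (\<forall>(G' :: (nat, 'a) graph_db) us. satisfies G' us c \<longrightarrow> satisfies G' us ?q')"
      proof (rule less.hyps)
        show "sum_list (map (\<lambda>t. Suc (length (fst (snd t)))) ?ts) < sum_list (map (\<lambda>t. Suc (length (fst (snd t)))) ts)"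
          by (simp add: \<open>ts = t # ts'\<close> t w)
        have "rooted_td (insert b N) r (p(b := s)) bag'" unfolding bag'_def
          using b s z by (intro rooted_td_leaf) auto
        moreover have "narrow k (insert b N) bag'"
          using nb b k by (auto simp: narrow_def bag'_def card_insert_if)
        moreover have bag': "bag' t = bag t" if "t \<in> N" for t using that b by (auto simp: bag'_def)
        moreover have cov_old: "share_bag (insert b N) bag' u v" if "share_bag N bag u v" for u v
          using that bag' by (auto simp: share_bag_def)
        moreover have cov_new: "share_bag (insert b N) bag' u v" if "{u, v} \<subseteq> {x, y, z}" for u v
          using that by (auto simp: share_bag_def bag'_def)
        moreover have "z \<in> bag' b" by (simp add: bag'_def)
        moreover have "share_bag (insert b N) bag' (source (letter_atom x l z)) (target (letter_atom x l z))"
          by (rule cov_new) (use letter_atom_ends[of x l z] in blast)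
        ultimately show "certifies k (insert b N) r (p(b := s)) bag' ?q'"
          using less.prems(1) unfolding certifies_def \<open>ts = t # ts'\<close> t by auto
        show "\<forall>\<alpha>\<in>set ?ds. \<exists>a. lang \<alpha> = {[Fwd a]}" using less.prems(4) letter_atom_lang[of x l z] by auto
        have "v \<in> nodes G" using edges_pm_nodes[OF G v(1)] by simp
        then show "?f ` ?V \<subseteq> nodes G" using less.prems(6) by auto
        show "\<forall>\<alpha>\<in>set (?ds @ map word_atom ?ts). source \<alpha> \<in> ?V \<and> target \<alpha> \<in> ?V \<and>
            (\<exists>w\<in>lang \<alpha>. lpath (edges_pm G) (?f (source \<alpha>)) w (?f (target \<alpha>)))"
        proof
          fix \<alpha> assume "\<alpha> \<in> set (?ds @ map word_atom ?ts)"
          then consider "\<alpha> = letter_atom x l z" | "\<alpha> = Atom z {w'} y" | "\<alpha> \<in> set (ds @ map word_atom ts)"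
            using \<open>ts = t # ts'\<close> by auto
          then show "source \<alpha> \<in> ?V \<and> target \<alpha> \<in> ?V \<and>
            (\<exists>w\<in>lang \<alpha>. lpath (edges_pm G) (?f (source \<alpha>)) w (?f (target \<alpha>)))"
          proof cases
            case 1
            have "(?f x, l, ?f z) \<in> edges_pm G" using v f[OF xy(1)] by simp
            then have "\<exists>w\<in>lang \<alpha>. lpath (edges_pm G) (?f (source \<alpha>)) w (?f (target \<alpha>))"
              unfolding 1 letter_atom_path .
            moreover have "source \<alpha> \<in> ?V" "target \<alpha> \<in> ?V" using 1 xy(1) by (cases l; simp)+
            ultimately show ?thesis by (intro conjI)
          next
            case 2
            then show ?thesis using v f[OF xy(2)] xy(2) by simp
          next
            case 3
            from bspec[OF less.prems(5) this] show ?thesis using f by (simp del: fun_upd_apply)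
          qed
        qed
      qed (use less.prems in auto)
      then obtain c where c: "is_cq c" "c2rpq_tree_width c \<le> k" "length (outs c) = length os"
        "satisfies G (map ?f os) c" "\<And>(G' :: (nat, 'a) graph_db) us. satisfies G' us c \<Longrightarrow> satisfies G' us ?q'"
        by blast
      have os: "map ?f os = map f os" using z(1) less.prems(3) by auto
      have sub: "satisfies G' us ?q" if sat: "satisfies G' us ?q'" for G' :: "(nat, 'a) graph_db" and us
      proof -
        obtain g where g: "g ` ?V \<subseteq> nodes G'" "map g os = us"
          "\<forall>\<alpha>\<in>set (?ds @ map word_atom ?ts). \<exists>w\<in>lang \<alpha>. lpath (edges_pm G') (g (source \<alpha>)) w (g (target \<alpha>))"
          using sat by (auto simp: satisfies_def)
        have "(g x, l, g z) \<in> edges_pm G'" using g(3) letter_atom_path[of x l z G' g] by simp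
        moreover have "lpath (edges_pm G') (g z) w' (g y)" using g(3) by simp
        ultimately have "lpath (edges_pm G') (g x) w (g y)" using w by auto
        then show ?thesis
          unfolding satisfies_def \<open>ts = t # ts'\<close> t using g by (intro exI[of _ g]) auto
      qed
      show ?thesis
        by (intro exI[of _ c] conjI allI impI c(1-3) c(4)[unfolded os] sub[OF c(5)])
    qed
  qed
qed

text \<open>For each atom a word witnessing it in \<open>G\<close> is fixed. Replacing the languages
  by these single words gives a query that is contained in \<open>\<delta>\<close>, holds in
  \<open>G\<close> and has the same shape, to which \<open>expand_words\<close> applies.\<close>

lemma expansion:
  fixes G :: "('v, 'a) graph_db"
  assumes "2 \<le> k" "wf_graph_db G" "wf_c2rpq \<delta>" "c2rpq_tree_width \<delta> \<le> k" "satisfies G us \<delta>"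
  shows "\<exists>c. is_cq c \<and> c2rpq_tree_width c \<le> k \<and> length (outs c) = length (outs \<delta>) \<and> satisfies G us c \<and>
    (\<forall>(G' :: (nat, 'a) graph_db) us. satisfies G' us c \<longrightarrow> satisfies G' us \<delta>)"
proof -
  obtain f where f: "f ` vars \<delta> \<subseteq> nodes G" "map f (outs \<delta>) = us"
    "\<forall>\<alpha>\<in>set (atoms \<delta>). \<exists>w\<in>lang \<alpha>. lpath (edges_pm G) (f (source \<alpha>)) w (f (target \<alpha>))"
    using assms(5) by (auto simp: satisfies_def)
  then obtain w where w: "\<And>\<alpha>. \<alpha> \<in> set (atoms \<delta>) \<Longrightarrow> w \<alpha> \<in> lang \<alpha> \<and>
      lpath (edges_pm G) (f (source \<alpha>)) (w \<alpha>) (f (target \<alpha>))" by metis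
  obtain N r p bag where cert: "certifies k N r p bag \<delta>"
    using c2rpq_tree_width_le_iff[OF assms(3)] assms(4) by blast
  let ?ts = "map (\<lambda>\<alpha>. (source \<alpha>, w \<alpha>, target \<alpha>)) (atoms \<delta>)"
  let ?q = "\<lparr>outs = outs \<delta>, vars = vars \<delta>, atoms = [] @ map word_atom ?ts\<rparr> :: 'a c2rpq"
  have "\<exists>c. is_cq c \<and> c2rpq_tree_width c \<le> k \<and> length (outs c) = length (outs \<delta>) \<and> satisfies G (map f (outs \<delta>)) c \<and>
    (\<forall>(G' :: (nat, 'a) graph_db) us. satisfies G' us c \<longrightarrow> satisfies G' us ?q)"
  proof (rule expand_words[OF assms(1,2)])
    show "certifies k N r p bag ?q" using cert by (auto simp: certifies_def)
  qed (use f w assms(3) in \<open>auto simp: wf_c2rpq_def\<close>)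
  then obtain c where c: "is_cq c" "c2rpq_tree_width c \<le> k" "length (outs c) = length (outs \<delta>)"
    "satisfies G (map f (outs \<delta>)) c" "\<And>(G' :: (nat, 'a) graph_db) us. satisfies G' us c \<Longrightarrow> satisfies G' us ?q"
    by blast
  have sub: "satisfies G' us \<delta>" if sat: "satisfies G' us ?q" for G' :: "(nat, 'a) graph_db" and us
  proof -
    obtain g where "g ` vars \<delta> \<subseteq> nodes G'" "map g (outs \<delta>) = us"
      "\<forall>\<alpha>\<in>set (atoms \<delta>). lpath (edges_pm G') (g (source \<alpha>)) (w \<alpha>) (g (target \<alpha>))"
      using sat by (auto simp: satisfies_def)
    then show ?thesis unfolding satisfies_def using w by (intro exI[of _ g]) auto
  qed
  show ?thesis
    by (intro exI[of _ c] conjI allI impI c(1-3) c(4)[unfolded f(2)] sub[OF c(5)])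
qed

section \<open>Bounded approximations of a conjunctive query\<close>

definition canonical_db :: "'a c2rpq \<Rightarrow> (nat, 'a) graph_db" where
  "canonical_db \<delta> = \<lparr>nodes = vars \<delta>, edges = {(x, a, y). Atom x {[Fwd a]} y \<in> set (atoms \<delta>)}\<rparr>"

lemma cq_atom: "is_cq \<delta> \<Longrightarrow> \<alpha> \<in> set (atoms \<delta>) \<Longrightarrow> \<exists>a. \<alpha> = Atom (source \<alpha>) {[Fwd a]} (target \<alpha>)"
  unfolding is_cq_def by (metis atom.collapse)

text \<open>The edges are triples of a variable, a letter and a variable, so a finite alphabet makes
  their number finite.\<close>

lemma wf_canonical_db:
  fixes \<delta> :: "('a :: finite) c2rpq"
  assumes "is_cq \<delta>"
  shows "wf_graph_db (canonical_db \<delta>)"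
proof -
  have "finite (vars \<delta>)" using assms by (simp add: is_cq_def wf_c2rpq_def)
  moreover have "edges (canonical_db \<delta>) \<subseteq> vars \<delta> \<times> UNIV \<times> vars \<delta>"
    using assms by (force simp: canonical_db_def is_cq_def wf_c2rpq_def)
  moreover have "finite (vars \<delta> \<times> (UNIV :: 'a set) \<times> vars \<delta>)" using calculation by simp
  ultimately show ?thesis by (simp add: wf_graph_db_def canonical_db_def finite_subset)
qed

lemma satisfies_canonical_db:
  assumes "is_cq \<delta>"
  shows "satisfies (canonical_db \<delta>) (outs \<delta>) \<delta>"
proof -
  have "\<exists>w\<in>lang \<alpha>. lpath (edges_pm (canonical_db \<delta>)) (source \<alpha>) w (target \<alpha>)" if \<alpha>: "\<alpha> \<in> set (atoms \<delta>)" for \<alpha>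
  proof -
    obtain a where a: "\<alpha> = Atom (source \<alpha>) {[Fwd a]} (target \<alpha>)" using cq_atom assms \<alpha> by blast
    then have "(source \<alpha>, a, target \<alpha>) \<in> edges (canonical_db \<delta>)"
      using \<alpha> by (simp add: canonical_db_def)
    then have "lpath (edges_pm (canonical_db \<delta>)) (source \<alpha>) [Fwd a] (target \<alpha>)" by simp
    moreover have "[Fwd a] \<in> lang \<alpha>" by (subst a) simp
    ultimately show ?thesis by blast
  qed
  then show ?thesis unfolding satisfies_def by (intro exI[of _ id]) (simp add: canonical_db_def)
qed

text \<open>A satisfying assignment is a homomorphism from the canonical database, and homomorphisms
  preserve labelled paths, inverse letters included.\<close>

lemma canonical_db_hom:
  assumes "\<forall>\<alpha>\<in>set (atoms \<delta>). \<exists>w\<in>lang \<alpha>. lpath (edges_pm G) (g (source \<alpha>)) w (g (target \<alpha>))"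
    and "lpath (edges_pm (canonical_db \<delta>)) u w v"
  shows "lpath (edges_pm G) (g u) w (g v)"
proof (rule lpath_map[OF _ assms(2)])
  fix x l y assume "(x, l, y) \<in> edges_pm (canonical_db \<delta>)"
  then show "(g x, l, g y) \<in> edges_pm G"
  proof (rule edges_pm_map[rotated])
    fix x a y assume "(x, a, y) \<in> edges (canonical_db \<delta>)"
    then have "Atom x {[Fwd a]} y \<in> set (atoms \<delta>)" by (simp add: canonical_db_def)
    from bspec[OF assms(1) this] show "(g x, a, g y) \<in> edges G" by simp
  qed
qed

text \<open>The common word is nonempty so that both states are states of the automaton and the
  sublanguage between them is neither empty nor \<open>{[]}\<close>.\<close>

definition linked :: "('v \<times> 'l \<times> 'v) set \<Rightarrow> ('q \<times> 'l \<times> 'q) set \<Rightarrow> 'v \<times> 'q \<Rightarrow> 'v \<times> 'q \<Rightarrow> bool" where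
  "linked E D x y \<longleftrightarrow> (\<exists>w. w \<noteq> [] \<and> lpath E (fst x) w (fst y) \<and> lpath D (snd x) w (snd y))"

lemma transp_linked: "transp (linked E D)"
proof (rule transpI)
  fix x y z assume "linked E D x y" "linked E D y z"
  then obtain w w' where "w \<noteq> []" "lpath E (fst x) (w @ w') (fst z)" "lpath D (snd x) (w @ w') (snd z)"
    unfolding linked_def lpath_append by blast
  then show "linked E D x z" unfolding linked_def by blast
qed

lemma subseq_set: "subseq xs ys \<Longrightarrow> set xs \<subseteq> set ys"
  by (induction rule: list_emb.induct) auto

text \<open>Words concatenate, so being linked is transitive; a chain for a transitive relation
  relates all pairs in order and survives the omission of entries.\<close>

lemma linked_subseq:
  assumes "successively (linked E D) xs" "subseq ys xs"
  shows "successively (linked E D) ys"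
proof -
  have "sorted_wrt (linked E D) xs" using assms(1) successively_conv_sorted_wrt[OF transp_linked] by blast
  with assms(2) have "sorted_wrt (linked E D) ys"
    by (induction rule: list_emb.induct) (use subseq_set in fastforce)+
  then show ?thesis by (rule successively_if_sorted_wrt)
qed

lemma product_walk:
  assumes "lpath E u w v" "lpath D q w q'"
  shows "\<exists>xs. xs \<noteq> [] \<and> hd xs = (u, q) \<and> last xs = (v, q') \<and>
    successively (\<lambda>x y. \<exists>l. (fst x, l, fst y) \<in> E \<and> (snd x, l, snd y) \<in> D) xs"
  using assms
proof (induction w arbitrary: u q)
  case Nil
  then show ?case by (intro exI[of _ "[(u, q)]"]) auto
next
  case (Cons l w)
  then obtain t s where "(u, l, t) \<in> E" "(q, l, s) \<in> D" "lpath E t w v" "lpath D s w q'" by auto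
  moreover from this Cons.IH[of t s] obtain xs where "xs \<noteq> []" "hd xs = (t, s)" "last xs = (v, q')"
    "successively (\<lambda>x y. \<exists>l. (fst x, l, fst y) \<in> E \<and> (snd x, l, snd y) \<in> D) xs" by blast
  ultimately show ?case
    by (intro exI[of _ "(u, q) # xs"]) (auto simp: successively_Cons)
qed

lemma successively_invariant:
  assumes "successively P xs" "xs \<noteq> []" "Q (hd xs)" "\<And>x y. P x y \<Longrightarrow> Q y" "x \<in> set xs"
  shows "Q x"
  using assms(1-3,5)
proof (induction xs)
  case (Cons y ys)
  then show ?case using assms(4) by (cases ys) auto
qed simp

fun walk_atoms :: "('q, 'a letter) nfa \<Rightarrow> (nat \<times> 'q) list \<Rightarrow> 'a atom list" where
  "walk_atoms A (x # y # ys) =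
     Atom (fst x) (nfa_lang (sub_nfa A (snd x) (snd y))) (fst y) # walk_atoms A (y # ys)"
| "walk_atoms A _ = []"

lemma length_walk_atoms: "length (walk_atoms A ys) \<le> length ys"
  by (induction A ys rule: walk_atoms.induct) auto

lemma in_walk_atomsD:
  assumes "\<alpha> \<in> set (walk_atoms A ys)" "successively P ys" "successively Q ys"
  shows "\<exists>x\<in>set ys. \<exists>y\<in>set ys. P x y \<and> Q x y \<and> \<alpha> = Atom (fst x) (nfa_lang (sub_nfa A (snd x) (snd y))) (fst y)"
  using assms
proof (induction A ys rule: walk_atoms.induct)
  case (1 A x y ys)
  then have PQ: "P x y" "Q x y" "successively P (y # ys)" "successively Q (y # ys)" by simp_all
  from 1(2) consider "\<alpha> = Atom (fst x) (nfa_lang (sub_nfa A (snd x) (snd y))) (fst y)"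
    | "\<alpha> \<in> set (walk_atoms A (y # ys))" by auto
  then show ?case
  proof cases
    case 1
    then show ?thesis using PQ(1,2) by (intro bexI[of _ x] bexI[of _ y] conjI) simp_all
  next
    case 2
    from 1(1)[OF this PQ(3,4)] show ?thesis by (meson list.set_intros(2))
  qed
qed simp_all

text \<open>The words of the atoms are concatenated. A walk with one entry has no atoms; its ends
  coincide and the empty word serves.\<close>

lemma walk_atoms_path:
  assumes "ys \<noteq> []" "\<forall>\<alpha>\<in>set (walk_atoms A ys). \<exists>w\<in>lang \<alpha>. lpath E (g (source \<alpha>)) w (g (target \<alpha>))"
  shows "\<exists>w. lpath E (g (fst (hd ys))) w (g (fst (last ys))) \<and> lpath (delta A) (snd (hd ys)) w (snd (last ys))"
  using assms
proof (induction A ys rule: walk_atoms.induct)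
  case (1 A x y ys)
  then obtain w where "lpath E (g (fst y)) w (g (fst (last (y # ys)))) \<and> lpath (delta A) (snd y) w (snd (last (y # ys)))"
    by auto
  moreover obtain w' where "lpath E (g (fst x)) w' (g (fst y))" "lpath (delta A) (snd x) w' (snd y)"
    using 1(3) by auto
  ultimately show ?case
    by (intro exI[of _ "w' @ w"]) (auto simp: lpath_append)
qed (rule exI[of _ "[]"], simp)+

lemma lpath_walk_atoms:
  assumes "successively (linked E (delta A)) ys" "\<alpha> \<in> set (walk_atoms A ys)"
  shows "\<exists>w\<in>lang \<alpha>. lpath E (source \<alpha>) w (target \<alpha>)"
  using in_walk_atomsD[OF assms(2,1,1)] by (auto simp: linked_def)

text \<open>The two languages removed are those exempted in the closure condition on the class of
  languages.\<close>

definition sublanguages :: "('q, 'l) nfa \<Rightarrow> 'l lang set" where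
  "sublanguages A = {nfa_lang (sub_nfa A q q') | q q'. q \<in> states A \<and> q' \<in> states A} - {{}, {[]}}"

lemma finite_sublanguages: "wf_nfa A \<Longrightarrow> finite (sublanguages A)"
proof -
  assume "wf_nfa A"
  then have "finite ((\<lambda>(q, q'). nfa_lang (sub_nfa A q q')) ` (states A \<times> states A))" by (simp add: wf_nfa_def)
  then show ?thesis by (rule finite_subset[rotated]) (auto simp: sublanguages_def)
qed

lemma linked_sublanguages:
  assumes "wf_nfa A" "linked E (delta A) x y"
  shows "nfa_lang (sub_nfa A (snd x) (snd y)) \<in> sublanguages A"
proof -
  obtain w where w: "w \<noteq> []" "lpath (delta A) (snd x) w (snd y)" using assms(2) by (auto simp: linked_def)
  have "q \<in> states A \<and> q' \<in> states A" if "lpath (delta A) q w q'" "w \<noteq> []" for q w q'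
    using that
  proof (induction w arbitrary: q)
    case (Cons l w)
    then obtain t where t: "(q, l, t) \<in> delta A" "lpath (delta A) t w q'" by auto
    then have "q \<in> states A" "t \<in> states A" using assms(1) by (auto simp: wf_nfa_def)
    then show ?case using t Cons.IH by (cases w) auto
  qed simp
  from this[OF w(2,1)] show ?thesis using w unfolding sublanguages_def by auto
qed

text \<open>The candidates are, up to the names of the variables, the refinements of \<open>\<gamma>\<close> by sublanguages whose
  size is bounded in terms of \<open>\<gamma>\<close> and \<open>k\<close> only.\<close>

definition candidates :: "nat \<Rightarrow> nat \<Rightarrow> 'a letter lang set \<Rightarrow> 'a c2rpq set" where
  "candidates n B \<K> = {\<alpha>. length (outs \<alpha>) = n \<and> set (outs \<alpha>) \<subseteq> vars \<alpha> \<and> vars \<alpha> \<subseteq> {..<B} \<and>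
     length (atoms \<alpha>) \<le> B \<and>
     (\<forall>\<beta>\<in>set (atoms \<alpha>). source \<beta> \<in> vars \<alpha> \<and> target \<beta> \<in> vars \<alpha> \<and> lang \<beta> \<in> \<K>)}"

lemma finite_candidates:
  assumes "finite \<K>"
  shows "finite (candidates n B \<K>)"
proof -
  let ?At = "(\<lambda>(x, L, y). Atom x L y) ` ({..<B} \<times> \<K> \<times> {..<B})"
  let ?S = "{os. set os \<subseteq> {..<B} \<and> length os = n} \<times> Pow {..<B} \<times> {as. set as \<subseteq> ?At \<and> length as \<le> B}"
  have "finite ?S"
    using assms by (intro finite_cartesian_product finite_lists_length_eq finite_lists_length_le) auto
  moreover have "candidates n B \<K> \<subseteq> (\<lambda>(os, V, as). \<lparr>outs = os, vars = V, atoms = as\<rparr>) ` ?S"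
  proof
    fix \<alpha> assume \<alpha>: "\<alpha> \<in> candidates n B \<K>"
    have "\<beta> \<in> ?At" if "\<beta> \<in> set (atoms \<alpha>)" for \<beta>
    proof (rule image_eqI)
      show "\<beta> = (\<lambda>(x, L, y). Atom x L y) (source \<beta>, lang \<beta>, target \<beta>)" by simp
      show "(source \<beta>, lang \<beta>, target \<beta>) \<in> {..<B} \<times> \<K> \<times> {..<B}"
        using \<alpha> that unfolding candidates_def by blast
    qed
    then have "(outs \<alpha>, vars \<alpha>, atoms \<alpha>) \<in> ?S" using \<alpha> unfolding candidates_def by blast
    then show "\<alpha> \<in> (\<lambda>(os, V, as). \<lparr>outs = os, vars = V, atoms = as\<rparr>) ` ?S"
      by (intro image_eqI[of _ _ "(outs \<alpha>, vars \<alpha>, atoms \<alpha>)"]) auto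
  qed
  ultimately show ?thesis by (meson finite_imageI finite_subset)
qed

text \<open>The approximation is built on vertices of \<open>\<delta>\<close>, so an assignment for
  \<open>\<delta>\<close> restricts to it. Conversely, concatenating along the short-cut walks gives
  back an accepted word for every atom of \<open>\<gamma>\<close>. The bounds mention
  \<open>\<gamma>\<close> and k but not \<open>\<delta>\<close>.\<close>

lemma exists_candidate:
  fixes \<delta> :: "('a :: finite) c2rpq" and A :: "'a letter lang \<Rightarrow> (nat, 'a letter) nfa"
  assumes \<gamma>: "wf_c2rpq \<gamma>"
    and A: "\<And>\<beta>. \<beta> \<in> set (atoms \<gamma>) \<Longrightarrow> wf_nfa (A (lang \<beta>)) \<and> nfa_lang (A (lang \<beta>)) = lang \<beta>"
    and \<delta>: "is_cq \<delta>" "c2rpq_tree_width \<delta> \<le> k"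
    and sat: "satisfies (canonical_db \<delta>) (outs \<delta>) \<gamma>"
    and m: "m = length (atoms \<gamma>)"
    and b: "b = Suc (Suc (2 ^ card (vars \<gamma>) * 2 ^ (m * m) * (k + 2)))"
  shows "\<exists>\<alpha>\<in>candidates (length (outs \<gamma>)) (card (vars \<gamma>) + m * b) (\<Union>\<beta>\<in>set (atoms \<gamma>). sublanguages (A (lang \<beta>))).
    (\<exists>N r p bag. certifies k N r p bag \<alpha>) \<and>
    (\<forall>(G :: (nat, 'a) graph_db) us. satisfies G us \<alpha> \<longrightarrow> satisfies G us \<gamma>) \<and>
    (\<forall>(G :: (nat, 'a) graph_db) us. satisfies G us \<delta> \<longrightarrow> satisfies G us \<alpha>)"
proof -
  let ?G = "canonical_db \<delta>" and ?at = "\<lambda>j. atoms \<gamma> ! j"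
  let ?E = "edges_pm ?G" and ?A = "\<lambda>j. A (lang (?at j))"
  let ?\<K> = "\<Union>\<beta>\<in>set (atoms \<gamma>). sublanguages (A (lang \<beta>))"
  have wf\<delta>: "wf_c2rpq \<delta>" using \<delta> by (simp add: is_cq_def)
  obtain N r p bag where cert: "certifies k N r p bag \<delta>"
    using c2rpq_tree_width_le_iff[OF wf\<delta>] \<delta>(2) by blast
  obtain f where f: "f ` vars \<gamma> \<subseteq> vars \<delta>" "map f (outs \<gamma>) = outs \<delta>"
    "\<And>\<beta>. \<beta> \<in> set (atoms \<gamma>) \<Longrightarrow> \<exists>w\<in>lang \<beta>. lpath ?E (f (source \<beta>)) w (f (target \<beta>))"
    using sat unfolding satisfies_def by (auto simp: canonical_db_def)
  \<comment> \<open>All images count as terminals, not only ends of walks, so that output and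
    isolated variables of \<open>\<gamma>\<close> stay in the bags.\<close>
  define F where "F = f ` vars \<gamma>"
  have at: "?at j \<in> set (atoms \<gamma>)" if "j < m" for j using that m by simp
  have ends: "source (?at j) \<in> vars \<gamma>" "target (?at j) \<in> vars \<gamma>" if "j < m" for j
    using \<gamma> at[OF that] by (auto simp: wf_c2rpq_def)
  have step: "share_bag N bag u v" if "(u, l, v) \<in> ?E" for u l v
  proof -
    have *: "share_bag N bag x y" if "Atom x L y \<in> set (atoms \<delta>)" for x L y
      using that cert unfolding certifies_def by force
    show ?thesis using that by (cases l) (auto simp: canonical_db_def intro: * share_bag_sym)
  qed
  have step_vars: "v \<in> vars \<delta>" if "(u, l, v) \<in> ?E" for u l v
    using edges_pm_nodes[OF wf_canonical_db[OF \<delta>(1)] that] by (simp add: canonical_db_def)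
  define product_walk_of where "product_walk_of j xs \<longleftrightarrow> xs \<noteq> [] \<and>
      fst (hd xs) = f (source (?at j)) \<and> fst (last xs) = f (target (?at j)) \<and>
      snd (hd xs) \<in> init (?A j) \<and> snd (last xs) \<in> final (?A j) \<and>
      successively (linked ?E (delta (?A j))) xs \<and> bag_walk N bag xs \<and> fst ` set xs \<subseteq> vars \<delta>" for j xs
  have "\<exists>xs. product_walk_of j xs" if j: "j < m" for j
  proof -
    obtain w where w: "w \<in> lang (?at j)" "lpath ?E (f (source (?at j))) w (f (target (?at j)))"
      using f(3) at[OF j] by blast
    have "w \<in> nfa_lang (?A j)" using A[OF at[OF j]] w(1) by simp
    then obtain q q' where q: "q \<in> init (?A j)" "q' \<in> final (?A j)" "lpath (delta (?A j)) q w q'"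
      unfolding nfa_lang_def by blast
    obtain xs where xs: "xs \<noteq> []" "hd xs = (f (source (?at j)), q)" "last xs = (f (target (?at j)), q')"
      "successively (\<lambda>x y. \<exists>l. (fst x, l, fst y) \<in> ?E \<and> (snd x, l, snd y) \<in> delta (?A j)) xs"
      using product_walk[OF w(2) q(3)] by blast
    have "successively (linked ?E (delta (?A j))) xs"
    proof (rule successively_mono[OF xs(4)])
      fix x y :: "nat \<times> nat"
      assume "\<exists>l. (fst x, l, fst y) \<in> ?E \<and> (snd x, l, snd y) \<in> delta (?A j)"
      then obtain l where "lpath ?E (fst x) [l] (fst y)" "lpath (delta (?A j)) (snd x) [l] (snd y)" by auto
      then show "linked ?E (delta (?A j)) x y" unfolding linked_def by blast
    qed
    moreover have "bag_walk N bag xs" by (rule successively_mono[OF xs(4)]) (use step in blast)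
    moreover have "fst x \<in> vars \<delta>" if "x \<in> set xs" for x
    proof (rule successively_invariant[OF xs(4,1) _ _ that])
      show "fst (hd xs) \<in> vars \<delta>" using xs(2) ends(1)[OF j] f(1) by auto
    qed (use step_vars in blast)
    ultimately have "product_walk_of j xs" using xs q by (auto simp: product_walk_of_def)
    then show ?thesis ..
  qed
  then obtain xs where "\<And>j. j < m \<Longrightarrow> product_walk_of j (xs j)" by metis
  note xs = this[unfolded product_walk_of_def]
  have finV: "finite (vars \<gamma>)" using \<gamma> by (simp add: wf_c2rpq_def)
  then have cardF: "card F \<le> card (vars \<gamma>)" unfolding F_def by (rule card_image_le)
  \<comment> \<open>The map \<open>f\<close> may identify variables; the bound is stated with
    \<open>card (vars \<gamma>)\<close> to make it independent of \<open>f\<close>.\<close>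
  have "2 ^ card F \<le> (2 :: nat) ^ card (vars \<gamma>)" using cardF by simp
  then have bound: "Suc (Suc (2 ^ card F * 2 ^ (m * m) * (k + 2))) \<le> b"
    unfolding b Suc_le_mono by (intro mult_le_mono1)
  have "rooted_td N r p bag" "narrow k N bag" using cert by (auto simp: certifies_def)
  moreover have "finite F" unfolding F_def using finV by simp
  moreover have "F \<subseteq> \<Union>(bag ` N)" using f(1) cert by (auto simp: F_def certifies_def)
  moreover have "xs j \<noteq> [] \<and> bag_walk N bag (xs j) \<and> fst (hd (xs j)) \<in> F \<and> fst (last (xs j)) \<in> F" if "j < m" for j
    using xs[OF that] ends[OF that] by (simp add: F_def)
  ultimately have "\<exists>(N' :: nat set) r' p' bag' ys. rooted_td N' r' p' bag' \<and> narrow k N' bag' \<and> F \<subseteq> \<Union>(bag' ` N') \<and>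
    (\<forall>j<m. shortcut (ys j) (xs j) \<and> bag_walk N' bag' (ys j) \<and>
      length (ys j) \<le> Suc (Suc (2 ^ card F * 2 ^ (m * m) * (k + 2))))"
    by (rule bounded_shortcuts)
  then obtain N' :: "nat set" and r' p' bag' ys where td: "rooted_td N' r' p' bag'" "narrow k N' bag'" "F \<subseteq> \<Union>(bag' ` N')"
    and ys: "\<forall>j<m. shortcut (ys j) (xs j) \<and> bag_walk N' bag' (ys j) \<and>
      length (ys j) \<le> Suc (Suc (2 ^ card F * 2 ^ (m * m) * (k + 2)))"
    by - (elim exE conjE, rule that)
  note ys = ys[rule_format]
  have ys': "ys j \<noteq> []" "hd (ys j) = hd (xs j)" "last (ys j) = last (xs j)"
    "successively (linked ?E (delta (?A j))) (ys j)" "length (ys j) \<le> b" "bag_walk N' bag' (ys j)" if "j < m" for j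
    using ys[OF that] xs[OF that] linked_subseq[of ?E "delta (?A j)" "xs j" "ys j"] bound
    by (auto simp: shortcut_def)
  \<comment> \<open>The variables kept are the images of those of \<open>\<gamma>\<close> and the
    vertices still visited. Bags are cut down to \<open>W\<close> below, because the final renaming
    is injective only there.\<close>
  define W where "W = F \<union> (\<Union>j<m. fst ` set (ys j))"
  define q where "q = \<lparr>outs = outs \<delta>, vars = W, atoms = concat (map (\<lambda>j. walk_atoms (?A j) (ys j)) [0..<m])\<rparr>"
  have q_simps: "outs q = outs \<delta>" "vars q = W" "set (atoms q) = (\<Union>j<m. set (walk_atoms (?A j) (ys j)))"
    by (auto simp: q_def)
  have in_q: "\<exists>x\<in>set (ys j). \<exists>y\<in>set (ys j). share_bag N' bag' (fst x) (fst y) \<and>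
      linked ?E (delta (?A j)) x y \<and> \<beta> = Atom (fst x) (nfa_lang (sub_nfa (?A j) (snd x) (snd y))) (fst y)"
    if "\<beta> \<in> set (walk_atoms (?A j) (ys j))" "j < m" for \<beta> j
    using in_walk_atomsD[OF that(1) ys'(6)[OF that(2)] ys'(4)[OF that(2)]] .
  have q_atoms: "source \<beta> \<in> W \<and> target \<beta> \<in> W \<and> lang \<beta> \<in> ?\<K> \<and> share_bag N' bag' (source \<beta>) (target \<beta>) \<and>
      (\<exists>w\<in>lang \<beta>. lpath ?E (source \<beta>) w (target \<beta>))" if "\<beta> \<in> set (atoms q)" for \<beta>
  proof -
    obtain j where j: "j < m" "\<beta> \<in> set (walk_atoms (?A j) (ys j))" using \<open>\<beta> \<in> set (atoms q)\<close> q_simps by auto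
    obtain x y where xy: "x \<in> set (ys j)" "y \<in> set (ys j)" "share_bag N' bag' (fst x) (fst y)"
      "linked ?E (delta (?A j)) x y" "\<beta> = Atom (fst x) (nfa_lang (sub_nfa (?A j) (snd x) (snd y))) (fst y)"
      using in_q[OF j(2,1)] by blast
    have "nfa_lang (sub_nfa (?A j) (snd x) (snd y)) \<in> sublanguages (?A j)"
      using linked_sublanguages[OF _ xy(4)] A[OF at[OF j(1)]] by blast
    then have "lang \<beta> \<in> ?\<K>" using at[OF j(1)] xy(5) by auto
    moreover have "fst x \<in> W" "fst y \<in> W" using xy(1,2) j(1) by (auto simp: W_def)
    moreover have "\<exists>w\<in>lang \<beta>. lpath ?E (source \<beta>) w (target \<beta>)"
      using lpath_walk_atoms[OF ys'(4)[OF j(1)] j(2)] .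
    ultimately show ?thesis using xy(3,5) by simp
  qed
  have outs_F: "set (outs \<delta>) \<subseteq> F"
    using \<gamma> f(2) by (auto simp: F_def wf_c2rpq_def simp flip: f(2))
  have finW: "finite W" using finV by (simp add: W_def F_def)
  have "card (\<Union>j<m. fst ` set (ys j)) \<le> (\<Sum>j<m. card (fst ` set (ys j)))" by (rule card_UN_le) simp
  also have "\<dots> \<le> (\<Sum>j<m. b)"
  proof (rule sum_mono)
    fix j assume "j \<in> {..<m}"
    have "card (fst ` set (ys j)) \<le> length (ys j)" by (meson card_image_le card_length finite_set le_trans)
    then show "card (fst ` set (ys j)) \<le> b" using ys'(5)[of j] \<open>j \<in> {..<m}\<close> by simp
  qed
  finally have "card (\<Union>j<m. fst ` set (ys j)) \<le> m * b" by simp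
  then have cardW: "card W \<le> card (vars \<gamma>) + m * b"
    unfolding W_def using card_Un_le[of F "\<Union>j<m. fst ` set (ys j)"] cardF by linarith
  have "length (atoms q) = (\<Sum>j\<leftarrow>[0..<m]. length (walk_atoms (?A j) (ys j)))"
    by (simp add: q_def length_concat o_def)
  also have "\<dots> \<le> (\<Sum>j\<leftarrow>[0..<m]. b)"
  proof (rule sum_list_mono)
    fix j assume "j \<in> set [0..<m]"
    then show "length (walk_atoms (?A j) (ys j)) \<le> b"
      using length_walk_atoms[of "?A j" "ys j"] ys'(5)[of j] by simp
  qed
  finally have len: "length (atoms q) \<le> m * b" by (simp add: sum_list_triv)
  have W_bags: "W \<subseteq> \<Union>(bag' ` N')"
  proof -
    have "fst x \<in> \<Union>(bag' ` N')" if j: "j < m" and x: "x \<in> set (ys j)" for j x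
    proof (rule successively_invariant[OF ys'(6)[OF j] ys'(1)[OF j] _ _ x])
      show "fst (hd (ys j)) \<in> \<Union>(bag' ` N')"
        using xs[OF j] ys'(2)[OF j] ends[OF j] td(3) by (auto simp: F_def)
    qed (auto simp: share_bag_def)
    then show ?thesis using td(3) by (auto simp: W_def)
  qed
  have cert_q: "certifies k N' r' p' (\<lambda>t. bag' t \<inter> W) q"
    unfolding certifies_def
  proof (intro conjI ballI)
    show "rooted_td N' r' p' (\<lambda>t. bag' t \<inter> W)" using td(1) by (rule rooted_td_restrict)
    show "narrow k N' (\<lambda>t. bag' t \<inter> W)"
      using td(2) unfolding narrow_def by (metis card_mono finite_Int inf_le1 le_trans)
    show "vars q \<subseteq> (\<Union>t\<in>N'. bag' t \<inter> W)" using W_bags q_simps by auto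
    show "share_bag N' (\<lambda>t. bag' t \<inter> W) (source \<beta>) (target \<beta>)" if "\<beta> \<in> set (atoms q)" for \<beta>
      using q_atoms[OF that] unfolding share_bag_def by blast
  qed
  have q_\<gamma>: "satisfies G us \<gamma>" if sat: "satisfies G us q" for G :: "(nat, 'a) graph_db" and us
  proof -
    obtain g where g: "g ` W \<subseteq> nodes G" "map g (outs \<delta>) = us"
      "\<forall>\<beta>\<in>set (atoms q). \<exists>w\<in>lang \<beta>. lpath (edges_pm G) (g (source \<beta>)) w (g (target \<beta>))"
      using sat by (auto simp: satisfies_def q_simps(1,2))
    have "\<exists>w\<in>lang \<beta>. lpath (edges_pm G) (g (f (source \<beta>))) w (g (f (target \<beta>)))" if \<beta>: "\<beta> \<in> set (atoms \<gamma>)" for \<beta>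
    proof -
      obtain j where j: "j < m" "\<beta> = ?at j" using \<beta> m by (metis in_set_conv_nth)
      have "\<forall>\<beta>\<in>set (walk_atoms (?A j) (ys j)). \<exists>w\<in>lang \<beta>. lpath (edges_pm G) (g (source \<beta>)) w (g (target \<beta>))"
        using g(3) j(1) q_simps(3) by blast
      then obtain w where "lpath (edges_pm G) (g (fst (hd (ys j)))) w (g (fst (last (ys j))))"
        "lpath (delta (?A j)) (snd (hd (ys j))) w (snd (last (ys j)))"
        using walk_atoms_path[OF ys'(1)[OF j(1)]] by blast
      moreover have "w \<in> nfa_lang (?A j)"
        using calculation(2) xs[OF j(1)] ys'(2,3)[OF j(1)] by (auto simp: nfa_lang_def)
      ultimately show ?thesis using A[OF \<beta>] xs[OF j(1)] ys'(2,3)[OF j(1)] j(2) by auto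
    qed
    moreover have "(g \<circ> f) ` vars \<gamma> \<subseteq> nodes G" using g(1) by (auto simp: W_def F_def)
    moreover have "map (g \<circ> f) (outs \<gamma>) = us" using g(2) f(2) by (metis map_map)
    ultimately show ?thesis unfolding satisfies_def by (intro exI[of _ "g \<circ> f"]) simp
  qed
  have \<delta>_q: "satisfies G us q" if sat: "satisfies G us \<delta>" for G :: "(nat, 'a) graph_db" and us
  proof -
    obtain g where g: "g ` vars \<delta> \<subseteq> nodes G" "map g (outs \<delta>) = us"
      "\<forall>\<beta>\<in>set (atoms \<delta>). \<exists>w\<in>lang \<beta>. lpath (edges_pm G) (g (source \<beta>)) w (g (target \<beta>))"
      using sat by (auto simp: satisfies_def)
    have "fst x \<in> vars \<delta>" if "j < m" "x \<in> set (ys j)" for j x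
    proof -
      have "subseq (ys j) (xs j)" using ys[OF that(1)] by (simp add: shortcut_def)
      then have "x \<in> set (xs j)" using subseq_set that(2) by blast
      then show ?thesis using xs[OF that(1)] by blast
    qed
    then have "W \<subseteq> vars \<delta>" using f(1) unfolding W_def F_def by blast
    then have "g ` W \<subseteq> nodes G" using g(1) by blast
    moreover have "\<exists>w\<in>lang \<beta>. lpath (edges_pm G) (g (source \<beta>)) w (g (target \<beta>))" if "\<beta> \<in> set (atoms q)" for \<beta>
    proof -
      from q_atoms[OF that] obtain w where "w \<in> lang \<beta>" "lpath ?E (source \<beta>) w (target \<beta>)" by blast
      then show ?thesis using canonical_db_hom[OF g(3)] by blast
    qed
    ultimately show ?thesis unfolding satisfies_def q_simps(1,2) using g(2) by (intro exI[of _ g] conjI ballI)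
  qed
  \<comment> \<open>The variables are vertices of the unbounded query \<open>\<delta>\<close>;
    compressing them to an initial segment puts the query among finitely many.\<close>
  obtain \<rho> :: "nat \<Rightarrow> nat" and n where \<rho>: "\<rho> ` W = {i. i < n}" "inj_on \<rho> W"
    using finite_imp_inj_to_nat_seg[OF finW] by blast
  have n: "n = card W" using card_image[OF \<rho>(2)] \<rho>(1) by simp
  let ?\<alpha> = "rename \<rho> q"
  have "?\<alpha> \<in> candidates (length (outs \<gamma>)) (card (vars \<gamma>) + m * b) ?\<K>"
    unfolding candidates_def
  proof (intro CollectI conjI ballI)
    show "length (outs ?\<alpha>) = length (outs \<gamma>)" using f(2) by (auto simp: rename_def q_simps simp flip: f(2))
    show "set (outs ?\<alpha>) \<subseteq> vars ?\<alpha>" using outs_F by (auto simp: rename_def q_simps W_def)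
    show "vars ?\<alpha> \<subseteq> {..<card (vars \<gamma>) + m * b}" using \<rho>(1) n cardW by (auto simp: rename_def q_simps)
    show "length (atoms ?\<alpha>) \<le> card (vars \<gamma>) + m * b" using len by (simp add: rename_def)
    fix \<beta> assume "\<beta> \<in> set (atoms ?\<alpha>)"
    then obtain \<beta>' where \<beta>': "\<beta>' \<in> set (atoms q)" "\<beta> = rename_atom \<rho> \<beta>'" by (auto simp: rename_def)
    then show "source \<beta> \<in> vars ?\<alpha>" "target \<beta> \<in> vars ?\<alpha>" "lang \<beta> \<in> ?\<K>"
      using q_atoms[OF \<beta>'(1)] unfolding \<beta>'(2) rename_atom_simps by (simp_all add: rename_def q_simps)
  qed
  moreover have cert_\<alpha>: "certifies k N' r' p' (\<lambda>t. \<rho> ` (bag' t \<inter> W)) ?\<alpha>"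
  proof (rule certifies_rename[OF cert_q])
    interpret R: rooted_td N' r' p' "\<lambda>t. bag' t \<inter> W" using cert_q by (simp add: certifies_def)
    show "rooted_td N' r' p' (\<lambda>t. \<rho> ` (bag' t \<inter> W))"
      by (rule R.rooted_td_image_inj) (rule inj_on_subset[OF \<rho>(2)], blast)
  qed
  moreover have "satisfies G us ?\<alpha>" if "satisfies G us \<delta>" for G :: "(nat, 'a) graph_db" and us
    using \<delta>_q[OF that] q_atoms outs_F \<rho>(2) by (intro satisfies_renameI) (auto simp: q_simps W_def)
  moreover have "satisfies G us \<gamma>" if "satisfies G us ?\<alpha>" for G :: "(nat, 'a) graph_db" and us
    using q_\<gamma> satisfies_renameD[OF that] .
  moreover have "\<exists>N r p bag. certifies k N r p bag ?\<alpha>" using cert_\<alpha> by (intro exI)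
  ultimately show ?thesis by (intro bexI[of _ ?\<alpha>] conjI allI impI)
qed

section \<open>From single queries to unions\<close>

lemma uc2rpq_tree_width_le_iff:
  assumes "finite \<Delta>"
  shows "uc2rpq_tree_width \<Delta> \<le> k \<longleftrightarrow> (\<forall>\<delta>\<in>\<Delta>. c2rpq_tree_width \<delta> \<le> k)"
proof (cases "\<Delta> = {}")
  case True
  then show ?thesis by (simp add: uc2rpq_tree_width_def)
next
  case False
  then show ?thesis unfolding uc2rpq_tree_width_def
    using assms by (intro cSUP_le_iff) auto
qed

lemma expand_uc2rpq:
  assumes "2 \<le> k" "\<Delta> \<in> UC2RPQ" "uc2rpq_tree_width \<Delta> \<le> k"
  shows "\<exists>\<Theta>. infinitary_union \<Theta> \<and> (\<forall>\<theta>\<in>\<Theta>. is_cq \<theta> \<and> c2rpq_tree_width \<theta> \<le> k) \<and> equivalent \<Delta> \<Theta>"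
proof -
  \<comment> \<open>All conjunctive queries of small tree-width below a member of
    \<open>\<Delta>\<close> are taken at once. One inclusion is then immediate, and
    \<open>expansion\<close> supplies the other database by database.\<close>
  define \<Theta> where "\<Theta> = {\<theta>. is_cq \<theta> \<and> c2rpq_tree_width \<theta> \<le> k \<and> (\<exists>\<delta>\<in>\<Delta>. length (outs \<theta>) = length (outs \<delta>) \<and>
    (\<forall>(G :: (nat, 'a) graph_db) us. satisfies G us \<theta> \<longrightarrow> satisfies G us \<delta>))}"
  have fin: "finite \<Delta>" and iu: "infinitary_union \<Delta>" using assms(2) by (auto simp: UC2RPQ_def)
  obtain n where n: "\<forall>\<delta>\<in>\<Delta>. length (outs \<delta>) = n" using iu by (auto simp: infinitary_union_def)
  then have "\<forall>\<theta>\<in>\<Theta>. length (outs \<theta>) = n" by (auto simp: \<Theta>_def)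
  moreover have "\<forall>\<theta>\<in>\<Theta>. wf_c2rpq \<theta>" by (auto simp: \<Theta>_def is_cq_def)
  ultimately have "infinitary_union \<Theta>" unfolding infinitary_union_def by blast
  moreover have "equivalent \<Delta> \<Theta>"
    unfolding equivalent_def satisfies_union_def
  proof (intro allI impI iffI)
    fix G :: "(nat, 'a) graph_db" and us
    assume G: "wf_graph_db G"
    assume "\<exists>\<delta>\<in>\<Delta>. satisfies G us \<delta>"
    then obtain \<delta> where \<delta>: "\<delta> \<in> \<Delta>" "satisfies G us \<delta>" by blast
    have "wf_c2rpq \<delta>" "c2rpq_tree_width \<delta> \<le> k"
      using \<delta>(1) iu uc2rpq_tree_width_le_iff[OF fin] assms(3) by (auto simp: infinitary_union_def)
    from expansion[OF assms(1) G this \<delta>(2)] show "\<exists>\<theta>\<in>\<Theta>. satisfies G us \<theta>"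
      using \<delta>(1) unfolding \<Theta>_def by blast
  next
    fix G :: "(nat, 'a) graph_db" and us
    assume "\<exists>\<theta>\<in>\<Theta>. satisfies G us \<theta>"
    then show "\<exists>\<delta>\<in>\<Delta>. satisfies G us \<delta>" unfolding \<Theta>_def by blast
  qed
  ultimately show ?thesis unfolding \<Theta>_def by blast
qed

lemma equivalent_trans: "equivalent \<Gamma> \<Delta> \<Longrightarrow> equivalent \<Delta> \<Theta> \<Longrightarrow> equivalent \<Gamma> \<Theta>"
  by (simp add: equivalent_def)

text \<open>A member of \<open>\<Theta>\<close> is contained in \<open>\<Gamma>\<close>, and
  evaluating \<open>\<Gamma>\<close> on its canonical database singles out one
  \<open>\<gamma>\<close>. A bounded candidate then fits between the two.\<close>

lemma approximate_uc2rpq: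
  fixes \<L> :: "('a :: finite) letter lang set"
  assumes reg: "\<forall>L\<in>\<L>. regular L"
    and closed: "closed_under_sublanguages \<L>"
    and \<Gamma>: "\<Gamma> \<in> UC2RPQ_over \<L>"
    and \<Theta>: "\<forall>\<theta>\<in>\<Theta>. is_cq \<theta> \<and> c2rpq_tree_width \<theta> \<le> k" "equivalent \<Gamma> \<Theta>"
  shows "\<exists>\<Delta>\<in>UC2RPQ_over \<L>. equivalent \<Gamma> \<Delta> \<and> uc2rpq_tree_width \<Delta> \<le> k"
proof -
  have fin: "finite \<Gamma>" and wf: "\<And>\<gamma>. \<gamma> \<in> \<Gamma> \<Longrightarrow> wf_c2rpq \<gamma>"
    and lang: "\<And>\<gamma> \<beta>. \<gamma> \<in> \<Gamma> \<Longrightarrow> \<beta> \<in> set (atoms \<gamma>) \<Longrightarrow> lang \<beta> \<in> \<L>"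
    using \<Gamma> by (auto simp: UC2RPQ_over_def UC2RPQ_def infinitary_union_def)
  obtain n where n: "\<And>\<gamma>. \<gamma> \<in> \<Gamma> \<Longrightarrow> length (outs \<gamma>) = n"
    using \<Gamma> by (auto simp: UC2RPQ_over_def UC2RPQ_def infinitary_union_def)
  have "\<forall>L\<in>\<L>. \<exists>A :: (nat, 'a letter) nfa. wf_nfa A \<and> nfa_lang A = L \<and> sublanguages A \<subseteq> \<L>"
  proof
    fix L assume "L \<in> \<L>"
    from bspec[OF conjunct2[OF closed[unfolded closed_under_sublanguages_def]] this]
    obtain A :: "(nat, 'a letter) nfa" where A: "wf_nfa A" "nfa_lang A = L"
      "\<forall>q\<in>states A. \<forall>q'\<in>states A. nfa_lang (sub_nfa A q q') \<noteq> {} \<and> nfa_lang (sub_nfa A q q') \<noteq> {[]}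
             \<longrightarrow> nfa_lang (sub_nfa A q q') \<in> \<L>"
      by - (elim exE conjE, rule that)
    have "sublanguages A \<subseteq> \<L>"
    proof
      fix L' assume "L' \<in> sublanguages A"
      then obtain q q' where "q \<in> states A" "q' \<in> states A" "L' = nfa_lang (sub_nfa A q q')" "L' \<noteq> {}" "L' \<noteq> {[]}"
        unfolding sublanguages_def by blast
      then show "L' \<in> \<L>" using bspec[OF bspec[OF A(3)], of q q'] by metis
    qed
    then show "\<exists>A :: (nat, 'a letter) nfa. wf_nfa A \<and> nfa_lang A = L \<and> sublanguages A \<subseteq> \<L>" using A(1,2) by blast
  qed
  then obtain A :: "'a letter lang \<Rightarrow> (nat, 'a letter) nfa"
    where A: "\<And>L. L \<in> \<L> \<Longrightarrow> wf_nfa (A L) \<and> nfa_lang (A L) = L \<and> sublanguages (A L) \<subseteq> \<L>" by metis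
  define K where "K \<gamma> = (\<Union>\<beta>\<in>set (atoms \<gamma>). sublanguages (A (lang \<beta>)))" for \<gamma> :: "'a c2rpq"
  define m where "m \<gamma> = length (atoms \<gamma>)" for \<gamma> :: "'a c2rpq"
  define b where "b \<gamma> = Suc (Suc (2 ^ card (vars \<gamma>) * 2 ^ (m \<gamma> * m \<gamma>) * (k + 2)))" for \<gamma> :: "'a c2rpq"
  define B where "B \<gamma> = card (vars \<gamma>) + m \<gamma> * b \<gamma>" for \<gamma> :: "'a c2rpq"
  \<comment> \<open>Sizes and languages are bounded by \<open>\<gamma>\<close> and k alone, whence
    finiteness. Containment in \<open>\<Gamma>\<close> is imposed, so only the other inclusion
    requires an argument.\<close>
  define \<Delta> where "\<Delta> = {\<alpha> \<in> (\<Union>\<gamma>\<in>\<Gamma>. candidates n (B \<gamma>) (K \<gamma>)). c2rpq_tree_width \<alpha> \<le> k \<and>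
    (\<exists>\<gamma>\<in>\<Gamma>. \<forall>(G :: (nat, 'a) graph_db) us. satisfies G us \<alpha> \<longrightarrow> satisfies G us \<gamma>)}"
  have K: "K \<gamma> \<subseteq> \<L>" "finite (K \<gamma>)" if "\<gamma> \<in> \<Gamma>" for \<gamma>
  proof -
    show "K \<gamma> \<subseteq> \<L>" unfolding K_def
    proof (rule UN_least)
      fix \<beta> assume "\<beta> \<in> set (atoms \<gamma>)"
      from A[OF lang[OF that this]] show "sublanguages (A (lang \<beta>)) \<subseteq> \<L>" by (elim conjE)
    qed
    show "finite (K \<gamma>)" unfolding K_def
    proof (rule finite_UN_I)
      fix \<beta> assume "\<beta> \<in> set (atoms \<gamma>)"
      from A[OF lang[OF that this]] show "finite (sublanguages (A (lang \<beta>)))"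
        by (intro finite_sublanguages) (elim conjE)
    qed simp
  qed
  have cand: "wf_c2rpq \<alpha> \<and> (\<forall>\<beta>\<in>set (atoms \<alpha>). lang \<beta> \<in> \<L>) \<and> length (outs \<alpha>) = n"
    if "\<gamma> \<in> \<Gamma>" "\<alpha> \<in> candidates n (B \<gamma>) (K \<gamma>)" for \<alpha> \<gamma>
  proof -
    have \<alpha>: "length (outs \<alpha>) = n" "set (outs \<alpha>) \<subseteq> vars \<alpha>" "vars \<alpha> \<subseteq> {..<B \<gamma>}"
      "\<And>\<beta>. \<beta> \<in> set (atoms \<alpha>) \<Longrightarrow> source \<beta> \<in> vars \<alpha> \<and> target \<beta> \<in> vars \<alpha> \<and> lang \<beta> \<in> \<L>"
      using that(2) K(1)[OF that(1)] unfolding candidates_def by blast+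
    have "finite (vars \<alpha>)" using \<alpha>(3) finite_subset by blast
    then show ?thesis using \<alpha> reg unfolding wf_c2rpq_def by blast
  qed
  have "finite (\<Union>\<gamma>\<in>\<Gamma>. candidates n (B \<gamma>) (K \<gamma>))" using fin K(2) finite_candidates by blast
  then have fin\<Delta>: "finite \<Delta>" unfolding \<Delta>_def by (rule finite_subset[rotated]) blast
  have \<Delta>: "wf_c2rpq \<alpha> \<and> (\<forall>\<beta>\<in>set (atoms \<alpha>). lang \<beta> \<in> \<L>) \<and> length (outs \<alpha>) = n" if "\<alpha> \<in> \<Delta>" for \<alpha>
    using that cand unfolding \<Delta>_def by blast
  then have "\<Delta> \<in> UC2RPQ_over \<L>"
    using fin\<Delta> unfolding UC2RPQ_over_def UC2RPQ_def infinitary_union_def by blast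
  moreover have "uc2rpq_tree_width \<Delta> \<le> k"
    using uc2rpq_tree_width_le_iff[OF fin\<Delta>] unfolding \<Delta>_def by blast
  moreover have "equivalent \<Gamma> \<Delta>"
    unfolding equivalent_def satisfies_union_def
  proof (intro allI impI iffI)
    fix G :: "(nat, 'a) graph_db" and us
    assume G: "wf_graph_db G"
    assume "\<exists>\<gamma>\<in>\<Gamma>. satisfies G us \<gamma>"
    then obtain \<theta> where \<theta>: "\<theta> \<in> \<Theta>" "satisfies G us \<theta>"
      using \<Theta>(2) G unfolding equivalent_def satisfies_union_def by blast
    have cq: "is_cq \<theta>" "c2rpq_tree_width \<theta> \<le> k" using \<Theta>(1) \<theta>(1) by auto
    \<comment> \<open>The canonical database satisfies \<open>\<theta>\<close>, hence by equivalence
      some member of \<open>\<Gamma>\<close>. This member varies with \<open>\<theta>\<close>, which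
      is harmless because \<open>\<Gamma>\<close> is finite.\<close>
    obtain \<gamma> where \<gamma>: "\<gamma> \<in> \<Gamma>" "satisfies (canonical_db \<theta>) (outs \<theta>) \<gamma>"
      using \<Theta>(2) wf_canonical_db[OF cq(1)] satisfies_canonical_db[OF cq(1)] \<theta>(1)
      unfolding equivalent_def satisfies_union_def by blast
    have "wf_nfa (A (lang \<beta>)) \<and> nfa_lang (A (lang \<beta>)) = lang \<beta>" if "\<beta> \<in> set (atoms \<gamma>)" for \<beta>
      using A[OF lang[OF \<gamma>(1) that]] by blast
    from exists_candidate[OF wf[OF \<gamma>(1)] this cq \<gamma>(2) m_def b_def] obtain \<alpha> where
      \<alpha>: "\<alpha> \<in> candidates n (B \<gamma>) (K \<gamma>)" "\<exists>N r p bag. certifies k N r p bag \<alpha>"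
      "\<And>(G :: (nat, 'a) graph_db) us. satisfies G us \<alpha> \<Longrightarrow> satisfies G us \<gamma>"
      "\<And>(G :: (nat, 'a) graph_db) us. satisfies G us \<theta> \<Longrightarrow> satisfies G us \<alpha>"
      unfolding B_def[symmetric] K_def[symmetric] n[OF \<gamma>(1)] by blast
    have "c2rpq_tree_width \<alpha> \<le> k"
      using c2rpq_tree_width_le_iff cand[OF \<gamma>(1) \<alpha>(1)] \<alpha>(2) by blast
    then have "\<alpha> \<in> \<Delta>" using \<alpha>(1,3) \<gamma>(1) unfolding \<Delta>_def by blast
    then show "\<exists>\<alpha>\<in>\<Delta>. satisfies G us \<alpha>" using \<alpha>(4) \<theta>(2) by blast
  next
    fix G :: "(nat, 'a) graph_db" and us
    assume "\<exists>\<alpha>\<in>\<Delta>. satisfies G us \<alpha>"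
    then show "\<exists>\<gamma>\<in>\<Gamma>. satisfies G us \<gamma>" unfolding \<Delta>_def by blast
  qed
  ultimately show ?thesis by blast
qed

theorem theorem3p13:
  fixes \<L> :: "('a::finite) letter lang set"
    and k :: nat
    and \<Gamma> :: "'a c2rpq set"
  assumes "\<forall>L\<in>\<L>. regular L"
    and "closed_under_sublanguages \<L>"
    and "k > 1"
    and "\<Gamma> \<in> UC2RPQ_over \<L>"
  shows
    "((\<exists>\<Delta>. infinitary_union \<Delta> \<and> (\<forall>\<delta>\<in>\<Delta>. is_cq \<delta> \<and> c2rpq_tree_width \<delta> \<le> k) \<and> equivalent \<Gamma> \<Delta>)
        \<longleftrightarrow> semantic_tree_width_at_most \<Gamma> k) \<and>
     (semantic_tree_width_at_most \<Gamma> k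
        \<longleftrightarrow> (\<exists>\<Delta>\<in>UC2RPQ_over \<L>. equivalent \<Gamma> \<Delta> \<and> uc2rpq_tree_width \<Delta> \<le> k))"
  (is "(?cqs \<longleftrightarrow> ?sem) \<and> (?sem \<longleftrightarrow> ?over)")
proof -
  \<comment> \<open>The implications run in a circle: from (1) to (3), from (3) to (2), and from (2)
    back to (1) by expansion.\<close>
  have "?over" if "?cqs"
    using that approximate_uc2rpq[OF assms(1,2,4)] by blast
  moreover have "?sem" if "?over"
    using that unfolding semantic_tree_width_at_most_def UC2RPQ_over_def by blast
  moreover have "?cqs" if "?sem"
  proof -
    from that obtain \<Delta> where \<Delta>: "\<Delta> \<in> UC2RPQ" "equivalent \<Gamma> \<Delta>" "uc2rpq_tree_width \<Delta> \<le> k"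
      unfolding semantic_tree_width_at_most_def by blast
    have "2 \<le> k" using assms(3) by simp
    from expand_uc2rpq[OF this \<Delta>(1,3)] show ?thesis using equivalent_trans[OF \<Delta>(2)] by blast
  qed
  ultimately show ?thesis by blast
qed

end
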